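(* Let $G$ be an additive arithmetical semigroup with set of primes $P$ and degree mapping $\partial\colon G\to\mathbf{R}$, and suppose that the number $\pi_G^\#(x)$ of primes $p\in P$ with $\partial(p)\le x$ satisfies $$\pi_G^\#(x)=\rho x^{\gamma}e^{x}\bigl(1+O(x^{-\delta})\bigr),\qquad x\to\infty,$$ for some constants $\rho>0$, $\gamma>-1$, and $\delta\in(0,1]$. Let $k\ge 2$ be an integer, let $\mathcal N_{G,k}^\#(x)$ be the number of $k$-th power-free elements $a\in G$ with $\partial(a)\le x$, and let $\zeta_{G,k}(s)=\sum_{a\in G_k}e^{-\partial(a)s}$, $\operatorname{Re}s>1$, where $G_k\subset G$ is the set of $k$-th power-free elements. Let $\kappa>0$ be an arbitrary number such that $$\kappa<\frac{\delta}{2+\gamma}\qquad\text{and}\qquad \kappa\le\frac{1+\gamma}{2+\gamma}.$$ Then, as $x\to\infty$, $$\mathcal N_{G,k}^\#(x)=\left.\frac{e^{xs}\,\zeta_{G,k}(s)}{\sqrt{2\pi\,(\ln\zeta_{G,k}(s))''}}\right|_{s=\beta(x)}\bigl(1+O(x^{-\kappa})\bigr),$$ where $s=\beta(x)>1$ is the unique real solution of the equation $$x+(\ln\zeta_{G,k}(s))'=0,$$ and primes on functions denote derivatives with respect to $s$.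
   Context: An additive arithmetical semigroup is a commutative semigroup $G$ (written multiplicatively) with identity element $1$ such that: (a) there is a (uniquely determined) countable subset $P\subset G$, whose elements are called the primes of $G$, such that every $a\in G$, $a\ne1$, has a factorization $a=p_1^{n_1}p_2^{n_2}\cdots p_s^{n_s}$ with positive integers $s,n_1,\dots,n_s$ and $p_1,\dots,p_s\in P$, unique up to the order of factors; (b) a mapping $\partial\colon G\to\mathbf{R}$ (the degree mapping) is given such that $\partial(1)=0$, $\partial(p)>0$ for all $p\in P$, $\partial(ab)=\partial(a)+\partial(b)$ for all $a,b\in G$, and for every $x>0$ the number of elements $a\in G$ with $\partial(a)\le x$ is finite. For an integer $k\ge2$, an element $a\in G$ is called $k$-th power-free if it has no divisors of the form $b^k$ with $1\ne b\in G$ (equivalently, every prime occurs in the factorization of $a$ with exponent at most $k-1$). The set of $k$-th power-free elements is denoted by $G_k$. Under the stated assumption on $\pi_G^\#$, the series defining $\zeta_{G,k}(s)$ converges absolutely in the half-plane $\operatorname{Re}s>1$, and $\zeta_{G,k}(s)=\prod_{p\in P}\frac{1-e^{-\partial(p)sk}}{1-e^{-\partial(p)s}}$ there. For real $s>1$, $\zeta_{G,k}(s)>0$ and $\ln\zeta_{G,k}(s)$ is the real logarithm. *)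

theory Defs
  imports "HOL-Analysis.Analysis" "HOL-Library.Landau_Symbols" "HOL-Library.Multiset"
begin

text \<open>
  The semigroup is the whole type. A factorization into prime powers, up to the order of the
  factors, is a multiset of primes; it is nonempty because it has \<open>s > 0\<close> factors with positive
  exponents.
\<close>

locale additive_arithmetical_semigroup =
  fixes P :: "'a::comm_monoid_mult set"
    and deg :: "'a \<Rightarrow> real"
  assumes countable_primes: "countable P"
    and unique_factorization:
      "a \<noteq> 1 \<Longrightarrow> \<exists>!M. M \<noteq> {#} \<and> set_mset M \<subseteq> P \<and> prod_mset M = a"
    and deg_one: "deg 1 = 0"
    and deg_prime_pos: "p \<in> P \<Longrightarrow> deg p > 0"
    and deg_mult: "deg (a * b) = deg a + deg b"
    and finite_deg_le: "x > 0 \<Longrightarrow> finite {a. deg a \<le> x}"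

definition prime_count :: "'a set \<Rightarrow> ('a \<Rightarrow> real) \<Rightarrow> real \<Rightarrow> nat" where
  "prime_count P deg x = card {p \<in> P. deg p \<le> x}"

definition power_free :: "nat \<Rightarrow> 'a::comm_monoid_mult \<Rightarrow> bool" where
  "power_free k a \<longleftrightarrow> (\<nexists>b. b \<noteq> 1 \<and> b ^ k dvd a)"

definition power_free_count :: "('a::comm_monoid_mult \<Rightarrow> real) \<Rightarrow> nat \<Rightarrow> real \<Rightarrow> nat" where
  "power_free_count deg k x = card {a. power_free k a \<and> deg a \<le> x}"

definition zeta :: "('a::comm_monoid_mult \<Rightarrow> real) \<Rightarrow> nat \<Rightarrow> complex \<Rightarrow> complex" where
  "zeta deg k s = (\<Sum>\<^sub>\<infinity>a\<in>{a. power_free k a}. exp (- complex_of_real (deg a) * s))"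

text \<open>On the real axis every term of the series is a positive real, so \<^const>\<open>Re\<close> only changes the type.\<close>

definition zeta_real :: "('a::comm_monoid_mult \<Rightarrow> real) \<Rightarrow> nat \<Rightarrow> real \<Rightarrow> real" where
  "zeta_real deg k s = Re (zeta deg k (complex_of_real s))"

definition ln_zeta :: "('a::comm_monoid_mult \<Rightarrow> real) \<Rightarrow> nat \<Rightarrow> real \<Rightarrow> real" where
  "ln_zeta deg k s = ln (zeta_real deg k s)"

definition saddle_eq :: "('a::comm_monoid_mult \<Rightarrow> real) \<Rightarrow> nat \<Rightarrow> real \<Rightarrow> real \<Rightarrow> bool" where
  "saddle_eq deg k x s \<longleftrightarrow> s > 1 \<and> x + deriv (ln_zeta deg k) s = 0"

definition saddle_point :: "('a::comm_monoid_mult \<Rightarrow> real) \<Rightarrow> nat \<Rightarrow> real \<Rightarrow> real" where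
  "saddle_point deg k x = (THE s. saddle_eq deg k x s)"

definition saddle_term :: "('a::comm_monoid_mult \<Rightarrow> real) \<Rightarrow> nat \<Rightarrow> real \<Rightarrow> real \<Rightarrow> real" where
  "saddle_term deg k x s =
     exp (x * s) * zeta_real deg k s / sqrt (2 * pi * deriv (deriv (ln_zeta deg k)) s)"

text \<open>\<open>f(x) = g(x) (1 + O(h(x)))\<close> as \<open>x \<rightarrow> \<infinity>\<close>.\<close>

definition eq_times_one_plus_bigo :: "(real \<Rightarrow> real) \<Rightarrow> (real \<Rightarrow> real) \<Rightarrow> (real \<Rightarrow> real) \<Rightarrow> bool" where
  "eq_times_one_plus_bigo f g h \<longleftrightarrow>
     (\<exists>\<epsilon>. \<epsilon> \<in> O[at_top](h) \<and> (\<forall>\<^sub>F x in at_top. f x = g x * (1 + \<epsilon> x)))"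

end

theory Submission imports Defs "HOL-Probability.Probability" begin

text \<open>
  Write \<open>s = \<beta>(x) = 1 + e\<close> and weight each power-free \<open>a\<close> by \<open>exp (- deg a * s) / \<zeta>(s)\<close>. Under this
  probability measure \<open>deg\<close> is a sum of independent truncated geometric variables, one for each
  prime, with mean \<open>- (ln \<zeta>)'(s) = x\<close> and variance \<open>B = (ln \<zeta>)''(s)\<close>, and the claim becomes a local
  limit theorem: the expectation of \<open>exp (s * (deg a - x))\<close> over \<open>deg a \<le> x\<close> is
  \<open>(1 + O(x powr (- \<kappa>))) / sqrt (2 * pi * B)\<close>.
  For \<open>\<bar>t\<bar> \<le> c * e\<close> the characteristic function is expanded to third order; the cubic term is odd and
  integrates to zero, which leaves a relative error of order \<open>e powr (1 + \<gamma>)\<close>, of order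
  \<open>x powr (- (1 + \<gamma>) / (2 + \<gamma>))\<close>. For
  \<open>c * e \<le> \<bar>t\<bar> \<le> e powr (- \<tau>)\<close> with \<open>\<tau> < \<delta>\<close> it is at most \<open>exp (- c' * e powr (- \<gamma> - 1))\<close>, because
  the prime count is precise enough to find the expected number of primes in intervals of length
  \<open>e powr \<tau>\<close> near \<open>1 / e\<close>. Larger frequencies are removed by a Gaussian smoothing on a scale slightly
  below \<open>e powr (\<kappa> * (2 + \<gamma>))\<close>, which is harmless because the counting function is monotone.
\<close>

section \<open>Truncated geometric distributions\<close>

text \<open>Since x has order \<open>e powr (- (2 + \<gamma>))\<close>, an error
  \<open>x powr (- \<kappa>)\<close> is \<open>e powr \<tau>\<close> with \<tau> = \<kappa> (2 +
  \<gamma>), and the conditions on \<kappa> read \<tau> < \<delta> and \<tau> \<le> 1 + \<gamma>.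
  The second is the size of the central error: at the typical frequency 1 / sqrt B the cubic phase
  is only O(\<open>e powr ((1 + \<gamma>) / 2)\<close>), and it is its square that gives
  \<open>e powr (1 + \<gamma>)\<close>, so the linear term really has to cancel. The first condition
  is the obstacle. The prime count is known up to a relative error
  \<open>x powr (- \<delta>)\<close>, so the arrangement of degrees on scales shorter than
  \<open>e powr \<delta>\<close> is invisible, and nothing is known of the characteristic function
  beyond frequency \<open>e powr (- \<delta>)\<close>. The smoothing scale has to fit between
  \<open>e powr \<delta>\<close> and the target error \<open>e powr \<tau>\<close>. The bound
  \<delta> \<le> 1 enters because exp (s w) on w \<le> 0 has integral 1 / s = 1 + O(e), which must
  be absorbed in \<open>e powr \<tau>\<close>.\<close>

definition tg_norm :: "nat \<Rightarrow> real \<Rightarrow> real" where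
  "tg_norm k r = (\<Sum>j<k. r ^ j)"

definition tg_prob :: "nat \<Rightarrow> real \<Rightarrow> nat \<Rightarrow> real" where
  "tg_prob k r j = r ^ j / tg_norm k r"

definition tg_mean :: "nat \<Rightarrow> real \<Rightarrow> real" where
  "tg_mean k r = (\<Sum>j<k. tg_prob k r j * real j)"

definition tg_moment :: "nat \<Rightarrow> real \<Rightarrow> nat \<Rightarrow> real" where
  "tg_moment k r i = (\<Sum>j<k. tg_prob k r j * (real j - tg_mean k r) ^ i)"

definition tg_char :: "nat \<Rightarrow> real \<Rightarrow> real \<Rightarrow> complex" where
  "tg_char k r y = (\<Sum>j<k. complex_of_real (tg_prob k r j) * iexp (y * (real j - tg_mean k r)))"

locale truncated_geometric =
  fixes k :: nat and r :: real
  assumes k2: "k \<ge> 2" and r0: "0 < r" and r1: "r \<le> 1"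
begin

lemma norm_ge1: "tg_norm k r \<ge> 1"
proof -
  have "(\<Sum>j\<in>{0}. r ^ j) \<le> (\<Sum>j<k. r ^ j)" using k2 r0 by (intro sum_mono2) auto
  thus ?thesis unfolding tg_norm_def by simp
qed

lemma norm_le: "tg_norm k r \<le> k"
proof -
  have "(\<Sum>j<k. r ^ j) \<le> (\<Sum>j<k. 1)" using r0 r1 by (intro sum_mono) (simp add: power_le_one)
  thus ?thesis unfolding tg_norm_def by simp
qed

lemma prob_nonneg: "tg_prob k r j \<ge> 0"
  unfolding tg_prob_def using norm_ge1 r0 by simp

lemma prob_le: "j \<ge> 1 \<Longrightarrow> tg_prob k r j \<le> r"
proof -
  assume "j \<ge> 1"
  hence "r ^ j \<le> r ^ 1" using r0 r1 by (intro power_decreasing) auto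
  moreover have "r ^ j / tg_norm k r \<le> r ^ j / 1" using norm_ge1 r0 by (intro divide_left_mono) auto
  ultimately show ?thesis unfolding tg_prob_def by simp
qed

lemma sum_prob: "(\<Sum>j<k. tg_prob k r j) = 1"
  unfolding tg_prob_def sum_divide_distrib[symmetric] using norm_ge1 by (simp add: tg_norm_def)

lemma prob_le_1: "j < k \<Longrightarrow> tg_prob k r j \<le> 1"
  using member_le_sum[of j "{..<k}" "tg_prob k r"] prob_nonneg sum_prob by auto

lemma prob1_ge: "tg_prob k r 1 \<ge> r / k"
  unfolding tg_prob_def using norm_ge1 norm_le r0 by (simp add: frac_le)

lemma prob0_ge: "tg_prob k r 0 \<ge> 1 / k"
  unfolding tg_prob_def using norm_ge1 norm_le r0 by (simp add: frac_le)

lemma mean_nonneg: "tg_mean k r \<ge> 0"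
  unfolding tg_mean_def using prob_nonneg by (intro sum_nonneg) auto

lemma mean_le: "tg_mean k r \<le> k"
proof -
  have "tg_mean k r \<le> (\<Sum>j<k. tg_prob k r j * k)"
    unfolding tg_mean_def using prob_nonneg by (intro sum_mono mult_left_mono) auto
  thus ?thesis using sum_prob by (simp add: sum_distrib_right[symmetric])
qed

lemma mean_le_r: "tg_mean k r \<le> real k ^ 2 * r"
proof -
  have "tg_mean k r \<le> (\<Sum>j<k. r * k)"
    unfolding tg_mean_def
  proof (intro sum_mono)
    fix j assume "j \<in> {..<k}"
    thus "tg_prob k r j * real j \<le> r * real k"
      using prob_le[of j] prob_nonneg[of j] r0 by (cases "j = 0") (auto intro!: mult_mono)
  qed
  thus ?thesis by (simp add: power2_eq_square mult_ac)
qed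

lemma mean_ge: "tg_mean k r \<ge> r / k"
proof -
  have "tg_prob k r 1 * real 1 \<le> tg_mean k r"
    unfolding tg_mean_def using k2 prob_nonneg by (intro member_le_sum[of 1 _ "\<lambda>j. tg_prob k r j * real j"]) auto
  thus ?thesis using prob1_ge by simp
qed

lemma abs_dev_le: "j < k \<Longrightarrow> \<bar>real j - tg_mean k r\<bar> \<le> k"
  using mean_nonneg mean_le by (auto simp: abs_le_iff)

text \<open>Linear in \<open>r\<close>, so that it can be summed over primes. Values j \<ge> 1 have
  probability at most \<open>r\<close>; at j = 0 the deviation is the mean, which is itself
  O(\<open>r\<close>), and one such factor is available because i \<ge> 1.\<close>

lemma abs_moment_le:
  assumes "i \<ge> 1"
  shows "(\<Sum>j<k. tg_prob k r j * \<bar>real j - tg_mean k r\<bar> ^ i) \<le> 2 * real k ^ (i + 1) * r"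
proof -
  have "(\<Sum>j<k. tg_prob k r j * \<bar>real j - tg_mean k r\<bar> ^ i)
      \<le> (\<Sum>j<k. (if j = 0 then real k ^ (i + 1) * r else 0) + r * real k ^ i)"
  proof (intro sum_mono)
    fix j assume j: "j \<in> {..<k}"
    show "tg_prob k r j * \<bar>real j - tg_mean k r\<bar> ^ i \<le> (if j = 0 then real k ^ (i + 1) * r else 0) + r * real k ^ i"
    proof (cases "j = 0")
      case True
      have "tg_mean k r ^ i = tg_mean k r * tg_mean k r ^ (i - 1)" using assms by (cases i) auto
      also have "\<dots> \<le> (real k ^ 2 * r) * real k ^ (i - 1)"
        using mean_le_r mean_le mean_nonneg r0 by (intro mult_mono power_mono) auto
      also have "\<dots> = real k ^ (i + 1) * r"
        using assms by (cases i) (auto simp: power2_eq_square)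
      finally have "tg_mean k r ^ i \<le> real k ^ (i + 1) * r" .
      moreover have "tg_prob k r 0 * tg_mean k r ^ i \<le> 1 * tg_mean k r ^ i"
        using prob_le_1[of 0] k2 mean_nonneg by (intro mult_right_mono) auto
      moreover have "r * real k ^ i \<ge> 0" using r0 by simp
      ultimately show ?thesis using True mean_nonneg by simp
    next
      case False
      have "tg_prob k r j * \<bar>real j - tg_mean k r\<bar> ^ i \<le> r * real k ^ i"
        using False j prob_le[of j] abs_dev_le[of j] r0 by (intro mult_mono power_mono) auto
      thus ?thesis using False by simp
    qed
  qed
  also have "\<dots> = 2 * real k ^ (i + 1) * r"
    using k2 by (simp add: sum.distrib)
  finally show ?thesis .
qed

lemma moment_abs_le:
  assumes "i \<ge> 1" shows "\<bar>tg_moment k r i\<bar> \<le> 2 * real k ^ (i + 1) * r"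
proof -
  have "\<bar>tg_moment k r i\<bar> \<le> (\<Sum>j<k. \<bar>tg_prob k r j * (real j - tg_mean k r) ^ i\<bar>)"
    unfolding tg_moment_def by (rule sum_abs)
  also have "\<dots> = (\<Sum>j<k. tg_prob k r j * \<bar>real j - tg_mean k r\<bar> ^ i)"
    using prob_nonneg by (simp add: abs_mult power_abs)
  finally show ?thesis using abs_moment_le[OF assms] by linarith
qed

lemma moment1: "tg_moment k r 1 = 0"
  unfolding tg_moment_def
  by (simp add: right_diff_distrib sum_subtractf tg_mean_def[symmetric] sum_distrib_right[symmetric] sum_prob)

text \<open>Two atoms suffice: 0 and 1 each have probability at least r / k, and m^2 + (1 - m)^2
  \<ge> 1/2 wherever the mean m lies.\<close>

lemma moment2_ge: "tg_moment k r 2 \<ge> r / (2 * k)"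
proof -
  define m where "m = tg_mean k r"
  have "(\<Sum>j\<in>{0,1}. tg_prob k r j * (real j - m) ^ 2) \<le> tg_moment k r 2"
    unfolding tg_moment_def m_def using k2 prob_nonneg by (intro sum_mono2) auto
  hence "tg_prob k r 0 * m ^ 2 + tg_prob k r 1 * (1 - m) ^ 2 \<le> tg_moment k r 2" by simp
  moreover have "r / k * m ^ 2 \<le> tg_prob k r 0 * m ^ 2"
  proof -
    have "r / k \<le> 1 / k" using r1 by (intro divide_right_mono) auto
    thus ?thesis using prob0_ge by (intro mult_right_mono) auto
  qed
  moreover have "r / k * (1 - m) ^ 2 \<le> tg_prob k r 1 * (1 - m) ^ 2"
    using prob1_ge by (intro mult_right_mono) auto
  moreover have "r / k * (1/2) \<le> r / k * (m ^ 2 + (1 - m) ^ 2)"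
  proof (intro mult_left_mono)
    have "m ^ 2 + (1 - m) ^ 2 - 1/2 = 2 * (m - 1/2) ^ 2" by (simp add: power2_eq_square field_simps)
    thus "1/2 \<le> m ^ 2 + (1 - m) ^ 2" by (smt (verit) zero_le_power2)
  qed (use r0 in auto)
  ultimately show ?thesis by (simp add: distrib_left)
qed

text \<open>The atoms 0 and 1 already differ in phase: the squared modulus of their joint
  contribution falls short of (p 0 + p 1)^2 by 2 p 0 p 1 (1 - cos y). The other atoms are estimated
  trivially, and centring does not change the modulus.\<close>

lemma norm_char_le: "norm (tg_char k r y) \<le> exp (- (r / k ^ 2) * (1 - cos y))"
proof -
  define p where "p = tg_prob k r"
  define c where "c = 1 - cos y"
  have c: "c \<ge> 0" unfolding c_def by simp
  have p0: "p 0 > 0" "p 1 > 0" unfolding p_def tg_prob_def using norm_ge1 r0 by auto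
  have p01: "p 0 + p 1 \<le> 1"
  proof -
    have "(\<Sum>j\<in>{0,1}. p j) \<le> (\<Sum>j<k. p j)" unfolding p_def using k2 prob_nonneg by (intro sum_mono2) auto
    thus ?thesis using sum_prob unfolding p_def by simp
  qed
  have "tg_char k r y = iexp (- (y * tg_mean k r)) * (\<Sum>j<k. complex_of_real (p j) * iexp (y * real j))"
    unfolding tg_char_def p_def
    by (simp add: sum_distrib_left right_diff_distrib exp_diff exp_minus field_simps)
  hence "norm (tg_char k r y) = norm (\<Sum>j<k. complex_of_real (p j) * iexp (y * real j))"
    by (simp add: norm_mult del: of_real_mult)
  also have "(\<Sum>j<k. complex_of_real (p j) * iexp (y * real j)) =
     (\<Sum>j\<in>{0,1}. complex_of_real (p j) * iexp (y * real j)) + (\<Sum>j\<in>{..<k} - {0,1}. complex_of_real (p j) * iexp (y * real j))"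
    using k2 by (subst sum.subset_diff[of "{0,1}"]) (auto simp: add.commute)
  also have "norm \<dots> \<le> norm (\<Sum>j\<in>{0,1}. complex_of_real (p j) * iexp (y * real j)) +
     norm (\<Sum>j\<in>{..<k} - {0,1}. complex_of_real (p j) * iexp (y * real j))" by (rule norm_triangle_ineq)
  also have "norm (\<Sum>j\<in>{..<k} - {0,1}. complex_of_real (p j) * iexp (y * real j)) \<le> (\<Sum>j\<in>{..<k} - {0,1}. p j)"
    by (intro sum_norm_le) (simp add: norm_mult p_def prob_nonneg del: of_real_mult)
  also have "(\<Sum>j\<in>{..<k} - {0,1}. p j) = 1 - p 0 - p 1"
  proof -
    have "(\<Sum>j<k. p j) = (\<Sum>j\<in>{..<k} - {0,1}. p j) + (\<Sum>j\<in>{0,1}. p j)" using k2 by (intro sum.subset_diff) auto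
    thus ?thesis using sum_prob unfolding p_def by simp
  qed
  also have "norm (\<Sum>j\<in>{0,1}. complex_of_real (p j) * iexp (y * real j)) \<le> p 0 + p 1 - p 0 * p 1 * c"
  proof -
    have 1: "(\<Sum>j\<in>{0,1}. complex_of_real (p j) * iexp (y * real j)) = Complex (p 0 + p 1 * cos y) (p 1 * sin y)"
      by (simp add: complex_eq_iff Re_exp Im_exp)
    have "(norm (Complex (p 0 + p 1 * cos y) (p 1 * sin y)))\<^sup>2 = (p 0 + p 1 * cos y)\<^sup>2 + (p 1 * sin y)\<^sup>2"
      by (simp add: cmod_power2)
    also have "\<dots> = (p 0)\<^sup>2 + 2 * p 0 * p 1 * cos y + (p 1)\<^sup>2 * ((sin y)\<^sup>2 + (cos y)\<^sup>2)"
      by (simp only: power2_eq_square) algebra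
    also have "\<dots> = (p 0 + p 1)\<^sup>2 - 2 * (p 0 * p 1 * c)"
      unfolding c_def sin_cos_squared_add by (simp add: power2_eq_square algebra_simps)
    also have "\<dots> \<le> (p 0 + p 1 - p 0 * p 1 * c)\<^sup>2"
    proof -
      have "p 0 * p 1 * c * (p 0 + p 1) \<le> p 0 * p 1 * c * 1" using p01 p0 c by (intro mult_left_mono) auto
      moreover have "(p 0 + p 1 - p 0 * p 1 * c)\<^sup>2 = (p 0 + p 1)\<^sup>2 - 2 * (p 0 * p 1 * c * (p 0 + p 1)) + (p 0 * p 1 * c)\<^sup>2"
        by (simp add: power2_eq_square algebra_simps)
      ultimately show ?thesis using zero_le_power2[of "p 0 * p 1 * c"] by linarith
    qed
    finally have sq: "(norm (Complex (p 0 + p 1 * cos y) (p 1 * sin y)))\<^sup>2 \<le> (p 0 + p 1 - p 0 * p 1 * c)\<^sup>2" .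
    \<comment> \<open>The right-hand side of \<open>sq\<close> is a square of something that must be
      nonnegative before the roots may be compared.\<close>
    have "p 0 * p 1 * c \<le> p 0 + p 1"
    proof -
      have "p 0 * c \<le> 1 * 2" using p0 p01 c unfolding c_def by (intro mult_mono) (auto intro: cos_ge_minus_one)
      hence "p 1 * (p 0 * c) \<le> p 1 * 2" using p0 by (intro mult_left_mono) auto
      moreover have "p 1 \<le> p 0" unfolding p_def tg_prob_def using norm_ge1 r1 by (simp add: divide_right_mono)
      ultimately show ?thesis by (simp add: mult_ac)
    qed
    thus ?thesis unfolding 1 using power2_le_imp_le[OF sq] by simp
  qed
  finally have "norm (tg_char k r y) \<le> 1 - p 0 * p 1 * c" by simp
  also have "\<dots> \<le> 1 - (1/k) * (r/k) * c"
    using prob0_ge prob1_ge c r0 prob_nonneg unfolding p_def by (intro diff_left_mono mult_right_mono mult_mono) auto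
  also have "\<dots> \<le> exp (- ((1/k) * (r/k) * c))"
    using exp_ge_add_one_self[of "- ((1/k) * (r/k) * c)"] by simp
  finally show ?thesis unfolding c_def by (simp add: power2_eq_square)
qed

text \<open>Centring removes the first-order term; the remainder is y^4 / 24 times the fourth
  absolute moment, hence again linear in \<open>r\<close>.\<close>

lemma char_taylor:
  "norm (tg_char k r y - (1 - of_real (tg_moment k r 2 * y ^ 2 / 2) - \<i> * of_real (tg_moment k r 3 * y ^ 3 / 6)))
     \<le> 2 * real k ^ 5 * r * y ^ 4 / 24"
proof -
  define p where "p = tg_prob k r"
  define z where "z = (\<lambda>j. real j - tg_mean k r)"
  have mom: "tg_moment k r i = (\<Sum>j<k. p j * z j ^ i)" for i unfolding tg_moment_def p_def z_def by simp
  have sum_p: "(\<Sum>j<k. p j) = 1" using sum_prob unfolding p_def .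
  have e: "(1 - of_real (tg_moment k r 2 * y ^ 2 / 2) - \<i> * of_real (tg_moment k r 3 * y ^ 3 / 6))
     = (\<Sum>j<k. complex_of_real (p j) * (\<Sum>i\<le>3. (\<i> * of_real (y * z j)) ^ i / fact i))"
  proof -
    have "(\<Sum>i\<le>3. (\<i> * of_real x) ^ i / fact i) = of_real (1 - x^2/2) + \<i> * of_real (x - x^3/6)" for x
      by (simp add: eval_nat_numeral complex_eq_iff field_simps)
    hence "(\<Sum>j<k. complex_of_real (p j) * (\<Sum>i\<le>3. (\<i> * of_real (y * z j)) ^ i / fact i)) =
       (\<Sum>j<k. complex_of_real (p j) * (of_real (1 - (y * z j)^2/2) + \<i> * of_real (y * z j - (y * z j)^3/6)))" by (simp only:)
    also have "\<dots> = of_real (\<Sum>j<k. p j * (1 - (y * z j)^2/2)) + \<i> * of_real (\<Sum>j<k. p j * (y * z j - (y * z j)^3/6))"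
      by (simp add: sum.distrib sum_distrib_left distrib_left mult_ac)
    also have "(\<Sum>j<k. p j * (1 - (y * z j)^2/2)) = 1 - tg_moment k r 2 * y^2/2"
      using sum_p unfolding mom
      by (simp add: right_diff_distrib sum_subtractf power_mult_distrib sum_divide_distrib[symmetric] sum_distrib_left mult_ac)
    also have "(\<Sum>j<k. p j * (y * z j - (y * z j)^3/6)) = y * tg_moment k r 1 - tg_moment k r 3 * y^3/6"
      unfolding mom
      by (simp add: right_diff_distrib sum_subtractf power_mult_distrib sum_distrib_right sum_distrib_left sum_divide_distrib mult_ac)
    finally show ?thesis using moment1 by simp
  qed
  have "tg_char k r y - (1 - of_real (tg_moment k r 2 * y ^ 2 / 2) - \<i> * of_real (tg_moment k r 3 * y ^ 3 / 6))
     = (\<Sum>j<k. complex_of_real (p j) * (iexp (y * z j) - (\<Sum>i\<le>3. (\<i> * of_real (y * z j)) ^ i / fact i)))"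
    unfolding e unfolding tg_char_def p_def z_def
    by (simp only: sum_subtractf right_diff_distrib)
  also have "norm \<dots> \<le> (\<Sum>j<k. p j * \<bar>z j\<bar> ^ 4 * (y ^ 4 / 24))"
  proof (intro sum_norm_le)
    fix j
    have "norm (iexp (y * z j) - (\<Sum>i\<le>3. (\<i> * of_real (y * z j)) ^ i / fact i)) \<le> \<bar>y * z j\<bar> ^ Suc 3 / fact (Suc 3)"
      by (rule iexp_approx1)
    also have "\<dots> = \<bar>z j\<bar> ^ 4 * (y ^ 4 / 24)"
      by (simp add: abs_mult power_mult_distrib fact_numeral)
    finally show "norm (complex_of_real (p j) * (iexp (y * z j) - (\<Sum>i\<le>3. (\<i> * of_real (y * z j)) ^ i / fact i))) \<le> p j * \<bar>z j\<bar> ^ 4 * (y ^ 4 / 24)"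
      using prob_nonneg[of j] unfolding p_def norm_mult norm_of_real by (simp add: mult_left_mono mult.assoc)
  qed
  also have "\<dots> = (\<Sum>j<k. p j * \<bar>z j\<bar> ^ 4) * (y ^ 4 / 24)" by (rule sum_distrib_right[symmetric])
  also have "\<dots> \<le> (2 * real k ^ 5 * r) * (y ^ 4 / 24)"
    using abs_moment_le[of 4] unfolding p_def z_def by (intro mult_right_mono) auto
  finally show ?thesis by simp
qed

text \<open>Quadratic in y because the mean has been subtracted. It keeps the value near 1, where
  the principal logarithm is under control.\<close>

lemma char_near_1: "norm (tg_char k r y - 1) \<le> real k ^ 3 * r * y ^ 2"
proof -
  define p where "p = tg_prob k r"
  define z where "z = (\<lambda>j. real j - tg_mean k r)"
  have "tg_char k r y - 1 = (\<Sum>j<k. complex_of_real (p j) * (iexp (y * z j) - (\<Sum>i\<le>1. (\<i> * of_real (y * z j)) ^ i / fact i)))"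
  proof -
    have "(\<Sum>j<k. complex_of_real (p j) * (\<Sum>i\<le>1. (\<i> * of_real (y * z j)) ^ i / fact i))
      = of_real (\<Sum>j<k. p j) + \<i> * of_real (y * (\<Sum>j<k. p j * z j))"
      by (simp add: sum.distrib sum_distrib_left distrib_left mult_ac)
    also have "\<dots> = 1" using sum_prob moment1 unfolding p_def z_def tg_moment_def by simp
    finally show ?thesis unfolding right_diff_distrib sum_subtractf by (simp add: tg_char_def p_def z_def)
  qed
  also have "norm \<dots> \<le> (\<Sum>j<k. p j * \<bar>z j\<bar> ^ 2 * (y ^ 2 / 2))"
  proof (intro sum_norm_le)
    fix j
    have "norm (iexp (y * z j) - (\<Sum>i\<le>1. (\<i> * of_real (y * z j)) ^ i / fact i)) \<le> \<bar>y * z j\<bar> ^ Suc 1 / fact (Suc 1)"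
      by (rule iexp_approx1)
    also have "\<dots> = \<bar>z j\<bar> ^ 2 * (y ^ 2 / 2)"
      by (simp add: power_mult_distrib numeral_2_eq_2[symmetric] del: power_Suc)
    finally show "norm (complex_of_real (p j) * (iexp (y * z j) - (\<Sum>i\<le>1. (\<i> * of_real (y * z j)) ^ i / fact i))) \<le> p j * \<bar>z j\<bar> ^ 2 * (y ^ 2 / 2)"
      using prob_nonneg[of j] unfolding p_def norm_mult norm_of_real by (simp add: mult_left_mono mult.assoc)
  qed
  also have "\<dots> = (\<Sum>j<k. p j * \<bar>z j\<bar> ^ 2) * (y ^ 2 / 2)" by (rule sum_distrib_right[symmetric])
  also have "\<dots> \<le> (2 * real k ^ 3 * r) * (y ^ 2 / 2)"
    using abs_moment_le[of 2] unfolding p_def z_def by (intro mult_right_mono) (auto simp: numeral_3_eq_3)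
  finally show ?thesis by simp
qed

text \<open>Let w be the characteristic function minus 1. The hypothesis gives |w| \<le> 1/2, so Ln
  (1 + w) differs from w by at most 2 |w|^2, and |w|^2 is of order r^2 y^4 \<le> r y^4. The
  quadratic part of the logarithm thus goes into the error, where it accounts for 2 of the 3
  k^6.\<close>

lemma Ln_char_expansion:
  assumes "real k ^ 3 * r * y ^ 2 \<le> 1/2"
  shows "tg_char k r y \<noteq> 0"
    and "norm (Ln (tg_char k r y) + of_real (tg_moment k r 2 * y ^ 2 / 2) + \<i> * of_real (tg_moment k r 3 * y ^ 3 / 6))
           \<le> 3 * real k ^ 6 * r * y ^ 4"
proof -
  define w where "w = tg_char k r y - 1"
  have w: "norm w \<le> real k ^ 3 * r * y ^ 2" unfolding w_def by (rule char_near_1)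
  hence w2: "norm w \<le> 1/2" using assms by linarith
  show "tg_char k r y \<noteq> 0"
  proof
    assume "tg_char k r y = 0"
    hence "norm w = 1" unfolding w_def by simp
    thus False using w2 by simp
  qed
  have "norm (Ln (1 + w) - w) \<le> (norm w)\<^sup>2 / (1 - norm w)" using w2 by (intro Ln_approx_linear) auto
  also have "\<dots> \<le> (norm w)\<^sup>2 / (1/2)" using w2 by (intro divide_left_mono) auto
  also have "\<dots> \<le> 2 * (real k ^ 3 * r * y ^ 2)\<^sup>2" using w by (simp add: power_mono)
  also have "\<dots> = 2 * real k ^ 6 * y ^ 4 * (r * r)" by (simp add: power_mult_distrib power2_eq_square eval_nat_numeral)
  also have "\<dots> \<le> 2 * real k ^ 6 * y ^ 4 * (r * 1)" using r0 r1 by (intro mult_left_mono) auto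
  finally have 1: "norm (Ln (1 + w) - w) \<le> 2 * real k ^ 6 * r * y ^ 4" by (simp add: mult_ac)
  have 2: "norm (w + of_real (tg_moment k r 2 * y ^ 2 / 2) + \<i> * of_real (tg_moment k r 3 * y ^ 3 / 6)) \<le> 2 * real k ^ 5 * r * y ^ 4 / 24"
    using char_taylor[of y] unfolding w_def by (simp add: algebra_simps)
  also have "\<dots> \<le> real k ^ 6 * r * y ^ 4"
  proof -
    have "real k ^ 5 \<le> real k ^ 6" using k2 by (intro power_increasing) auto
    hence "real k ^ 5 * (r * y ^ 4) \<le> real k ^ 6 * (r * y ^ 4)" using r0 by (intro mult_right_mono) auto
    moreover have "0 \<le> real k ^ 5 * (r * y ^ 4)" using r0 by simp
    moreover have "2 * real k ^ 5 * r * y ^ 4 / 24 = (real k ^ 5 * (r * y ^ 4)) / 12" by simp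
    moreover have "real k ^ 6 * r * y ^ 4 = real k ^ 6 * (r * y ^ 4)" by simp
    ultimately show ?thesis by linarith
  qed
  finally have 3: "norm (w + of_real (tg_moment k r 2 * y ^ 2 / 2) + \<i> * of_real (tg_moment k r 3 * y ^ 3 / 6)) \<le> real k ^ 6 * r * y ^ 4" .
  have eq: "Ln (tg_char k r y) + of_real (tg_moment k r 2 * y ^ 2 / 2) + \<i> * of_real (tg_moment k r 3 * y ^ 3 / 6)
     = (Ln (1 + w) - w) + (w + of_real (tg_moment k r 2 * y ^ 2 / 2) + \<i> * of_real (tg_moment k r 3 * y ^ 3 / 6))"
    unfolding w_def by simp
  have "2 * real k ^ 6 * r * y ^ 4 + real k ^ 6 * r * y ^ 4 = 3 * real k ^ 6 * r * y ^ 4" by simp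
  thus "norm (Ln (tg_char k r y) + of_real (tg_moment k r 2 * y ^ 2 / 2) + \<i> * of_real (tg_moment k r 3 * y ^ 3 / 6))
           \<le> 3 * real k ^ 6 * r * y ^ 4"
    using norm_triangle_le[OF add_mono[OF 1 3]] arg_cong[OF eq, of norm] by linarith
qed

text \<open>With r = exp (- d s) and y = t d the left side is the Euler factor of a prime at s - i
  t. It splits into the real Euler factor, a phase carrying the mean, and the centred characteristic
  function.\<close>

lemma local_factor:
  "(\<Sum>j<k. (of_real r * iexp y) ^ j) = of_real (tg_norm k r) * iexp (y * tg_mean k r) * tg_char k r y"
proof -
  have "of_real (tg_norm k r) * iexp (y * tg_mean k r) * tg_char k r y
    = (\<Sum>j<k. of_real (tg_norm k r * tg_prob k r j) * (iexp (y * tg_mean k r) * iexp (y * (real j - tg_mean k r))))"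
    unfolding tg_char_def by (simp add: sum_distrib_left mult_ac)
  also have "\<dots> = (\<Sum>j<k. (of_real r * iexp y) ^ j)"
  proof (intro sum.cong refl)
    fix j
    have "iexp (y * tg_mean k r) * iexp (y * (real j - tg_mean k r)) = iexp (real j * y)"
      unfolding exp_add[symmetric] by (simp add: algebra_simps)
    also have "\<dots> = iexp y ^ j" by (simp add: exp_of_nat_mult[symmetric] mult_ac)
    finally have "iexp (y * tg_mean k r) * iexp (y * (real j - tg_mean k r)) = iexp y ^ j" .
    moreover have "tg_norm k r * tg_prob k r j = r ^ j" unfolding tg_prob_def using norm_ge1 by simp
    ultimately show "of_real (tg_norm k r * tg_prob k r j) * (iexp (y * tg_mean k r) * iexp (y * (real j - tg_mean k r))) = (of_real r * iexp y) ^ j"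
      by (simp only: power_mult_distrib of_real_power)
  qed
  finally show ?thesis by simp
qed

end

section \<open>Sums over primes\<close>

text \<open>Raise y / a \<le> exp (y / a) to the power a.\<close>

lemma powr_le_exp:
  fixes a y :: real assumes "a > 0" "y > 0" shows "y powr a \<le> a powr a * exp y"
proof -
  have "y / a \<le> exp (y / a)" using exp_ge_add_one_self[of "y/a"] by linarith
  hence "(y / a) powr a \<le> exp (y / a) powr a" using assms by (intro powr_mono2) auto
  also have "\<dots> = exp y" using assms by (simp add: exp_powr_real)
  finally show ?thesis using assms by (simp add: powr_divide field_simps)
qed

text \<open>The tails that occur below all have this form; each can be made smaller than any
  prescribed power of e.\<close>

lemma exp_neg_powr_le:
  fixes a b N :: real assumes "a > 0" "b > 0" "N > 0"
  shows "\<exists>C>0. \<forall>e>0. exp (- (a * e powr (- b))) \<le> C * e powr N"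
proof -
  define p where "p = N / b"
  have p: "p > 0" "b * p = N" unfolding p_def using assms by auto
  define C where "C = p powr p / a powr p"
  have "exp (- (a * e powr (- b))) \<le> C * e powr N" if e: "e > 0" for e
  proof -
    define y where "y = a * e powr (- b)"
    have y: "y > 0" unfolding y_def using assms e by simp
    have "y powr p = a powr p * e powr (- N)"
      unfolding y_def using assms e p by (simp add: powr_mult powr_powr)
    moreover have "y powr p \<le> p powr p * exp y" by (rule powr_le_exp[OF p(1) y])
    ultimately have "a powr p * e powr (- N) * exp (- y) \<le> p powr p * exp y * exp (- y)"
      by (intro mult_right_mono) auto
    also have "p powr p * exp y * exp (- y) = p powr p" by (simp add: mult.assoc exp_add[symmetric])
    finally have "a powr p * e powr (- N) * exp (- y) \<le> p powr p" .
    hence "a powr p * e powr (- N) * exp (- y) * (e powr N / a powr p) \<le> p powr p * (e powr N / a powr p)"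
      by (intro mult_right_mono) auto
    moreover have "a powr p * e powr (- N) * exp (- y) * (e powr N / a powr p) = exp (- y)"
    proof -
      have "e powr (- N) * e powr N = 1" using e by (simp add: powr_add[symmetric])
      moreover have "a powr p > 0" using assms by simp
      ultimately show ?thesis by (simp add: mult.commute mult.left_commute)
    qed
    ultimately show ?thesis unfolding y_def C_def by simp
  qed
  moreover have "C > 0" unfolding C_def using p assms by simp
  ultimately show ?thesis by blast
qed

text \<open>Half of the exponential absorbs the power: \<open>powr_le_exp\<close> at y = (m + 1) e /
  2 leaves a geometric series of ratio exp (- e/2), whose sum is at most 4 / e. The other factor 4
  in the constant bounds exp (e/2).\<close>

lemma powr_exp_sum_le:
  assumes a: "a > (0::real)" and e: "0 < e" "e \<le> 1"
  shows "(\<Sum>m<M. (real m + 1) powr a * exp (- real m * e)) \<le> (16 * 2 powr a * a powr a) * e powr (- a - 1)"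
proof -
  define q where "q = exp (- (e/2))"
  have q: "0 < q" "q < 1" unfolding q_def using e by auto
  have summand: "(real m + 1) powr a * exp (- real m * e) \<le> (2 powr a * a powr a * e powr (-a) * exp (e/2)) * q ^ m" for m
  proof -
    have "((real m + 1) * e / 2) powr a \<le> a powr a * exp ((real m + 1) * e / 2)"
      using a e by (intro powr_le_exp) auto
    hence "(real m + 1) powr a \<le> (2 powr a * e powr (-a)) * (a powr a * exp ((real m + 1) * e / 2))"
    proof -
      have "(real m + 1) powr a = (2 powr a * e powr (-a)) * ((real m + 1) * e / 2) powr a"
      proof -
        have "((real m + 1) * e / 2) powr a = (real m + 1) powr a * e powr a / 2 powr a"
          using e by (simp only: powr_divide powr_mult mult_nonneg_nonneg)
        moreover have "e powr (-a) * e powr a = 1" using e by (simp add: powr_add[symmetric])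
        ultimately show ?thesis by (simp add: field_simps)
      qed
      thus ?thesis using \<open>((real m + 1) * e / 2) powr a \<le> _\<close> by (simp add: mult_left_mono)
    qed
    hence "(real m + 1) powr a * exp (- real m * e) \<le> (2 powr a * e powr (-a)) * (a powr a * exp ((real m + 1) * e / 2)) * exp (- real m * e)"
      by simp
    also have "\<dots> = (2 powr a * a powr a * e powr (-a)) * (exp ((real m + 1) * e / 2) * exp (- real m * e))"
      by simp
    also have "exp ((real m + 1) * e / 2) * exp (- real m * e) = exp (e/2) * q ^ m"
      unfolding q_def by (simp add: exp_add[symmetric] exp_of_nat_mult[symmetric] field_simps)
    finally show ?thesis by (simp add: mult.assoc)
  qed
  have "(\<Sum>m<M. q ^ m) \<le> 1 / (1 - q)" using q by (simp add: sum_gp_strict divide_right_mono)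
  moreover have "1 - q \<ge> e / 4"
  proof -
    have "q \<le> 1 / (1 + e/2)" unfolding q_def exp_minus
      using exp_ge_add_one_self[of "e/2"] e by (simp add: field_simps)
    also have "\<dots> \<le> 1 - e/4" using e by (simp add: field_simps)
    finally show ?thesis by simp
  qed
  ultimately have geo: "(\<Sum>m<M. q ^ m) \<le> 4 / e"
  proof -
    assume "(\<Sum>m<M. q ^ m) \<le> 1 / (1 - q)" "e / 4 \<le> 1 - q"
    moreover from this have "1 / (1 - q) \<le> 1 / (e / 4)" using e q by (intro divide_left_mono) auto
    ultimately show ?thesis by simp
  qed
  have exp2: "exp (e/2) \<le> 4"
  proof -
    have "exp (e/2) \<le> exp 1" using e by simp
    thus ?thesis using exp_le by linarith
  qed
  have "(\<Sum>m<M. (real m + 1) powr a * exp (- real m * e)) \<le> (\<Sum>m<M. (2 powr a * a powr a * e powr (-a) * exp (e/2)) * q ^ m)"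
    by (intro sum_mono summand)
  also have "\<dots> = (2 powr a * a powr a * e powr (-a) * exp (e/2)) * (\<Sum>m<M. q ^ m)" by (simp add: sum_distrib_left)
  also have "\<dots> \<le> (2 powr a * a powr a * e powr (-a) * 4) * (4 / e)"
    using geo exp2 e q by (intro mult_mono mult_left_mono) (auto intro: sum_nonneg)
  also have "\<dots> = (16 * 2 powr a * a powr a) * e powr (- a - 1)"
    using e by (simp add: powr_diff powr_minus field_simps)
  finally show ?thesis .
qed

section \<open>Cosines and their sums over arithmetic progressions\<close>

lemma abs_cos_diff_le: "\<bar>cos x - cos y\<bar> \<le> \<bar>x - y\<bar>" for x y :: real
proof -
  have "\<bar>cos x - cos y\<bar> = 2 * \<bar>sin ((x + y) / 2)\<bar> * \<bar>sin ((y - x) / 2)\<bar>"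
    by (simp add: cos_diff_cos abs_mult)
  also have "\<dots> \<le> 2 * 1 * \<bar>(y - x) / 2\<bar>"
    by (intro mult_mono abs_sin_x_le_abs_x) (auto simp: abs_sin_le_one)
  finally show ?thesis by simp
qed

text \<open>Multiplication by 2 sin (x/2) makes the sum telescope. The bound depends neither on a
  nor on J, which is what lets the cosine average out over a long grid.\<close>

lemma sum_cos_le:
  assumes "0 < x" "x \<le> (1::real)/2"
  shows "(\<Sum>j<J. cos (a + real j * x)) \<le> 4 / x"
proof -
  have s: "sin (x/2) \<ge> x / 4"
  proof -
    have "\<bar>sin (x/2) - (\<Sum>m<2. sin_coeff m * (x/2) ^ m)\<bar> \<le> inverse (fact 2) * \<bar>x/2\<bar> ^ 2"
      by (rule Maclaurin_sin_bound)
    hence "\<bar>sin (x/2) - x/2\<bar> \<le> x * x / 8"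
      by (simp add: sin_coeff_def numeral_2_eq_2 power2_eq_square)
    hence "sin (x/2) \<ge> x/2 - x * x / 8"
      using abs_ge_minus_self[of "sin (x/2) - x/2"] by linarith
    moreover have "x * x \<le> x * (1/2)" using assms by (intro mult_left_mono) auto
    ultimately show ?thesis using assms by linarith
  qed
  hence s0: "sin (x/2) > 0" using assms by linarith
  have "2 * sin (x/2) * (\<Sum>j<J. cos (a + real j * x)) = sin (a + (real J - 1/2) * x) - sin (a - x/2)"
  proof (induction J)
    case (Suc J)
    have "2 * sin (x/2) * cos (a + real J * x) = sin (a + (real J + 1/2) * x) - sin (a + (real J - 1/2) * x)"
    proof -
      have "sin (a + (real J + 1/2) * x) = sin ((a + real J * x) + x/2)" by (simp add: algebra_simps)
      moreover have "sin (a + (real J - 1/2) * x) = sin ((a + real J * x) - x/2)" by (simp add: algebra_simps)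
      ultimately show ?thesis by (simp only: sin_add sin_diff) simp
    qed
    thus ?case using Suc by (simp add: algebra_simps)
  qed simp
  also have "\<dots> \<le> 2"
    using sin_ge_minus_one[of "a - x/2"] sin_le_one[of "a + (real J - 1/2) * x"] by linarith
  finally have "(\<Sum>j<J. cos (a + real j * x)) \<le> 1 / sin (x/2)" using s0 by (simp add: field_simps)
  also have "\<dots> \<le> 1 / (x / 4)" using s assms by (intro divide_left_mono) (auto simp: s0)
  finally show ?thesis by simp
qed

text \<open>The analysis needs only the degrees of the primes, so the multiplicative structure is
  left out here. \<open>count_asymp\<close> does not fix the sign of its constant, hence the
  absolute values taken of it below.\<close>

locale degree_sequence =
  fixes d :: "nat \<Rightarrow> real" and \<rho> \<gamma> \<delta> :: real
  assumes d_pos: "d n > 0"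
    and finite_d_le: "finite {n. d n \<le> x}"
    and rho_pos: "\<rho> > 0" and gamma_gt: "\<gamma> > -1" and delta_pos: "\<delta> > 0"
    and count_asymp: "\<exists>C X. \<forall>x\<ge>X. \<bar>real (card {n. d n \<le> x}) - \<rho> * x powr \<gamma> * exp x\<bar>
                         \<le> C * x powr (\<gamma> - \<delta>) * exp x"
begin

text \<open>Far out the asymptotics give the constant \<open>\<rho> + \<bar>C\<bar>\<close>; the
  finitely many integers up to \<open>M\<close> are paid for by adding their normalised counts to
  it.\<close>

lemma count_upper:
  "\<exists>C>0. \<forall>m::nat. real (card {n. d n \<le> real m + 1}) \<le> C * (real m + 1) powr \<gamma> * exp (real m + 1)"
proof -
  obtain C X where CX: "\<And>x. x \<ge> X \<Longrightarrow> \<bar>real (card {n. d n \<le> x}) - \<rho> * x powr \<gamma> * exp x\<bar>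
      \<le> C * x powr (\<gamma> - \<delta>) * exp x" using count_asymp by blast
  define M where "M = nat \<lceil>X\<rceil>"
  define f where "f = (\<lambda>m::nat. real (card {n. d n \<le> real m + 1}) / ((real m + 1) powr \<gamma> * exp (real m + 1)))"
  have f0: "f m \<ge> 0" for m unfolding f_def by simp
  define K where "K = \<rho> + \<bar>C\<bar> + (\<Sum>m\<le>M. f m)"
  have S0: "(\<Sum>m\<le>M. f m) \<ge> 0" using f0 by (simp add: sum_nonneg)
  have "real (card {n. d n \<le> real m + 1}) \<le> K * (real m + 1) powr \<gamma> * exp (real m + 1)" for m
  proof (cases "m \<le> M")
    case True
    have "f m \<le> (\<Sum>m\<le>M. f m)" using True f0 by (intro member_le_sum) auto
    hence "f m \<le> K" using rho_pos unfolding K_def by linarith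
    thus ?thesis unfolding f_def by (simp add: divide_le_eq mult.assoc)
  next
    case False
    define x where "x = real m + 1"
    have x: "x \<ge> X" "x \<ge> 1" using False unfolding x_def M_def by linarith+
    have "x powr (\<gamma> - \<delta>) \<le> x powr \<gamma>" using x delta_pos by (intro powr_mono) auto
    hence "C * x powr (\<gamma> - \<delta>) \<le> \<bar>C\<bar> * x powr \<gamma>"
      by (meson abs_ge_self abs_ge_zero mult_mono powr_ge_zero)
    hence "C * x powr (\<gamma> - \<delta>) * exp x \<le> \<bar>C\<bar> * x powr \<gamma> * exp x" by simp
    moreover have "real (card {n. d n \<le> x}) \<le> \<rho> * x powr \<gamma> * exp x + C * x powr (\<gamma> - \<delta>) * exp x"
      using CX[OF x(1)] by linarith
    ultimately have "real (card {n. d n \<le> x}) \<le> \<rho> * x powr \<gamma> * exp x + \<bar>C\<bar> * x powr \<gamma> * exp x" by linarith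
    hence "real (card {n. d n \<le> x}) \<le> (\<rho> + \<bar>C\<bar>) * (x powr \<gamma> * exp x)"
      by (simp add: algebra_simps)
    also have "\<dots> \<le> K * (x powr \<gamma> * exp x)"
      using S0 unfolding K_def by (intro mult_right_mono) auto
    finally show ?thesis unfolding x_def by (simp add: mult.assoc)
  qed
  moreover have "K > 0" using rho_pos S0 unfolding K_def by linarith
  ultimately show ?thesis by blast
qed

text \<open>Terms are grouped by the integer part m of d n. The factor exp m in the count cancels
  against exp (- m) in the weight and leaves (m + 1)^(\<gamma> + j) exp (- m e). Since j \<ge> 1 and
  \<gamma> > -1, the exponent \<gamma> + j is positive, as \<open>powr_exp_sum_le\<close>
  requires.\<close>

lemma moment_sum_upper:
  assumes "j \<ge> 1"
  shows "\<exists>C>0. \<forall>e. 0 < e \<and> e \<le> 1 \<longrightarrow> summable (\<lambda>n. d n ^ j * exp (- d n * (1 + e))) \<and>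
           (\<Sum>n. d n ^ j * exp (- d n * (1 + e))) \<le> C * e powr (- \<gamma> - 1 - real j)"
proof -
  obtain C where C: "C > 0" "\<And>m. real (card {n. d n \<le> real m + 1}) \<le> C * (real m + 1) powr \<gamma> * exp (real m + 1)"
    using count_upper by blast
  define a where "a = \<gamma> + real j"
  have a: "a > 0" unfolding a_def using gamma_gt assms by linarith
  define K where "K = C * exp 1 * (16 * 2 powr a * a powr a)"
  have K: "K > 0" unfolding K_def using C a by simp
  have part: "(\<Sum>n<N. d n ^ j * exp (- d n * (1 + e))) \<le> K * e powr (- \<gamma> - 1 - real j)"
    if e: "0 < e" "e \<le> 1" for e N
  proof -
    define c where "c = (\<lambda>m::nat. (real m + 1) ^ j * exp (- real m * (1 + e)))"
    define fl where "fl = (\<lambda>n. nat \<lfloor>d n\<rfloor>)"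
    have fl: "real (fl n) \<le> d n" "d n \<le> real (fl n) + 1" for n
      using d_pos[of n] unfolding fl_def by linarith+
    have c0: "c m \<ge> 0" for m unfolding c_def by simp
    have 1: "d n ^ j * exp (- d n * (1 + e)) \<le> c (fl n)" for n
      unfolding c_def using fl[of n] d_pos[of n] e by (intro mult_mono power_mono) auto
    obtain M where M: "fl ` {..<N} \<subseteq> {..<M}" by (meson finite_imageI finite_lessThan finite_nat_iff_bounded)
    have "(\<Sum>n<N. d n ^ j * exp (- d n * (1 + e))) \<le> (\<Sum>n<N. c (fl n))" by (intro sum_mono 1)
    also have "\<dots> = (\<Sum>m<M. \<Sum>n | n \<in> {..<N} \<and> fl n = m. c (fl n))"
      using sum.group[OF finite_lessThan finite_lessThan M, of "\<lambda>n. c (fl n)"] by simp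
    also have "\<dots> = (\<Sum>m<M. real (card {n. n \<in> {..<N} \<and> fl n = m}) * c m)"
      by (intro sum.cong refl) simp
    also have "\<dots> \<le> (\<Sum>m<M. (C * exp 1) * ((real m + 1) powr a * exp (- real m * e)))"
    proof (intro sum_mono)
      fix m
      have "card {n. n \<in> {..<N} \<and> fl n = m} \<le> card {n. d n \<le> real m + 1}"
        using fl finite_d_le by (intro card_mono) auto
      hence "real (card {n. n \<in> {..<N} \<and> fl n = m}) \<le> C * (real m + 1) powr \<gamma> * exp (real m + 1)"
        using C(2)[of m] by linarith
      hence "real (card {n. n \<in> {..<N} \<and> fl n = m}) * c m \<le> C * (real m + 1) powr \<gamma> * exp (real m + 1) * c m"
        using c0 by (intro mult_right_mono)
      also have "\<dots> = C * ((real m + 1) powr \<gamma> * (real m + 1) ^ j) * (exp (real m + 1) * exp (- real m * (1 + e)))"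
        unfolding c_def by simp
      also have "(real m + 1) powr \<gamma> * (real m + 1) ^ j = (real m + 1) powr a"
        unfolding a_def by (simp add: powr_add powr_realpow)
      also have "exp (real m + 1) * exp (- real m * (1 + e)) = exp 1 * exp (- real m * e)"
        by (simp add: exp_add[symmetric] algebra_simps)
      finally show "real (card {n. n \<in> {..<N} \<and> fl n = m}) * c m \<le> (C * exp 1) * ((real m + 1) powr a * exp (- real m * e))"
        by (simp only: mult_ac)
    qed
    also have "\<dots> = (C * exp 1) * (\<Sum>m<M. (real m + 1) powr a * exp (- real m * e))" by (simp add: sum_distrib_left)
    also have "\<dots> \<le> (C * exp 1) * ((16 * 2 powr a * a powr a) * e powr (- a - 1))"
      using C by (intro mult_left_mono powr_exp_sum_le a e) auto
    also have "\<dots> = K * e powr (- \<gamma> - 1 - real j)"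
      unfolding K_def a_def by (simp add: algebra_simps)
    finally show ?thesis .
  qed
  have "summable (\<lambda>n. d n ^ j * exp (- d n * (1 + e))) \<and>
           (\<Sum>n. d n ^ j * exp (- d n * (1 + e))) \<le> K * e powr (- \<gamma> - 1 - real j)" if e: "0 < e \<and> e \<le> 1" for e
  proof -
    have nn: "d n ^ j * exp (- d n * (1 + e)) \<ge> 0" for n using d_pos[of n] by simp
    have s: "summable (\<lambda>n. d n ^ j * exp (- d n * (1 + e)))"
      using part e nn by (intro bounded_imp_summable[where B = "K * e powr (- \<gamma> - 1 - real j)"])
         (metis lessThan_Suc_atMost)+
    thus ?thesis using part e by (auto intro!: suminf_le_const)
  qed
  thus ?thesis using K by blast
qed

text \<open>Comparison with the moment of order j + 1 at a point of (1, 2] not exceeding s. This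
  reaches j = 0 and large s, and is legitimate because d n \<ge> 1 for all but finitely many
  n.\<close>

lemma summable_moment:
  assumes "s > 1"
  shows "summable (\<lambda>n. d n ^ j * exp (- d n * s))"
proof -
  define e where "e = min 1 (s - 1)"
  have e: "0 < e" "e \<le> 1" "1 + e \<le> s" unfolding e_def using assms by auto
  obtain C where "summable (\<lambda>n. d n ^ (Suc j) * exp (- d n * (1 + e)))"
    using moment_sum_upper[of "Suc j"] e by auto
  moreover have "eventually (\<lambda>n. norm (d n ^ j * exp (- d n * s)) \<le> d n ^ (Suc j) * exp (- d n * (1 + e))) sequentially"
  proof -
    have "eventually (\<lambda>n. n \<notin> {n. d n \<le> 1}) sequentially"
      using finite_d_le[of 1] unfolding cofinite_eq_sequentially[symmetric] eventually_cofinite by simp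
    thus ?thesis
    proof eventually_elim
      case (elim n)
      hence 1: "d n \<ge> 1" by simp
      have "d n ^ j \<le> d n ^ Suc j" using 1 by (intro power_increasing) auto
      moreover have "exp (- d n * s) \<le> exp (- d n * (1 + e))" using e 1 by simp
      ultimately show ?case using 1 by (simp add: mult_mono del: power_Suc)
    qed
  qed
  ultimately show ?thesis by (rule summable_comparison_test_ev[rotated])
qed

text \<open>From u to u + h the main term grows by a relative amount of order h, while the two error
  terms have relative size \<open>u powr (- \<delta>)\<close>. As h is at least of order
  \<open>u powr (- \<tau>)\<close> with \<tau> < \<delta>, the growth dominates.\<close>

lemma count_window:
  assumes "0 < \<tau>" "\<tau> < \<delta>"
  shows "\<exists>u0>0. \<forall>u\<ge>u0. \<forall>h. u powr (-\<tau>) / 2 \<le> h \<and> h \<le> 1 \<longrightarrow>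
     real (card {n. u < d n \<and> d n \<le> u + h}) \<ge> \<rho> / 4 * h * u powr \<gamma> * exp u"
proof -
  obtain C' X where CX': "\<And>x. x \<ge> X \<Longrightarrow> \<bar>real (card {n. d n \<le> x}) - \<rho> * x powr \<gamma> * exp x\<bar>
      \<le> C' * x powr (\<gamma> - \<delta>) * exp x" using count_asymp by blast
  define C where "C = \<bar>C'\<bar>"
  have C0: "C \<ge> 0" unfolding C_def by simp
  have CX: "\<bar>real (card {n. d n \<le> x}) - \<rho> * x powr \<gamma> * exp x\<bar> \<le> C * x powr (\<gamma> - \<delta>) * exp x" if "x \<ge> X" for x
  proof -
    have "C' * (x powr (\<gamma> - \<delta>) * exp x) \<le> C * (x powr (\<gamma> - \<delta>) * exp x)"
      unfolding C_def by (intro mult_right_mono) auto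
    thus ?thesis using CX'[OF that] by (simp add: mult.assoc)
  qed
  \<comment> \<open>The errors at u and at u + h together, in units of
    \<open>u powr (\<gamma> - \<delta>) * exp u\<close>.\<close>
  define K where "K = C * (1 + 2 powr \<bar>\<gamma> - \<delta>\<bar> * exp 1)"
  have "((\<lambda>u. K * u powr (\<tau> - \<delta>)) \<longlongrightarrow> K * 0) at_top"
    using assms by (intro tendsto_mult tendsto_const tendsto_neg_powr filterlim_ident) auto
  hence "eventually (\<lambda>u. K * u powr (\<tau> - \<delta>) < \<rho> / 8) at_top"
    using rho_pos by (auto dest!: order_tendstoD(2)[where a = "\<rho>/8"])
  then obtain u1 where u1: "\<And>u. u \<ge> u1 \<Longrightarrow> K * u powr (\<tau> - \<delta>) < \<rho> / 8"
    by (auto simp: eventually_at_top_linorder)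
  \<comment> \<open>The bound 4 gives h / u \<le> h / 4, so that for \<gamma> < 0 the decrease of
    the power costs at most half of the gain h from exp h. Of the remaining h / 2 the errors take
    another h / 4.\<close>
  define u0 where "u0 = max (max u1 X) 4"
  have "real (card {n. u < d n \<and> d n \<le> u + h}) \<ge> \<rho> / 4 * h * u powr \<gamma> * exp u"
    if u: "u \<ge> u0" and h: "u powr (-\<tau>) / 2 \<le> h" "h \<le> 1" for u h
  proof -
    have u4: "u \<ge> 4" "u \<ge> X" "u \<ge> u1" using u unfolding u0_def by auto
    have h0: "h > 0"    proof -
      have "u powr (-\<tau>) > 0" using u4 by simp
      thus ?thesis using h(1) by linarith
    qed
    define G where "G = u powr \<gamma> * exp u"
    have G: "G > 0" unfolding G_def using u4 by simp
    have hu: "0 \<le> h / u" "h / u \<le> h / 4" using h0 u4 divide_left_mono[of 4 u h] by auto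
    have pw: "(u + h) powr a = u powr a * (1 + h/u) powr a" for a
    proof -
      have "u + h = u * (1 + h / u)" using u4 by (simp add: distrib_left)
      thus ?thesis using u4 hu(1) by (simp only: powr_mult)
    qed
    have ratio: "(1 + h / u) powr \<gamma> \<ge> 1 - h / u"
    proof -
      have "1 - h / u \<le> (1 + h/u) powr (-1)"
      proof -
        have "(1 - h / u) * (1 + h / u) \<le> 1" using hu(1) by (simp add: algebra_simps)
        thus ?thesis using hu(1) by (simp add: powr_minus_divide pos_le_divide_eq)
      qed
      also have "\<dots> \<le> (1 + h / u) powr \<gamma>" using hu gamma_gt by (intro powr_mono) auto
      finally show ?thesis .
    qed
    have 1: "(u + h) powr \<gamma> * exp (u + h) \<ge> G * (1 + h / 2)"
    proof -
      have "1 + h / 2 \<le> (1 - h / u) * (1 + h)"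
      proof -
        have "(h / u) * (1 + h) \<le> (h / 4) * 2" using hu h h0 by (intro mult_mono) auto
        moreover have "(1 - h / u) * (1 + h) = 1 + h - (h / u) * (1 + h)" by (simp add: algebra_simps)
        ultimately show ?thesis by linarith
      qed
      also have "\<dots> \<le> (1 + h / u) powr \<gamma> * exp h"
        using ratio exp_ge_add_one_self[of h] hu h h0 by (intro mult_mono) auto
      finally have "G * (1 + h / 2) \<le> G * ((1 + h / u) powr \<gamma> * exp h)" using G by simp
      also have "\<dots> = (u + h) powr \<gamma> * exp (u + h)"
        unfolding pw G_def by (simp add: exp_add mult_ac)
      finally show ?thesis .
    qed
    have 2: "(u + h) powr (\<gamma> - \<delta>) * exp (u + h) \<le> G * u powr (-\<delta>) * (2 powr \<bar>\<gamma> - \<delta>\<bar> * exp 1)"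
    proof -
      have "(1 + h / u) powr (\<gamma> - \<delta>) \<le> (1 + h/u) powr \<bar>\<gamma> - \<delta>\<bar>" using hu by (intro powr_mono) auto
      also have "\<dots> \<le> 2 powr \<bar>\<gamma> - \<delta>\<bar>"
      proof -
        have "h / u \<le> 1" using hu h by linarith
        thus ?thesis using hu by (intro powr_mono2) auto
      qed
      finally have "(1 + h / u) powr (\<gamma> - \<delta>) * exp h \<le> 2 powr \<bar>\<gamma> - \<delta>\<bar> * exp 1"
        using h by (intro mult_mono) auto
      hence "G * u powr (-\<delta>) * ((1 + h / u) powr (\<gamma> - \<delta>) * exp h) \<le> G * u powr (-\<delta>) * (2 powr \<bar>\<gamma> - \<delta>\<bar> * exp 1)"
        using G by (intro mult_left_mono) auto
      moreover have "G * u powr (-\<delta>) * ((1 + h / u) powr (\<gamma> - \<delta>) * exp h) = (u + h) powr (\<gamma> - \<delta>) * exp (u + h)"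
      proof -
        note pw[of "\<gamma> - \<delta>"]
        moreover have "u powr (\<gamma> - \<delta>) = u powr \<gamma> * u powr (-\<delta>)" by (simp add: powr_add[symmetric])
        ultimately show ?thesis unfolding G_def by (simp add: exp_add mult_ac)
      qed
      ultimately show ?thesis by simp
    qed
    have 3: "u powr (\<gamma> - \<delta>) * exp u = G * u powr (-\<delta>)"
      unfolding G_def by (simp add: powr_diff powr_minus field_simps)
    have err: "K * u powr (-\<delta>) \<le> \<rho> * h / 4"
    proof -
      have "K * u powr (-\<delta>) = (K * u powr (\<tau> - \<delta>)) * u powr (-\<tau>)" by (simp add: powr_add[symmetric])
      also have "\<dots> \<le> (\<rho> / 8) * u powr (-\<tau>)" using u1[OF u4(3)] by (intro mult_right_mono) auto
      also have "\<dots> \<le> (\<rho> / 8) * (2 * h)" using h rho_pos by (intro mult_left_mono) auto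
      finally show ?thesis by simp
    qed
    have "card {n. d n \<le> u + h} = card {n. d n \<le> u} + card {n. u < d n \<and> d n \<le> u + h}"
    proof -
      have "{n. d n \<le> u + h} = {n. d n \<le> u} \<union> {n. u < d n \<and> d n \<le> u + h}" using h0 by auto
      moreover have "finite {n. u < d n \<and> d n \<le> u + h}" using finite_d_le[of "u+h"] by (rule rev_finite_subset) auto
      ultimately show ?thesis using finite_d_le[of u] by (simp add: card_Un_disjoint disjoint_iff)
    qed
    hence "real (card {n. u < d n \<and> d n \<le> u + h}) = real (card {n. d n \<le> u + h}) - real (card {n. d n \<le> u})" by simp
    hence F1: "real (card {n. u < d n \<and> d n \<le> u + h}) \<ge> (\<rho> * ((u+h) powr \<gamma> * exp (u+h)) - C * ((u+h) powr (\<gamma> - \<delta>) * exp (u+h)))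
        - (\<rho> * G + C * (u powr (\<gamma> - \<delta>) * exp u))"
    proof -
      have "u + h \<ge> X" using u4 h0 by linarith
      moreover have "x - y \<ge> (r - s) - (r' + s')" if "\<bar>x - r\<bar> \<le> s" "\<bar>y - r'\<bar> \<le> s'" for x y r s r' s' :: real
        using that by linarith
      ultimately have "real (card {n. d n \<le> u + h}) - real (card {n. d n \<le> u}) \<ge>
         (\<rho> * (u+h) powr \<gamma> * exp (u+h) - C * (u+h) powr (\<gamma> - \<delta>) * exp (u+h))
        - (\<rho> * u powr \<gamma> * exp u + C * u powr (\<gamma> - \<delta>) * exp u)"
        using CX[of "u+h"] CX[of u] u4 by blast
      thus ?thesis using \<open>real (card {n. u < d n \<and> d n \<le> u + h}) = _\<close> unfolding G_def by (simp add: mult.assoc)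
    qed
    have F2: "\<rho> * ((u+h) powr \<gamma> * exp (u+h)) \<ge> \<rho> * (G * (1 + h/2))" using 1 rho_pos by simp
    have F3: "C * ((u+h) powr (\<gamma> - \<delta>) * exp (u+h)) \<le> C * (G * u powr (-\<delta>) * (2 powr \<bar>\<gamma> - \<delta>\<bar> * exp 1))"
      using 2 C0 by (rule mult_left_mono)
    have F4: "C * (u powr (\<gamma> - \<delta>) * exp u) + C * (G * u powr (-\<delta>) * (2 powr \<bar>\<gamma> - \<delta>\<bar> * exp 1)) = G * (K * u powr (-\<delta>))"
      unfolding 3 K_def by (simp add: algebra_simps)
    have F5: "G * (K * u powr (-\<delta>)) \<le> G * (\<rho> * h / 4)" using err G by (intro mult_left_mono) auto
    have F6: "\<rho> * (G * (1 + h/2)) - \<rho> * G - G * (\<rho> * h / 4) = \<rho> / 4 * h * G" by (simp add: algebra_simps)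
    \<comment> \<open>Stated for opaque reals, so that the linear arithmetic does not look inside
      the powers and exponentials.\<close>
    have "x \<ge> g" if "x \<ge> (a - b) - (r + c)" "a \<ge> a'" "b \<le> b'" "c + b' = k" "k \<le> k'" "a' - r - k' = g"
      for x a b c r a' b' k k' g :: real using that by linarith
    from this[OF F1 F2 F3 F4 F5 F6] have "real (card {n. u < d n \<and> d n \<le> u + h}) \<ge> \<rho> / 4 * h * G" .
    thus ?thesis unfolding G_def by (simp add: mult.assoc)
  qed
  moreover have "u0 > 0" unfolding u0_def by simp
  ultimately show ?thesis by blast
qed

text \<open>Needed twice: for the decay of the characteristic function, and at t = e for lower
  bounds on mean and variance. \<open>c0\<close> stays free because the width of the central range
  is fixed only when the variance is compared with the fourth moment.\<close>

lemma cosine_sum_lower: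
  assumes tau: "0 < \<tau>" "\<tau> < \<delta>" and c0: "c0 > 0"
  shows "\<exists>c1>0. \<exists>e0>0. \<forall>e t. 0 < e \<and> e < e0 \<and> c0 * e \<le> \<bar>t\<bar> \<and> \<bar>t\<bar> \<le> e powr (-\<tau>) \<longrightarrow>
     (\<Sum>n. exp (- d n * (1 + e)) * (1 - cos (t * d n))) \<ge> c1 * e powr (- \<gamma> - 1)"
proof -
  obtain u0 where u0: "u0 > 0" "\<And>u h. \<lbrakk>u \<ge> u0; u powr (-\<tau>) / 2 \<le> h; h \<le> 1\<rbrakk> \<Longrightarrow>
     real (card {n. u < d n \<and> d n \<le> u + h}) \<ge> \<rho> / 4 * h * u powr \<gamma> * exp u"
    using count_window[OF tau] by blast
  \<comment> \<open>Makes (A - 1) / 2 = 3/2 + 4 / c0. The part 4 / c0 outweighs the cosine sum, at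
    most 4 / t \<le> 4 / (c0 e) after scaling by h; of the part 3/2 at most 1/2 is lost to rounding
    J down, and a net length 1 / e remains.\<close>
  define A where "A = 4 + 8 / c0"
  have A: "A \<ge> 4" unfolding A_def using c0 by simp
  \<comment> \<open>\<rho> / 4 comes from \<open>count_window\<close>; for 1 \<le> u e \<le> A and
    \<gamma> > -1 the power \<open>(u * e) powr \<gamma>\<close> is at least 1 / A, and u - (u + 1)
    (1 + e) is at least - A - 2.\<close>
  define c1 where "c1 = \<rho> / 4 * (1 / A) * exp (- A - 2)"
  have c1: "c1 > 0" unfolding c1_def using A rho_pos by simp
  define e0 where "e0 = min 1 (1 / u0)"
  have "(\<Sum>n. exp (- d n * (1 + e)) * (1 - cos (t * d n))) \<ge> c1 * e powr (- \<gamma> - 1)"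
    if e: "0 < e" "e < e0" and t: "c0 * e \<le> t" "t \<le> e powr (-\<tau>)" for e t
  proof -
    have e1: "e < 1" "e < 1 / u0" using e unfolding e0_def by auto
    have eu: "1 / e \<ge> u0" using e1 e u0 by (simp add: field_simps)
    have t0: "t > 0" using t mult_pos_pos[OF c0 e(1)] by linarith
    \<comment> \<open>The primes between \<open>1 / e\<close> and \<open>A / e\<close> suffice. On a grid of mesh \<open>h\<close> every cell contains the
      expected number of primes, the cosine varies by at most \<open>1/2\<close> inside a cell, and it averages
      out over the grid.\<close>
    define h where "h = min 1 (1 / (2 * t))"
    have h: "0 < h" "h \<le> 1" "t * h \<le> 1/2" unfolding h_def using t0
      by (auto simp: min_def field_simps)
    \<comment> \<open>The upper bound on t keeps the mesh above the shortest window that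
      \<open>count_window\<close> can handle.\<close>
    have hlow: "e powr \<tau> / 2 \<le> h"
    proof -
      have "e powr \<tau> \<le> 1" using e e1 tau by (simp add: powr_le1)
      moreover have "e powr \<tau> / 2 \<le> 1 / (2 * t)" using t t0 e by (simp add: powr_minus field_simps)
      ultimately show ?thesis unfolding h_def by auto
    qed
    define J where "J = nat \<lfloor>(A - 1) / (e * h)\<rfloor>"
    have J: "real J \<le> (A - 1) / (e * h)" "real J \<ge> (A - 1) / (e * h) - 1"
      unfolding J_def using A e h by (auto simp: of_nat_nat intro: of_int_floor_le) (simp add: of_nat_nat; linarith)?
    define u where "u = (\<lambda>j::nat. 1 / e + real j * h)"
    define W where "W = (\<lambda>j. {n. u j < d n \<and> d n \<le> u j + h})"
    have finW: "finite (W j)" for j unfolding W_def using finite_d_le[of "u j + h"] by (rule rev_finite_subset) auto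
    have ujS: "u j + h = u (Suc j)" for j unfolding u_def by (simp add: algebra_simps)
    have umono: "u i \<le> u j" if "i \<le> j" for i j unfolding u_def using that h by (simp add: mult_right_mono)
    have disj: "W i \<inter> W j = {}" if "i \<noteq> j" for i j
    proof -
      have "W i \<inter> W j = {}" if "i < j" for i j
        using umono[of "Suc i" j] that unfolding W_def ujS by auto
      thus ?thesis using that by (metis Int_commute linorder_neqE_nat)
    qed
    define f where "f = (\<lambda>n. exp (- d n * (1 + e)) * (1 - cos (t * d n)))"
    have f0: "f n \<ge> 0" for n unfolding f_def by simp
    have sf: "summable f"
    proof -
      have "summable (\<lambda>n. 2 * (d n ^ 0 * exp (- d n * (1 + e))))" using e by (intro summable_mult summable_moment) auto
      moreover have "norm (f n) \<le> 2 * (d n ^ 0 * exp (- d n * (1 + e)))" for n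
        using cos_ge_minus_one[of "t * d n"] cos_le_one[of "t * d n"] unfolding f_def by (simp add: abs_mult)
      ultimately show ?thesis by (rule summable_comparison_test'[where N = 0])
    qed
    have win: "(\<Sum>n\<in>W j. f n) \<ge> c1 * e powr (- \<gamma>) * h * (1/2 - cos (t / e + real j * (t * h)))" if j: "j < J" for j
    proof -
      have uj: "u j \<ge> 1 / e" unfolding u_def using h by simp
      have uA: "u j \<le> A / e"
      proof -
        have "real j * h \<le> real J * h" using j h by (intro mult_right_mono) auto
        also have "\<dots> \<le> (A - 1) / (e * h) * h" using J h by (intro mult_right_mono) auto
        also have "\<dots> = (A - 1) / e" using h e by simp
        finally show ?thesis unfolding u_def by (simp add: diff_divide_distrib)
      qed
      have upos: "u j > 0" using uj divide_pos_pos[of 1 e] e by linarith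
      have ue: "1 \<le> u j * e" "u j * e \<le> A" using uj uA e by (auto simp: field_simps)
      have cnt: "real (card (W j)) \<ge> \<rho> / 4 * h * u j powr \<gamma> * exp (u j)"
        unfolding W_def
      proof (rule u0(2))
        show "u j \<ge> u0" using uj eu by linarith
        have "u j powr (-\<tau>) \<le> (1 / e) powr (-\<tau>)" using uj e tau by (intro powr_mono2') auto
        also have "\<dots> = e powr \<tau>" using e by (simp add: powr_minus powr_divide)
        finally show "u j powr (-\<tau>) / 2 \<le> h" using hlow by linarith
      qed (use h in auto)
      \<comment> \<open>Clipped at 0 so that it can be multiplied by the lower bounds for the count
        and the weight. The unclipped value, possibly negative, is what gets summed over the
        grid.\<close>
      define m where "m = max 0 (1/2 - cos (t * u j))"
      have pt: "f n \<ge> exp (- (u j + 1) * (1 + e)) * m" if n: "n \<in> W j" for n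
      proof -
        have dn: "u j < d n" "d n \<le> u j + h" using n unfolding W_def by auto
        have "\<bar>cos (t * d n) - cos (t * u j)\<bar> \<le> \<bar>t * d n - t * u j\<bar>"
          by (rule abs_cos_diff_le)
        also have "\<dots> = t * (d n - u j)" using dn t0 by (simp add: abs_mult right_diff_distrib[symmetric])
        also have "\<dots> \<le> t * h" using dn t0 by simp
        finally have "1 - cos (t * d n) \<ge> 1/2 - cos (t * u j)" using h by linarith
        hence "1 - cos (t * d n) \<ge> m" unfolding m_def by simp
        moreover have "exp (- (u j + 1) * (1 + e)) \<le> exp (- d n * (1 + e))"
        proof -
          have "d n * (1 + e) \<le> (u j + 1) * (1 + e)" using dn h e by (intro mult_right_mono) auto
          thus ?thesis by (simp only: exp_le_cancel_iff mult_minus_left neg_le_iff_le)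
        qed
        ultimately show ?thesis unfolding f_def using m_def by (intro mult_mono) auto
      qed
      have m0: "m \<ge> 0" unfolding m_def by simp
      have "c1 * e powr (- \<gamma>) * h * m \<le> (\<rho> / 4 * h * u j powr \<gamma> * exp (u j)) * (exp (- (u j + 1) * (1 + e)) * m)"
      proof -
        have "1 / A \<le> (u j * e) powr (-1)" using ue by (simp add: powr_minus_divide frac_le)
        also have "\<dots> \<le> (u j * e) powr \<gamma>" using ue gamma_gt by (intro powr_mono) auto
        finally have "1 / A * e powr (-\<gamma>) \<le> (u j * e) powr \<gamma> * e powr (-\<gamma>)" by (intro mult_right_mono) auto
        also have "\<dots> = u j powr \<gamma>" using e upos by (simp add: powr_mult powr_minus field_simps)
        finally have 1: "1 / A * e powr (-\<gamma>) \<le> u j powr \<gamma>" .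
        have 2: "exp (- A - 2) \<le> exp (u j) * exp (- (u j + 1) * (1 + e))"
        proof -
          have "- A - 2 \<le> u j + - (u j + 1) * (1 + e)" using ue e1 by (simp add: algebra_simps)
          thus ?thesis by (metis exp_add exp_le_cancel_iff)
        qed
        have "(1 / A * e powr (-\<gamma>)) * exp (- A - 2) \<le> u j powr \<gamma> * (exp (u j) * exp (- (u j + 1) * (1 + e)))"
          using 1 2 by (intro mult_mono) auto
        hence "(\<rho> / 4 * h * m) * ((1 / A * e powr (-\<gamma>)) * exp (- A - 2)) \<le> (\<rho> / 4 * h * m) * (u j powr \<gamma> * (exp (u j) * exp (- (u j + 1) * (1 + e))))"
          using rho_pos h m0 by (intro mult_left_mono) auto
        thus ?thesis unfolding c1_def by (simp add: mult_ac)
      qed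
      also have "\<dots> \<le> real (card (W j)) * (exp (- (u j + 1) * (1 + e)) * m)"
        using cnt m0 by (intro mult_right_mono) auto
      also have "\<dots> \<le> (\<Sum>n\<in>W j. f n)" using pt by (intro sum_bounded_below) auto
      finally have "c1 * e powr (- \<gamma>) * h * m \<le> (\<Sum>n\<in>W j. f n)" .
      moreover have "c1 * e powr (- \<gamma>) * h * (1/2 - cos (t * u j)) \<le> c1 * e powr (- \<gamma>) * h * m"
        using c1 h unfolding m_def by (intro mult_left_mono) auto
      moreover have "t * u j = t / e + real j * (t * h)" unfolding u_def by (simp add: algebra_simps)
      ultimately show ?thesis by simp
    qed
    have "c1 * e powr (- \<gamma> - 1) = c1 * e powr (-\<gamma>) * (1 / e)" using e by (simp add: powr_diff)
    also have "\<dots> \<le> c1 * e powr (-\<gamma>) * (h * (real J / 2 - 4 / (t * h)))"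
    proof (intro mult_left_mono)
      have "h * (real J / 2 - 4 / (t * h)) = (h * real J) / 2 - 4 / t" using h t0 by (simp add: field_simps)
      moreover have "h * real J \<ge> (A - 1) / e - 1"
      proof -
        have "h * real J \<ge> h * ((A - 1) / (e * h) - 1)" using J h by (intro mult_left_mono) auto
        also have "h * ((A - 1) / (e * h) - 1) = (A - 1) / e - h" using h e by (simp only: right_diff_distrib) simp
        finally show ?thesis using h by linarith
      qed
      moreover have "4 / t \<le> 4 / (c0 * e)" using t c0 e by (intro divide_left_mono) (auto simp: t0)
      moreover have "1 \<le> 1 / e" using e e1 by simp
      moreover have "((A - 1) / e) / 2 = (3/2) * (1 / e) + 4 / (c0 * e)" unfolding A_def using c0 e by (simp add: field_simps)
      moreover have arith: "i \<le> x" if "x = y / 2 - s" "y \<ge> v - 1" "s \<le> q" "1 \<le> i" "v / 2 = 3/2 * i + q"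
        for x y s v q i :: real using that by linarith
      ultimately show "1 / e \<le> h * (real J / 2 - 4 / (t * h))" by blast
    qed (use c1 in auto)
    also have "\<dots> \<le> c1 * e powr (-\<gamma>) * (h * (real J / 2 - (\<Sum>j<J. cos (t / e + real j * (t * h)))))"
      using c1 h t0 sum_cos_le[of "t * h" "t / e" J] by (intro mult_left_mono) auto
    also have "\<dots> = (\<Sum>j<J. c1 * e powr (- \<gamma>) * h * (1/2 - cos (t / e + real j * (t * h))))"
      by (simp add: sum_distrib_left[symmetric] sum_subtractf)
    also have "\<dots> \<le> (\<Sum>j<J. \<Sum>n\<in>W j. f n)" using win by (intro sum_mono) auto
    also have "\<dots> = (\<Sum>n\<in>(\<Union>j<J. W j). f n)"
      using finW disj by (intro sum.UNION_disjoint[symmetric]) auto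
    also have "\<dots> \<le> (\<Sum>n. f n)" using sf f0 finW by (intro sum_le_suminf) auto
    finally show ?thesis unfolding f_def .
  qed
  note main = this
  have "(\<Sum>n. exp (- d n * (1 + e)) * (1 - cos (t * d n))) \<ge> c1 * e powr (- \<gamma> - 1)"
    if "0 < e \<and> e < e0 \<and> c0 * e \<le> \<bar>t\<bar> \<and> \<bar>t\<bar> \<le> e powr (-\<tau>)" for e t
  proof -
    have "cos (\<bar>t\<bar> * d n) = cos (t * d n)" for n by (cases "t \<ge> 0") auto
    thus ?thesis using main[of e "\<bar>t\<bar>"] that by simp
  qed
  moreover have "e0 > 0" unfolding e0_def using u0 by simp
  ultimately show ?thesis using c1 by blast
qed

end

section \<open>Gaussian smoothing\<close>

text \<open>At \<sigma> = s and w = deg a - x this cancels the tilt on the counted elements and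
  vanishes on all others; see \<open>tilted_cut_exp\<close>.\<close>

definition cut_exp :: "real \<Rightarrow> real \<Rightarrow> real" where
  "cut_exp \<sigma> w = exp (\<sigma> * w) * indicator {..0} w"

definition smooth_exp :: "real \<Rightarrow> real \<Rightarrow> real \<Rightarrow> real" where
  "smooth_exp \<sigma> \<eta> y = (\<integral>w. cut_exp \<sigma> w * normal_density y \<eta> w \<partial>lborel)"

lemma cut_exp_measurable [measurable]: "cut_exp \<sigma> \<in> borel_measurable borel"
  unfolding cut_exp_def by measurable

lemma cut_exp_nonneg: "cut_exp \<sigma> w \<ge> 0"
  unfolding cut_exp_def by simp

lemma cut_exp_le_1: "\<sigma> > 0 \<Longrightarrow> cut_exp \<sigma> w \<le> 1"
  unfolding cut_exp_def by (auto simp: indicator_def mult_nonneg_nonpos)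

text \<open>The substitution x = - \<sigma> w turns this into the Gamma integral. The cases n = 0
  and n = 2 give the mass 1 / \<sigma> and the second moment.\<close>

lemma has_bochner_integral_cut_exp_moment:
  assumes "\<sigma> > 0"
  shows "has_bochner_integral lborel (\<lambda>w. cut_exp \<sigma> w * (- \<sigma> * w) ^ n) (fact n / \<sigma>)"
proof -
  have "has_bochner_integral lborel (\<lambda>x. x ^ n * exp (- x) * indicator {0..} x :: real) (fact n)"
  proof (rule has_bochner_integral_nn_integral)
    have "(\<integral>\<^sup>+x. ennreal (x ^ n * exp (- x) * indicator {0..} x) \<partial>lborel)
        = (\<integral>\<^sup>+x. ennreal (x^n * exp (-x)) * indicator {0 ..} x \<partial>lborel)"
      by (intro nn_integral_cong) (auto simp: indicator_def)
    thus "(\<integral>\<^sup>+x. ennreal (x ^ n * exp (- x) * indicator {0..} x) \<partial>lborel) = ennreal (fact n)"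
      by (simp add: nn_intergal_power_times_exp_Ici)
  qed (auto simp: indicator_def)
  hence "has_bochner_integral lborel (\<lambda>w. (0 + (-\<sigma>) * w) ^ n * exp (- (0 + (-\<sigma>) * w)) * indicator {0..} (0 + (-\<sigma>) * w)) (fact n /\<^sub>R \<bar>-\<sigma>\<bar>)"
    using assms by (subst (asm) lborel_has_bochner_integral_real_affine_iff[of "-\<sigma>" _ _ 0]) auto
  also have "(\<lambda>w. (0 + (-\<sigma>) * w) ^ n * exp (- (0 + (-\<sigma>) * w)) * indicator {0..} (0 + (-\<sigma>) * w))
       = (\<lambda>w. cut_exp \<sigma> w * (- \<sigma> * w) ^ n)"
    using assms by (auto simp: cut_exp_def indicator_def mult_le_0_iff fun_eq_iff)
  finally show ?thesis using assms by (simp add: divide_inverse mult.commute)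
qed

lemma integrable_density_bounded:
  assumes "\<eta> > 0" "f \<in> borel_measurable borel" "\<And>w. norm (f w) \<le> (C::real)"
  shows "integrable lborel (\<lambda>w. f w * normal_density y \<eta> w)"
proof (rule Bochner_Integration.integrable_bound)
  show "integrable lborel (\<lambda>w. C * normal_density y \<eta> w)"
    using assms(1) by (intro integrable_mult_right integrable_normal_density)
  show "AE x in lborel. norm (f x * normal_density y \<eta> x) \<le> norm (C * normal_density y \<eta> x)"
  proof (rule AE_I2)
    fix x
    have "\<bar>f x\<bar> \<le> \<bar>C\<bar>" using assms(3)[of x] by simp
    thus "norm (f x * normal_density y \<eta> x) \<le> norm (C * normal_density y \<eta> x)"
      by (simp add: abs_mult mult_right_mono)
  qed
qed (use assms in measurable)

lemma smooth_exp_shift: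
  "smooth_exp \<sigma> \<eta> y = (\<integral>v. cut_exp \<sigma> (y + v) * normal_density 0 \<eta> v \<partial>lborel)"
  unfolding smooth_exp_def
  by (subst lborel_integral_real_affine[where c = 1 and t = y]) (auto simp: normal_density_def)

lemma smooth_exp_bounds:
  assumes "\<eta> > 0" "\<sigma> > 0"
  shows "0 \<le> smooth_exp \<sigma> \<eta> y" "smooth_exp \<sigma> \<eta> y \<le> 1"
proof -
  show "0 \<le> smooth_exp \<sigma> \<eta> y" unfolding smooth_exp_def
    by (intro integral_nonneg_AE AE_I2) (simp add: cut_exp_nonneg)
  have "smooth_exp \<sigma> \<eta> y \<le> (\<integral>w. normal_density y \<eta> w \<partial>lborel)"
    unfolding smooth_exp_def
  proof (rule integral_mono)
    show "integrable lborel (\<lambda>w. cut_exp \<sigma> w * normal_density y \<eta> w)"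
      using assms by (intro integrable_density_bounded[where C = 1]) (auto simp: cut_exp_nonneg cut_exp_le_1)
    show "integrable lborel (\<lambda>w. normal_density y \<eta> w)" using assms by (intro integrable_normal_density)
    fix x show "cut_exp \<sigma> x * normal_density y \<eta> x \<le> normal_density y \<eta> x"
      using cut_exp_le_1[OF assms(2), of x] by (simp add: mult_left_le_one_le cut_exp_nonneg)
  qed
  thus "smooth_exp \<sigma> \<eta> y \<le> 1" using integral_normal_density[OF assms(1), of y] by simp
qed

definition normal_tail :: "real \<Rightarrow> real \<Rightarrow> real" where
  "normal_tail \<eta> u = (\<integral>v. indicator {v. \<bar>v\<bar> > u} v * normal_density 0 \<eta> v \<partial>lborel)"

text \<open>Chernoff's bound: the indicator is at most exp (- u/\<eta>) times exp (v/\<eta>) + exp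
  (- v/\<eta>), and such a factor merely shifts the Gaussian by \<eta> at the cost exp (1/2).
  Exponential decay is enough, since u / \<eta> will be a negative power of e.\<close>

lemma normal_tail_le:
  assumes "\<eta> > 0"
  shows "normal_tail \<eta> u \<le> 4 * exp (- u / \<eta>)"
proof -
  have shift: "exp (c * v / \<eta>) * normal_density 0 \<eta> v = exp (1/2) * normal_density (c * \<eta>) \<eta> v"
    if "c = 1 \<or> c = -1" for c v
  proof -
    have c2: "c * c = 1" using that by auto
    have "c * v / \<eta> - v\<^sup>2 / (2 * \<eta>\<^sup>2) = 1/2 - (v - c * \<eta>)\<^sup>2 / (2 * \<eta>\<^sup>2)"
    proof -
      have "(v - c * \<eta>)\<^sup>2 = v\<^sup>2 - 2 * c * v * \<eta> + (c * c) * \<eta>\<^sup>2" by (simp add: power2_eq_square algebra_simps)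
      thus ?thesis using assms c2 by (simp add: field_simps power2_eq_square)
    qed
    thus ?thesis unfolding normal_density_def by (simp add: exp_diff[symmetric] exp_add[symmetric] mult.left_commute)
  qed
  have int: "integrable lborel (\<lambda>v. exp (- u / \<eta>) * (exp (1/2) * (normal_density (1 * \<eta>) \<eta> v + normal_density (-1 * \<eta>) \<eta> v)))"
    using assms by (intro integrable_mult_right Bochner_Integration.integrable_add integrable_normal_density)
  have "normal_tail \<eta> u \<le> (\<integral>v. exp (- u / \<eta>) * (exp (1/2) * (normal_density (1 * \<eta>) \<eta> v + normal_density (-1 * \<eta>) \<eta> v)) \<partial>lborel)"
    unfolding normal_tail_def
  proof (rule integral_mono[OF _ int])
    show "integrable lborel (\<lambda>v. indicator {v. \<bar>v\<bar> > u} v * normal_density 0 \<eta> v)"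
      using assms by (intro integrable_density_bounded[where C = 1]) (auto simp: indicator_def)
    fix v
    have "indicator {v. \<bar>v\<bar> > u} v \<le> exp (- u / \<eta>) * (exp (1 * v / \<eta>) + exp (-1 * v / \<eta>))"
    proof (cases "\<bar>v\<bar> > u")
      case True
      have "1 \<le> exp (- u / \<eta> + \<bar>v\<bar> / \<eta>)" using True assms by (simp add: divide_right_mono)
      also have "\<dots> = exp (- u / \<eta>) * exp (\<bar>v\<bar> / \<eta>)" by (rule exp_add)
      also have "\<dots> \<le> exp (- u / \<eta>) * (exp (1 * v / \<eta>) + exp (-1 * v / \<eta>))"
        by (intro mult_left_mono) (auto simp: abs_if)
      finally show ?thesis using True by simp
    qed auto
    hence "indicator {v. \<bar>v\<bar> > u} v * normal_density 0 \<eta> v \<le>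
       exp (- u / \<eta>) * (exp (1 * v / \<eta>) + exp (-1 * v / \<eta>)) * normal_density 0 \<eta> v"
      by (intro mult_right_mono) auto
    also have "\<dots> = exp (- u / \<eta>) * (exp (1 * v / \<eta>) * normal_density 0 \<eta> v + exp (-1 * v / \<eta>) * normal_density 0 \<eta> v)"
      by (simp only: distrib_right mult.assoc)
    also have "\<dots> = exp (- u / \<eta>) * (exp (1/2) * (normal_density (1 * \<eta>) \<eta> v + normal_density (-1 * \<eta>) \<eta> v))"
      by (subst (1 2) shift) (simp_all add: distrib_left)
    finally show "indicator {v. \<bar>v\<bar> > u} v * normal_density 0 \<eta> v \<le>
      exp (- u / \<eta>) * (exp (1/2) * (normal_density (1 * \<eta>) \<eta> v + normal_density (-1 * \<eta>) \<eta> v))" .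
  qed
  also have "\<dots> = exp (- u / \<eta>) * (exp (1/2) * 2)"
    using assms by (simp add: integral_normal_density integrable_normal_density)
  also have "\<dots> \<le> exp (- u / \<eta>) * 4"
  proof -
    have "(exp (1/2::real))\<^sup>2 = exp 1" by (simp add: exp_double[symmetric])
    hence "(exp (1/2::real))\<^sup>2 \<le> 2\<^sup>2" using exp_le by simp
    hence "exp (1/2::real) \<le> 2" by (rule power2_le_imp_le) simp
    thus ?thesis by (intro mult_left_mono) auto
  qed
  finally show ?thesis by simp
qed

text \<open>The shift by u leaves room for the noise v: for y \<le> 0 and |v| \<le> u the point y -
  u + v is still nonpositive and at most 2 u below y, so the exponential loses at most a factor exp
  (2 \<sigma> u). Larger noise is dropped, at the cost of the tail.\<close>

lemma cut_exp_le_smooth: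
  assumes "\<eta> > 0" "\<sigma> > 0" "u \<ge> 0"
  shows "cut_exp \<sigma> y * (1 - normal_tail \<eta> u) \<le> exp (2 * \<sigma> * u) * smooth_exp \<sigma> \<eta> (y - u)"
proof -
  have "1 - normal_tail \<eta> u = (\<integral>v. normal_density 0 \<eta> v - indicator {v. \<bar>v\<bar> > u} v * normal_density 0 \<eta> v \<partial>lborel)"
    unfolding normal_tail_def using assms
    by (subst Bochner_Integration.integral_diff) (auto intro!: integrable_density_bounded[where C = 1] simp: indicator_def integral_normal_density integrable_normal_density)
  hence "cut_exp \<sigma> y * (1 - normal_tail \<eta> u) = (\<integral>v. cut_exp \<sigma> y * (normal_density 0 \<eta> v - indicator {v. \<bar>v\<bar> > u} v * normal_density 0 \<eta> v) \<partial>lborel)"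
    by simp
  also have "\<dots> \<le> (\<integral>v. exp (2 * \<sigma> * u) * (cut_exp \<sigma> (y - u + v) * normal_density 0 \<eta> v) \<partial>lborel)"
  proof (rule integral_mono)
    show "integrable lborel (\<lambda>v. cut_exp \<sigma> y * (normal_density 0 \<eta> v - indicator {v. \<bar>v\<bar> > u} v * normal_density 0 \<eta> v))"
      using assms by (intro integrable_mult_right Bochner_Integration.integrable_diff integrable_normal_density integrable_density_bounded[where C = 1]) (auto simp: indicator_def)
    show "integrable lborel (\<lambda>v. exp (2 * \<sigma> * u) * (cut_exp \<sigma> (y - u + v) * normal_density 0 \<eta> v))"
      using assms by (intro integrable_mult_right integrable_density_bounded[where C = 1]) (auto simp: cut_exp_nonneg cut_exp_le_1)
    fix v
    show "cut_exp \<sigma> y * (normal_density 0 \<eta> v - indicator {v. \<bar>v\<bar> > u} v * normal_density 0 \<eta> v) \<le>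
      exp (2 * \<sigma> * u) * (cut_exp \<sigma> (y - u + v) * normal_density 0 \<eta> v)"
    proof (cases "\<bar>v\<bar> > u")
      case True thus ?thesis by (simp add: cut_exp_nonneg)
    next
      case False
      have "cut_exp \<sigma> y \<le> exp (2 * \<sigma> * u) * cut_exp \<sigma> (y - u + v)"
      proof (cases "y \<le> 0")
        case True
        hence "y - u + v \<le> 0" using False by auto
        moreover have "\<sigma> * y \<le> 2 * \<sigma> * u + \<sigma> * (y - u + v)"
        proof -
          have "\<sigma> * 0 \<le> \<sigma> * (u + v)" using False assms by (intro mult_left_mono) auto
          thus ?thesis by (simp add: algebra_simps)
        qed
        ultimately show ?thesis using True by (simp add: cut_exp_def exp_add[symmetric])
      qed (simp add: cut_exp_def)
      hence "cut_exp \<sigma> y * normal_density 0 \<eta> v \<le> exp (2 * \<sigma> * u) * cut_exp \<sigma> (y - u + v) * normal_density 0 \<eta> v"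
        by (intro mult_right_mono) auto
      thus ?thesis using False by (simp add: mult.assoc)
    qed
  qed
  finally show ?thesis unfolding smooth_exp_shift[of \<sigma> \<eta> "y - u"] by simp
qed

text \<open>The reverse direction: if |v| \<le> u and y + u + v \<le> 0, then y \<le> 0 as well. For
  larger noise the bound \<open>cut_exp_le_1\<close> produces the additive tail.\<close>

lemma smooth_le_cut_exp:
  assumes "\<eta> > 0" "\<sigma> > 0" "u \<ge> 0"
  shows "smooth_exp \<sigma> \<eta> (y + u) \<le> exp (2 * \<sigma> * u) * cut_exp \<sigma> y + normal_tail \<eta> u"
proof -
  have "smooth_exp \<sigma> \<eta> (y + u) \<le> (\<integral>v. exp (2 * \<sigma> * u) * cut_exp \<sigma> y * normal_density 0 \<eta> v + indicator {v. \<bar>v\<bar> > u} v * normal_density 0 \<eta> v \<partial>lborel)"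
    unfolding smooth_exp_shift
  proof (rule integral_mono)
    show "integrable lborel (\<lambda>v. exp (2 * \<sigma> * u) * cut_exp \<sigma> y * normal_density 0 \<eta> v + indicator {v. \<bar>v\<bar> > u} v * normal_density 0 \<eta> v)"
      using assms by (intro Bochner_Integration.integrable_add integrable_mult_right integrable_normal_density integrable_density_bounded[where C = 1]) (auto simp: indicator_def)
    show "integrable lborel (\<lambda>v. cut_exp \<sigma> (y + u + v) * normal_density 0 \<eta> v)"
      using assms by (intro integrable_density_bounded[where C = 1]) (auto simp: cut_exp_nonneg cut_exp_le_1)
    fix v
    have "cut_exp \<sigma> (y + u + v) \<le> exp (2 * \<sigma> * u) * cut_exp \<sigma> y + indicator {v. \<bar>v\<bar> > u} v"
    proof (cases "\<bar>v\<bar> > u")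
      case True
      have "cut_exp \<sigma> (y + u + v) \<le> 1" by (rule cut_exp_le_1[OF assms(2)])
      moreover have "exp (2 * \<sigma> * u) * cut_exp \<sigma> y \<ge> 0" by (simp add: cut_exp_nonneg)
      ultimately show ?thesis using True by simp
    next
      case False
      have "cut_exp \<sigma> (y + u + v) \<le> exp (2 * \<sigma> * u) * cut_exp \<sigma> y"
      proof (cases "y + u + v \<le> 0")
        case True
        hence "y \<le> 0" using False by auto
        moreover have "\<sigma> * (y + u + v) \<le> 2 * \<sigma> * u + \<sigma> * y"
        proof -
          have "\<sigma> * 0 \<le> \<sigma> * (u - v)" using False assms by (intro mult_left_mono) auto
          thus ?thesis by (simp add: algebra_simps)
        qed
        ultimately show ?thesis using True by (simp add: cut_exp_def exp_add[symmetric])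
      next
        case False
        hence "cut_exp \<sigma> (y + u + v) = 0" by (simp add: cut_exp_def)
        thus ?thesis by (simp add: cut_exp_nonneg)
      qed
      thus ?thesis using False by simp
    qed
    hence "cut_exp \<sigma> (y + u + v) * normal_density 0 \<eta> v \<le> (exp (2 * \<sigma> * u) * cut_exp \<sigma> y + indicator {v. \<bar>v\<bar> > u} v) * normal_density 0 \<eta> v"
      by (intro mult_right_mono) auto
    thus "cut_exp \<sigma> (y + u + v) * normal_density 0 \<eta> v \<le> exp (2 * \<sigma> * u) * cut_exp \<sigma> y * normal_density 0 \<eta> v + indicator {v. \<bar>v\<bar> > u} v * normal_density 0 \<eta> v"
      by (simp add: distrib_right)
  qed
  also have "\<dots> = exp (2 * \<sigma> * u) * cut_exp \<sigma> y + normal_tail \<eta> u"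
    unfolding normal_tail_def using assms
    by (subst Bochner_Integration.integral_add)
       (auto intro!: integrable_mult_right integrable_density_bounded[where C = 1] simp: indicator_def integral_normal_density integrable_normal_density)
  finally show ?thesis .
qed

text \<open>The Gaussians of deviation 1/\<eta> and \<eta> are dual; rescaling reduces the claim to
  the characteristic function of the standard normal law.\<close>

lemma gaussian_fourier:
  assumes "\<eta> > 0"
  shows "(CLINT t|lborel. complex_of_real (normal_density 0 (1/\<eta>) t) * iexp (t * x)) = of_real (exp (- x\<^sup>2 / (2 * \<eta>\<^sup>2)))"
proof -
  have "(CLINT t|lborel. complex_of_real (normal_density 0 (1/\<eta>) t) * iexp (t * x))
     = \<bar>1/\<eta>\<bar> *\<^sub>R (CLINT t|lborel. complex_of_real (normal_density 0 (1/\<eta>) (0 + (1/\<eta>) * t)) * iexp ((0 + (1/\<eta>) * t) * x))"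
    using assms by (intro lborel_integral_real_affine) auto
  also have "\<dots> = (CLINT t|lborel. \<bar>1/\<eta>\<bar> *\<^sub>R (complex_of_real (normal_density 0 (1/\<eta>) (0 + (1/\<eta>) * t)) * iexp ((0 + (1/\<eta>) * t) * x)))"
    by (rule integral_scaleR_right[symmetric])
  also have "\<dots> = (CLINT t|lborel. std_normal_density t *\<^sub>R iexp ((x/\<eta>) * t))"
  proof (intro Bochner_Integration.integral_cong refl)
    fix t
    have "\<bar>1/\<eta>\<bar> * normal_density 0 (1/\<eta>) (0 + (1/\<eta>) * t) = std_normal_density t"
      using assms by (simp add: normal_density_def power2_eq_square real_sqrt_divide real_sqrt_mult)
    thus "\<bar>1/\<eta>\<bar> *\<^sub>R (complex_of_real (normal_density 0 (1/\<eta>) (0 + (1/\<eta>) * t)) * iexp ((0 + (1/\<eta>) * t) * x)) = std_normal_density t *\<^sub>R iexp ((x/\<eta>) * t)"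
      by (metis (no_types, opaque_lifting) add_0 mult.commute scaleR_conv_of_real scaleR_scaleR times_divide_eq_left times_divide_eq_right mult_1)
  qed
  also have "\<dots> = char std_normal_distribution (x/\<eta>)"
    unfolding char_def by (subst integral_density) auto
  also have "\<dots> = of_real (exp (- x\<^sup>2 / (2 * \<eta>\<^sup>2)))"
    by (simp add: char_std_normal_distribution power_divide field_simps)
  finally show ?thesis .
qed

section \<open>Fourier inversion for a random variable with Gaussian noise\<close>

locale real_variable = prob_space M for M :: "'b measure" +
  fixes Y :: "'b \<Rightarrow> real"
  assumes Y_measurable [measurable]: "Y \<in> borel_measurable M"
begin

definition cf :: "real \<Rightarrow> complex" where
  "cf t = (CLINT \<omega>|M. iexp (t * Y \<omega>))"

text \<open>The density at y of Y plus an independent centred Gaussian of standard deviation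
  \<eta>.\<close>

definition smooth_density :: "real \<Rightarrow> real \<Rightarrow> real" where
  "smooth_density \<eta> y = (\<integral>\<omega>. normal_density y \<eta> (Y \<omega>) \<partial>M)"

lemma norm_cf_le_1: "norm (cf t) \<le> 1"
proof -
  have "norm (cf t) \<le> (\<integral>\<omega>. norm (iexp (t * Y \<omega>)) \<partial>M)" unfolding cf_def by (rule integral_norm_bound)
  thus ?thesis by (simp add: prob_space del: of_real_mult)
qed

lemma cf_measurable [measurable]: "cf \<in> borel_measurable borel"
  unfolding cf_def by measurable

text \<open>The Gaussian is written as a Fourier transform and the integrals are exchanged.
  \<open>cf\<close> is merely bounded, and the Gaussian weight supplies the convergence.\<close>

lemma smooth_density_inversion:
  assumes "\<eta> > 0"
  shows "of_real (smooth_density \<eta> y) = of_real (1 / (sqrt (2 * pi) * \<eta>)) *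
     (CLINT t|lborel. of_real (normal_density 0 (1/\<eta>) t) * (cf t * iexp (- t * y)))"
proof -
  define N where "N = density lborel (\<lambda>t. ennreal (normal_density 0 (1/\<eta>) t))"
  interpret N: prob_space N unfolding N_def using assms by (intro prob_space_normal_density) auto
  interpret MN: pair_prob_space M N ..
  have [measurable_cong]: "sets N = sets borel" unfolding N_def by simp
  have int: "integrable (M \<Otimes>\<^sub>M N) (\<lambda>(\<omega>, t). iexp (t * (Y \<omega> - y)))"
    by (rule MN.integrable_const_bound[where B = 1]) (auto simp del: of_real_mult simp: case_prod_unfold)
  have intN: "(CLINT t|N. f t) = (CLINT t|lborel. of_real (normal_density 0 (1/\<eta>) t) * f t)" if "f \<in> borel_measurable borel" for f :: "real \<Rightarrow> complex"
    unfolding N_def using that by (subst integral_density) (auto simp: scaleR_conv_of_real)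
  have "of_real (sqrt (2 * pi) * \<eta> * smooth_density \<eta> y) = (CLINT \<omega>|M. of_real (exp (- (Y \<omega> - y)\<^sup>2 / (2 * \<eta>\<^sup>2))))"
  proof -
    have "sqrt (2 * pi) * \<eta> * smooth_density \<eta> y = (\<integral>\<omega>. sqrt (2 * pi) * \<eta> * normal_density y \<eta> (Y \<omega>) \<partial>M)"
      unfolding smooth_density_def by simp
    also have "\<dots> = (\<integral>\<omega>. exp (- (Y \<omega> - y)\<^sup>2 / (2 * \<eta>\<^sup>2)) \<partial>M)"
      using assms by (intro Bochner_Integration.integral_cong refl) (simp add: normal_density_def real_sqrt_mult)
    finally show ?thesis by (simp only: integral_complex_of_real)
  qed
  also have "\<dots> = (CLINT \<omega>|M. CLINT t|N. iexp (t * (Y \<omega> - y)))"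
    by (intro Bochner_Integration.integral_cong refl) (subst intN, simp, rule gaussian_fourier[OF assms, symmetric])
  also have "\<dots> = (CLINT t|N. CLINT \<omega>|M. iexp (t * (Y \<omega> - y)))"
    using int by (intro MN.Fubini_integral[symmetric])
  also have "\<dots> = (CLINT t|N. cf t * iexp (- t * y))"
  proof (intro Bochner_Integration.integral_cong refl)
    fix t
    have "iexp (t * (Y \<omega> - y)) = iexp (t * Y \<omega>) * iexp (- t * y)" for \<omega>
      unfolding exp_add[symmetric] by (simp add: algebra_simps)
    thus "(CLINT \<omega>|M. iexp (t * (Y \<omega> - y))) = cf t * iexp (- t * y)"
      unfolding cf_def by simp
  qed
  also have "\<dots> = (CLINT t|lborel. of_real (normal_density 0 (1/\<eta>) t) * (cf t * iexp (- t * y)))"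
    by (rule intN) measurable
  finally show ?thesis using assms by (simp add: field_simps)
qed

text \<open>A Gaussian density is symmetric in its argument and its mean, so after Fubini the noise
  moves from \<open>cut_exp\<close> to Y.\<close>

lemma expectation_smooth_exp:
  assumes "\<eta> > 0" "\<sigma> > 0"
  shows "(\<integral>\<omega>. smooth_exp \<sigma> \<eta> (Y \<omega> - u) \<partial>M) = (\<integral>w. cut_exp \<sigma> w * smooth_density \<eta> (w + u) \<partial>lborel)"
proof -
  interpret PL: pair_sigma_finite M lborel ..
  define f where "f = (\<lambda>\<omega> w. cut_exp \<sigma> w * normal_density (Y \<omega> - u) \<eta> w)"
  have fm: "case_prod f \<in> borel_measurable (M \<Otimes>\<^sub>M lborel)"
    unfolding f_def normal_density_def by measurable
  have sm: "(\<lambda>\<omega>. smooth_exp \<sigma> \<eta> (Y \<omega> - u)) \<in> borel_measurable M"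
    unfolding smooth_exp_def normal_density_def by measurable
  have int: "integrable (M \<Otimes>\<^sub>M lborel) (case_prod f)"
  proof (rule PL.Fubini_integrable[OF fm])
    have "(\<lambda>\<omega>. \<integral>w. norm (case (\<omega>, w) of (x, xa) \<Rightarrow> f x xa) \<partial>lborel) = (\<lambda>\<omega>. smooth_exp \<sigma> \<eta> (Y \<omega> - u))"
      unfolding f_def smooth_exp_def by (auto simp: cut_exp_nonneg abs_mult)
    moreover have "integrable M (\<lambda>\<omega>. smooth_exp \<sigma> \<eta> (Y \<omega> - u))"
      using smooth_exp_bounds[OF assms] sm by (intro integrable_const_bound[where B = 1]) auto
    ultimately show "integrable M (\<lambda>\<omega>. \<integral>w. norm (case (\<omega>, w) of (x, xa) \<Rightarrow> f x xa) \<partial>lborel)" by simp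
    show "AE x in M. integrable lborel (\<lambda>w. case (x, w) of (x, xa) \<Rightarrow> f x xa)"
      unfolding f_def using assms
      by (intro AE_I2) (auto intro!: integrable_density_bounded[where C = 1] simp: cut_exp_nonneg cut_exp_le_1)
  qed
  have "(\<integral>\<omega>. smooth_exp \<sigma> \<eta> (Y \<omega> - u) \<partial>M) = (\<integral>\<omega>. \<integral>w. f \<omega> w \<partial>lborel \<partial>M)"
    unfolding f_def smooth_exp_def by simp
  also have "\<dots> = (\<integral>w. \<integral>\<omega>. f \<omega> w \<partial>M \<partial>lborel)" using int by (rule PL.Fubini_integral[symmetric])
  also have "\<dots> = (\<integral>w. cut_exp \<sigma> w * smooth_density \<eta> (w + u) \<partial>lborel)"
  proof (intro Bochner_Integration.integral_cong refl)
    fix w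
    have "normal_density (Y \<omega> - u) \<eta> w = normal_density (w + u) \<eta> (Y \<omega>)" for \<omega>
      unfolding normal_density_def by (simp add: power2_commute algebra_simps)
    thus "(\<integral>\<omega>. f \<omega> w \<partial>M) = cut_exp \<sigma> w * smooth_density \<eta> (w + u)"
      unfolding f_def smooth_density_def by simp
  qed
  finally show ?thesis .
qed

end

section \<open>Gaussian moments and remainder bounds for the exponential\<close>

lemma has_bochner_integral_gaussian_even:
  assumes "a > 0"
  shows "has_bochner_integral lborel (\<lambda>t. exp (- (a * t\<^sup>2 / 2)) * t ^ (2 * n)) (sqrt (2 * pi / a) * (fact (2 * n) / ((2 * a) ^ n * fact n)))"
proof -
  define s where "s = 1 / sqrt a"
  have s: "s > 0" "s\<^sup>2 = 1 / a" unfolding s_def using assms by (auto simp: power_divide)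
  have "has_bochner_integral lborel (\<lambda>t. sqrt (2 * pi / a) * (normal_density 0 s t * (t - 0) ^ (2 * n))) (sqrt (2 * pi / a) * (fact (2 * n) / ((2 / s\<^sup>2) ^ n * fact n)))"
    by (intro has_bochner_integral_mult_right normal_moment_even s(1))
  moreover have "sqrt (2 * pi / a) * (normal_density 0 s t * (t - 0) ^ (2 * n)) = exp (- (a * t\<^sup>2 / 2)) * t ^ (2 * n)" for t
    unfolding normal_density_def using assms s by (simp add: real_sqrt_divide real_sqrt_mult)
  ultimately have "has_bochner_integral lborel (\<lambda>t. exp (- (a * t\<^sup>2 / 2)) * t ^ (2 * n)) (sqrt (2 * pi / a) * (fact (2 * n) / ((2 / s\<^sup>2) ^ n * fact n)))"
    by (simp only:)
  thus ?thesis using s assms by simp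
qed

lemma has_bochner_integral_gaussian_odd:
  assumes "a > 0"
  shows "has_bochner_integral lborel (\<lambda>t. exp (- (a * t\<^sup>2 / 2)) * t ^ (2 * n + 1)) (0::real)"
proof -
  define s where "s = 1 / sqrt a"
  have s: "s > 0" "s\<^sup>2 = 1 / a" unfolding s_def using assms by (auto simp: power_divide)
  have "has_bochner_integral lborel (\<lambda>t. sqrt (2 * pi / a) * (normal_density 0 s t * (t - 0) ^ (2 * n + 1))) (sqrt (2 * pi / a) * 0)"
    by (intro has_bochner_integral_mult_right normal_moment_odd s(1))
  moreover have "sqrt (2 * pi / a) * (normal_density 0 s t * (t - 0) ^ (2 * n + 1)) = exp (- (a * t\<^sup>2 / 2)) * t ^ (2 * n + 1)" for t
    unfolding normal_density_def using assms s by (simp add: real_sqrt_divide real_sqrt_mult)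
  ultimately have "has_bochner_integral lborel (\<lambda>t. exp (- (a * t\<^sup>2 / 2)) * t ^ (2 * n + 1)) (sqrt (2 * pi / a) * 0)"
    by (simp only:)
  thus ?thesis by simp
qed

lemma norm_exp_minus_1_le:
  fixes z :: complex shows "norm (exp z - 1) \<le> norm z * exp (norm z)"
proof -
  have "norm (exp z - (\<Sum>i\<le>0. z ^ i / fact i)) \<le> exp \<bar>Re z\<bar> * (norm z ^ Suc 0) / fact 0"
    by (rule Taylor_exp)
  hence "norm (exp z - 1) \<le> exp \<bar>Re z\<bar> * norm z" by simp
  also have "\<dots> \<le> exp (norm z) * norm z" by (intro mult_right_mono) (auto simp: abs_Re_le_cmod)
  finally show ?thesis by (simp add: mult.commute)
qed

text \<open>The phase a will be odd in t and is kept to first order, because its linear term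
  integrates to zero; w is estimated by size alone.\<close>

lemma norm_exp_linear_le:
  "norm (exp (\<i> * of_real a + w) - (1 + \<i> * of_real a)) \<le> norm w * exp (norm w) + a\<^sup>2 / 2"
proof -
  have "exp (\<i> * of_real a + w) - (1 + \<i> * of_real a) = iexp a * (exp w - 1) + (iexp a - (\<Sum>k\<le>1. (\<i> * of_real a) ^ k / fact k))"
    by (simp add: exp_add algebra_simps)
  also have "norm \<dots> \<le> norm (iexp a * (exp w - 1)) + norm (iexp a - (\<Sum>k\<le>1. (\<i> * of_real a) ^ k / fact k))"
    by (rule norm_triangle_ineq)
  also have "\<dots> \<le> norm w * exp (norm w) + \<bar>a\<bar> ^ Suc 1 / fact (Suc 1)"
    using norm_exp_minus_1_le[of w] by (intro add_mono iexp_approx1) (simp add: norm_mult)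
  finally show ?thesis by (simp add: power2_eq_square)
qed

section \<open>Comparison of the smoothed density with a Gaussian\<close>

context real_variable
begin

text \<open>Each term has its own source: K4 the fourth-order remainder,
  \<open>\<eta>\<^sup>2 / B\<close> the smoothing weight, 4 / t0^2 the Gaussian mass beyond t0, y^2
  and M3^2 the squares of the odd phases, and the last summand the true frequencies beyond t0. The
  growth in y is harmless, as the bound is going to be integrated against an exponential.\<close>

lemma smooth_density_near_gaussian:
  assumes B: "B > 0" and t0: "t0 > 0" and eta: "\<eta> > 0" "\<eta>\<^sup>2 \<le> B / 4"
    and K4: "K4 \<ge> 0" "K4 * t0\<^sup>2 \<le> B / 8" and E: "E \<ge> 0" and T: "T \<ge> 0"
    and near: "\<And>t. \<bar>t\<bar> \<le> t0 \<Longrightarrow> \<exists>R. cf t = exp (of_real (- (B * t\<^sup>2 / 2)) - \<i> * of_real (M3 * t ^ 3 / 6) + R) \<and> norm R \<le> K4 * t ^ 4"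
    and far: "\<And>t. \<lbrakk>t0 \<le> \<bar>t\<bar>; \<bar>t\<bar> \<le> T\<rbrakk> \<Longrightarrow> norm (cf t) \<le> E"
  shows "\<bar>smooth_density \<eta> y * sqrt (2 * pi * B) - 1\<bar> \<le>
     sqrt 2 * (12 * K4 / B\<^sup>2 + (\<eta>\<^sup>2 + 4 / t0\<^sup>2 + 2 * y\<^sup>2) / B + 10 / 3 * M3\<^sup>2 / B ^ 3)
     + (E + exp (- (\<eta>\<^sup>2 * T\<^sup>2 / 4))) * sqrt (2 * B) / \<eta>"
proof -
  \<comment> \<open>The phase t y from the point of evaluation is odd like the cubic one, so both
    integrate to zero against the Gaussian in \<open>G\<close>.\<close>
  define a where "a = (\<lambda>t. - (M3 * t ^ 3 / 6 + t * y))"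
  define A where "A = (\<lambda>t. of_real (exp (- (\<eta>\<^sup>2 * t\<^sup>2 / 2))) * (cf t * iexp (- t * y)))"
  define G where "G = (\<lambda>t. of_real (exp (- (B * t\<^sup>2 / 2))) * (1 + \<i> * of_real (a t)))"
  define F where "F = E + exp (- (\<eta>\<^sup>2 * T\<^sup>2 / 4))"
  \<comment> \<open>Beyond t0 one has 1 \<le> t^2 / t0^2, which turns the tail of \<open>G\<close>
    into a second moment; hence 2 / t0^2.\<close>
  define c2 where "c2 = \<eta>\<^sup>2 / 2 + 2 / t0\<^sup>2 + y\<^sup>2"
  \<comment> \<open>A majorant of A - G. Halving B leaves room for exp (norm w), since norm w \<le>
    B t^2 / 4. One half of the smoothing weight keeps the far part integrable, the other half
    provides the exponential in \<open>F\<close> for |t| > T.\<close>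
  define Q where "Q = (\<lambda>t. K4 * (exp (- (B/2 * t\<^sup>2 / 2)) * t ^ 4) + c2 * (exp (- (B/2 * t\<^sup>2 / 2)) * t ^ 2)
      + M3\<^sup>2 / 36 * (exp (- (B/2 * t\<^sup>2 / 2)) * t ^ 6) + F * exp (- (\<eta>\<^sup>2/2 * t\<^sup>2 / 2)))"
  have gauss0: "has_bochner_integral lborel (\<lambda>t. exp (- (x * t\<^sup>2 / 2))) (sqrt (2 * pi / x))" if "x > 0" for x
    using has_bochner_integral_gaussian_even[OF that, of 0] by simp
  have hG: "has_bochner_integral lborel G (of_real (sqrt (2 * pi / B)))"
  proof -
    have "has_bochner_integral lborel (\<lambda>t. of_real (exp (- (B * t\<^sup>2 / 2))) + \<i> * of_real (- (M3 / 6 * (exp (- (B * t\<^sup>2 / 2)) * t ^ (2 * 1 + 1)) + y * (exp (- (B * t\<^sup>2 / 2)) * t ^ (2 * 0 + 1)))))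
      (of_real (sqrt (2 * pi / B)) + \<i> * of_real (- (M3 / 6 * 0 + y * 0)))"
      by (intro has_bochner_integral_add has_bochner_integral_mult_right has_bochner_integral_of_real has_bochner_integral_minus
          gauss0 B has_bochner_integral_gaussian_odd)
    moreover have "G = (\<lambda>t. of_real (exp (- (B * t\<^sup>2 / 2))) + \<i> * of_real (- (M3 / 6 * (exp (- (B * t\<^sup>2 / 2)) * t ^ (2 * 1 + 1)) + y * (exp (- (B * t\<^sup>2 / 2)) * t ^ (2 * 0 + 1)))))"
      unfolding G_def a_def by (simp add: fun_eq_iff field_simps power3_eq_cube)
    ultimately have "has_bochner_integral lborel G (of_real (sqrt (2 * pi / B)) + \<i> * of_real (- (M3 / 6 * 0 + y * 0)))"
      by (simp only:)
    thus ?thesis by simp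
  qed
  have hQ: "has_bochner_integral lborel Q (K4 * (sqrt (4 * pi / B) * (12 / B\<^sup>2)) + c2 * (sqrt (4 * pi / B) * (2 / B)) +
      M3\<^sup>2 / 36 * (sqrt (4 * pi / B) * (120 / B ^ 3)) + F * sqrt (4 * pi / \<eta>\<^sup>2))"
  proof -
    have B2: "B / 2 > 0" using B by simp
    have 4: "has_bochner_integral lborel (\<lambda>t. exp (- (B/2 * t\<^sup>2 / 2)) * t ^ 4) (sqrt (4 * pi / B) * (12 / B\<^sup>2))"
      using has_bochner_integral_gaussian_even[OF B2, of 2] by (simp add: fact_numeral)
    have 2: "has_bochner_integral lborel (\<lambda>t. exp (- (B/2 * t\<^sup>2 / 2)) * t ^ 2) (sqrt (4 * pi / B) * (2 / B))"
      using has_bochner_integral_gaussian_even[OF B2, of 1] by (simp add: fact_numeral)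
    have 6: "has_bochner_integral lborel (\<lambda>t. exp (- (B/2 * t\<^sup>2 / 2)) * t ^ 6) (sqrt (4 * pi / B) * (120 / B ^ 3))"
      using has_bochner_integral_gaussian_even[OF B2, of 3] by (simp add: fact_numeral)
    have 0: "has_bochner_integral lborel (\<lambda>t. exp (- (\<eta>\<^sup>2/2 * t\<^sup>2 / 2))) (sqrt (4 * pi / \<eta>\<^sup>2))"
      using gauss0[of "\<eta>\<^sup>2/2"] eta by simp
    show ?thesis unfolding Q_def
      by (intro has_bochner_integral_add has_bochner_integral_mult_right 0 2 4 6)
  qed
  have c2: "c2 \<ge> 0" unfolding c2_def by simp
  have F: "F \<ge> 0" unfolding F_def using E by (simp add: add_nonneg_nonneg)
  have intA: "integrable lborel A"
  proof (rule Bochner_Integration.integrable_bound)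
    show "integrable lborel (\<lambda>t. exp (- (\<eta>\<^sup>2 * t\<^sup>2 / 2)))"
      using gauss0[of "\<eta>\<^sup>2"] eta by (auto intro: integrable.intros)
    show "A \<in> borel_measurable lborel" unfolding A_def by measurable
    show "AE x in lborel. cmod (A x) \<le> norm (exp (- (\<eta>\<^sup>2 * x\<^sup>2 / 2)))"
    proof (rule AE_I2)
      fix t
      show "cmod (A t) \<le> norm (exp (- (\<eta>\<^sup>2 * t\<^sup>2 / 2)))"
        unfolding A_def norm_mult using norm_cf_le_1[of t] by (simp del: of_real_mult)
    qed
  qed
  have point: "norm (A t - G t) \<le> Q t" for t
  proof -
    define g where "g = exp (- (B/2 * t\<^sup>2 / 2))"
    have g: "g > 0" unfolding g_def by simp
    have Bg: "exp (- (B * t\<^sup>2 / 2)) \<le> g" unfolding g_def using B by simp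
    have a2: "(a t)\<^sup>2 / 2 \<le> M3\<^sup>2 / 36 * t ^ 6 + y\<^sup>2 * t\<^sup>2"
    proof -
      have "(a t)\<^sup>2 = (M3 * t ^ 3 / 6 + t * y)\<^sup>2" unfolding a_def by (rule power2_minus)
      also have "\<dots> \<le> 2 * (M3 * t ^ 3 / 6)\<^sup>2 + 2 * (t * y)\<^sup>2"
        using zero_le_power2[of "M3 * t ^ 3 / 6 - t * y"] by (simp add: power2_sum power2_diff)
      also have "(M3 * t ^ 3 / 6)\<^sup>2 = M3\<^sup>2 / 36 * t ^ 6" by (simp add: power_divide power_mult_distrib power_mult[symmetric])
      finally show ?thesis by (simp add: power_mult_distrib mult.commute)
    qed
    have Qg: "Q t = g * (K4 * t ^ 4 + c2 * t\<^sup>2 + M3\<^sup>2 / 36 * t ^ 6) + F * exp (- (\<eta>\<^sup>2/2 * t\<^sup>2 / 2))"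
      unfolding Q_def g_def by (simp add: algebra_simps)
    show ?thesis
    proof (cases "\<bar>t\<bar> \<le> t0")
      case True
      obtain R where R: "cf t = exp (of_real (- (B * t\<^sup>2 / 2)) - \<i> * of_real (M3 * t ^ 3 / 6) + R)" "norm R \<le> K4 * t ^ 4"
        using near[OF True] by blast
      define w where "w = R - of_real (\<eta>\<^sup>2 * t\<^sup>2 / 2)"
      have w1: "norm w \<le> K4 * t ^ 4 + \<eta>\<^sup>2 / 2 * t\<^sup>2"
      proof -
        have "norm w \<le> norm R + norm (of_real (\<eta>\<^sup>2 * t\<^sup>2 / 2) :: complex)" unfolding w_def by (rule norm_triangle_ineq4)
        also have "norm (of_real (\<eta>\<^sup>2 * t\<^sup>2 / 2) :: complex) = \<eta>\<^sup>2 / 2 * t\<^sup>2" by (simp only: norm_of_real) simp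
        finally show ?thesis using R(2) by linarith
      qed
      have "K4 * t ^ 4 + \<eta>\<^sup>2 / 2 * t\<^sup>2 \<le> B / 4 * t\<^sup>2"
      proof -
        have "t\<^sup>2 \<le> t0\<^sup>2" using True t0 abs_le_square_iff[of t t0] by simp
        hence "K4 * t\<^sup>2 \<le> B / 8" using K4 by (meson mult_left_mono order_trans)
        hence "K4 * t\<^sup>2 * t\<^sup>2 \<le> B / 8 * t\<^sup>2" by (intro mult_right_mono) auto
        moreover have "\<eta>\<^sup>2 / 2 * t\<^sup>2 \<le> B / 8 * t\<^sup>2" using eta by (intro mult_right_mono) auto
        moreover have "K4 * t\<^sup>2 * t\<^sup>2 = K4 * t ^ 4" by simp
        ultimately show ?thesis by linarith
      qed
      hence w2: "norm w \<le> B / 4 * t\<^sup>2" using w1 by linarith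
      have "A t = exp (of_real (- (\<eta>\<^sup>2 * t\<^sup>2 / 2)) + (of_real (- (B * t\<^sup>2 / 2)) - \<i> * of_real (M3 * t ^ 3 / 6) + R) + \<i> * of_real (- t * y))"
        unfolding A_def R(1) by (simp only: exp_add exp_of_real mult.assoc)
      also have "(of_real (- (\<eta>\<^sup>2 * t\<^sup>2 / 2)) + (of_real (- (B * t\<^sup>2 / 2)) - \<i> * of_real (M3 * t ^ 3 / 6) + R) + \<i> * of_real (- t * y))
         = of_real (- (B * t\<^sup>2 / 2)) + (\<i> * of_real (a t) + w)"
        unfolding w_def a_def by (simp add: algebra_simps)
      finally have At: "A t = of_real (exp (- (B * t\<^sup>2 / 2))) * exp (\<i> * of_real (a t) + w)" by (simp only: exp_add exp_of_real)
      have "norm (A t - G t) = exp (- (B * t\<^sup>2 / 2)) * norm (exp (\<i> * of_real (a t) + w) - (1 + \<i> * of_real (a t)))"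
        unfolding At G_def right_diff_distrib[symmetric] norm_mult by simp
      also have "\<dots> \<le> exp (- (B * t\<^sup>2 / 2)) * (norm w * exp (norm w) + (a t)\<^sup>2 / 2)"
        by (intro mult_left_mono norm_exp_linear_le) auto
      also have "\<dots> = norm w * (exp (- (B * t\<^sup>2 / 2)) * exp (norm w)) + exp (- (B * t\<^sup>2 / 2)) * ((a t)\<^sup>2 / 2)"
        by (simp add: algebra_simps)
      also have "\<dots> \<le> norm w * g + g * ((a t)\<^sup>2 / 2)"
      proof (intro add_mono mult_left_mono mult_right_mono Bg)
        have "exp (- (B * t\<^sup>2 / 2)) * exp (norm w) = exp (- (B * t\<^sup>2 / 2) + norm w)" by (rule exp_add[symmetric])
        also have "\<dots> \<le> g" unfolding g_def using w2 by simp
        finally show "exp (- (B * t\<^sup>2 / 2)) * exp (norm w) \<le> g" .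
      qed auto
      also have "\<dots> = g * (norm w + (a t)\<^sup>2 / 2)" by (simp add: algebra_simps)
      also have "\<dots> \<le> g * (K4 * t ^ 4 + c2 * t\<^sup>2 + M3\<^sup>2 / 36 * t ^ 6)"
      proof (intro mult_left_mono)
        have "2 / t0\<^sup>2 * t\<^sup>2 \<ge> 0" by simp
        moreover have "c2 * t\<^sup>2 = \<eta>\<^sup>2 / 2 * t\<^sup>2 + 2 / t0\<^sup>2 * t\<^sup>2 + y\<^sup>2 * t\<^sup>2" unfolding c2_def by (simp add: algebra_simps)
        ultimately show "norm w + (a t)\<^sup>2 / 2 \<le> K4 * t ^ 4 + c2 * t\<^sup>2 + M3\<^sup>2 / 36 * t ^ 6" using w1 a2 by linarith
      qed (use g in auto)
      finally show ?thesis unfolding Qg using F by (simp add: add_increasing2)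
    next
      case False
      hence tt: "1 \<le> t\<^sup>2 / t0\<^sup>2" using t0 abs_le_square_iff[of t0 t] by (simp add: le_divide_eq_1_pos)
      have nA: "norm (A t) \<le> F * exp (- (\<eta>\<^sup>2/2 * t\<^sup>2 / 2))"
      proof -
        have e2: "exp (- (\<eta>\<^sup>2 * t\<^sup>2 / 2)) = exp (- (\<eta>\<^sup>2/2 * t\<^sup>2 / 2)) * exp (- (\<eta>\<^sup>2 * t\<^sup>2 / 4))" 
          by (simp add: exp_add[symmetric])
        have "norm (A t) = exp (- (\<eta>\<^sup>2/2 * t\<^sup>2 / 2)) * (exp (- (\<eta>\<^sup>2 * t\<^sup>2 / 4)) * norm (cf t))"
          unfolding A_def norm_mult norm_of_real abs_exp_cancel e2 by (simp del: of_real_mult of_real_minus)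
        also have "exp (- (\<eta>\<^sup>2 * t\<^sup>2 / 4)) * norm (cf t) \<le> F"
        proof (cases "\<bar>t\<bar> \<le> T")
          case True
          have "exp (- (\<eta>\<^sup>2 * t\<^sup>2 / 4)) * norm (cf t) \<le> 1 * E" using far[of t] True False by (intro mult_mono) auto
          thus ?thesis unfolding F_def by (simp add: add_increasing2)
        next
          case False
          hence "T\<^sup>2 \<le> t\<^sup>2" using T abs_le_square_iff[of T t] by simp
          hence "\<eta>\<^sup>2 * T\<^sup>2 / 4 \<le> \<eta>\<^sup>2 * t\<^sup>2 / 4" by (simp add: mult_left_mono)
          hence "exp (- (\<eta>\<^sup>2 * t\<^sup>2 / 4)) * norm (cf t) \<le> exp (- (\<eta>\<^sup>2 * T\<^sup>2 / 4)) * 1"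
            using norm_cf_le_1[of t] by (intro mult_mono) auto
          thus ?thesis unfolding F_def using E by simp
        qed
        finally show ?thesis by (simp add: mult.commute)
      qed
      have "norm (G t) \<le> g * (c2 * t\<^sup>2 + M3\<^sup>2 / 36 * t ^ 6)"
      proof -
        have "norm (1 + \<i> * of_real (a t)) \<le> 1 + \<bar>a t\<bar>" using norm_triangle_ineq[of 1 "\<i> * of_real (a t)"] by (simp add: norm_mult)
        \<comment> \<open>Trading |a| for a^2 keeps all moments even.\<close>
        also have "\<dots> \<le> 2 + (a t)\<^sup>2 / 2" using zero_le_power2[of "\<bar>a t\<bar> - 1"] by (simp add: power2_diff)
        also have "\<dots> \<le> 2 * (t\<^sup>2 / t0\<^sup>2) + (M3\<^sup>2 / 36 * t ^ 6 + y\<^sup>2 * t\<^sup>2)" using tt a2 by linarith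
        also have "\<dots> \<le> c2 * t\<^sup>2 + M3\<^sup>2 / 36 * t ^ 6"
        proof -
          have "\<eta>\<^sup>2 / 2 * t\<^sup>2 \<ge> 0" by simp
          moreover have "c2 * t\<^sup>2 = \<eta>\<^sup>2 / 2 * t\<^sup>2 + 2 * (t\<^sup>2 / t0\<^sup>2) + y\<^sup>2 * t\<^sup>2" unfolding c2_def by (simp add: algebra_simps)
          ultimately show ?thesis by linarith
        qed
        finally have "exp (- (B * t\<^sup>2 / 2)) * norm (1 + \<i> * of_real (a t)) \<le> g * (c2 * t\<^sup>2 + M3\<^sup>2 / 36 * t ^ 6)"
          using Bg g by (intro mult_mono) auto
        thus ?thesis unfolding G_def norm_mult by simp
      qed
      also have "\<dots> \<le> g * (K4 * t ^ 4 + c2 * t\<^sup>2 + M3\<^sup>2 / 36 * t ^ 6)" using g K4 by (intro mult_left_mono) auto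
      finally show ?thesis unfolding Qg using nA norm_triangle_ineq4[of "A t" "G t"] by linarith
    qed
  qed
  have dens: "normal_density 0 (1/\<eta>) t = \<eta> / sqrt (2 * pi) * exp (- (\<eta>\<^sup>2 * t\<^sup>2 / 2))" for t
    unfolding normal_density_def using eta by (simp add: real_sqrt_divide real_sqrt_mult power_divide)
  have inv: "of_real (smooth_density \<eta> y) = of_real (1 / (2 * pi)) * (CLINT t|lborel. A t)"
  proof -
    have "(CLINT t|lborel. of_real (normal_density 0 (1/\<eta>) t) * (cf t * iexp (- t * y))) = (CLINT t|lborel. of_real (\<eta> / sqrt (2 * pi)) * A t)"
      unfolding dens A_def by (simp only: of_real_mult mult.assoc)
    also have "\<dots> = of_real (\<eta> / sqrt (2 * pi)) * (CLINT t|lborel. A t)" by (rule integral_mult_right_zero)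
    finally have "of_real (smooth_density \<eta> y) = of_real (1 / (sqrt (2 * pi) * \<eta>)) * (of_real (\<eta> / sqrt (2 * pi)) * (CLINT t|lborel. A t))"
      unfolding smooth_density_inversion[OF eta(1)] by (simp only:)
    also have "\<dots> = of_real (1 / (sqrt (2 * pi) * \<eta>) * (\<eta> / sqrt (2 * pi))) * (CLINT t|lborel. A t)"
      by (simp only: of_real_mult mult.assoc)
    also have "1 / (sqrt (2 * pi) * \<eta>) * (\<eta> / sqrt (2 * pi)) = 1 / (2 * pi)" using eta by (simp add: field_simps)
    finally show ?thesis .
  qed
  have P: "sqrt (2 * pi) > 0" "sqrt (2 * pi) * sqrt (2 * pi) = 2 * pi" by simp_all
  have "norm ((CLINT t|lborel. A t) - of_real (sqrt (2 * pi / B))) \<le> integral\<^sup>L lborel Q"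
  proof -
    have "(CLINT t|lborel. A t) - of_real (sqrt (2 * pi / B)) = (CLINT t|lborel. A t - G t)"
      using hG intA by (subst Bochner_Integration.integral_diff) (auto simp: has_bochner_integral_iff)
    also have "norm \<dots> \<le> integral\<^sup>L lborel Q"
      using point hQ hG intA by (intro Bochner_Integration.integral_norm_bound_integral Bochner_Integration.integrable_diff) (auto simp: has_bochner_integral_iff)
    finally show ?thesis .
  qed
  moreover have "(CLINT t|lborel. A t) = of_real (2 * pi * smooth_density \<eta> y)"
    using inv by (simp add: field_simps)
  ultimately have "\<bar>2 * pi * smooth_density \<eta> y - sqrt (2 * pi / B)\<bar> \<le> integral\<^sup>L lborel Q"
    by (simp only: of_real_diff[symmetric] norm_of_real)
  \<comment> \<open>Passage to the ratio with 1 / sqrt (2 pi B), the peak of the limiting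
    density.\<close>
  hence "sqrt B / sqrt (2 * pi) * \<bar>2 * pi * smooth_density \<eta> y - sqrt (2 * pi / B)\<bar> \<le> sqrt B / sqrt (2 * pi) * integral\<^sup>L lborel Q"
    using B by (intro mult_left_mono) auto
  moreover have "sqrt B / sqrt (2 * pi) * \<bar>2 * pi * smooth_density \<eta> y - sqrt (2 * pi / B)\<bar> = \<bar>smooth_density \<eta> y * sqrt (2 * pi * B) - 1\<bar>"
  proof -
    have alg: "b / p * \<bar>p * p * q - v\<bar> = \<bar>q * (p * b) - 1\<bar>" if "b > 0" "p > 0" "b * v = p" for b p q v :: real
    proof -
      have "b / p * (p * p * q - v) = q * (p * b) - (b * v) / p" using that(2) by (simp add: right_diff_distrib)
      also have "(b * v) / p = 1" unfolding that(3) using that(2) by simp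
      finally have "b / p * (p * p * q - v) = q * (p * b) - 1" .
      moreover have "b / p \<ge> 0" using that by simp
      ultimately show ?thesis by (metis abs_mult abs_of_nonneg)
    qed
    have "sqrt B > 0" "sqrt B * sqrt (2 * pi / B) = sqrt (2 * pi)" using B by (simp_all add: real_sqrt_divide)
    from alg[OF this(1) P(1) this(2)] show ?thesis unfolding P(2) real_sqrt_mult[of "2 * pi" B] .
  qed
  moreover have "sqrt B / sqrt (2 * pi) * integral\<^sup>L lborel Q =
     sqrt 2 * (12 * K4 / B\<^sup>2 + (\<eta>\<^sup>2 + 4 / t0\<^sup>2 + 2 * y\<^sup>2) / B + 10 / 3 * M3\<^sup>2 / B ^ 3) + F * sqrt (2 * B) / \<eta>"
  proof -
    have s1: "sqrt B / sqrt (2 * pi) * sqrt (4 * pi / B) = sqrt 2"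
    proof -
      have "sqrt (4 * pi / B) = sqrt 2 * sqrt (2 * pi) / sqrt B"
        by (simp only: real_sqrt_mult[symmetric] real_sqrt_divide[symmetric]) simp
      thus ?thesis using P(1) B by simp
    qed
    have s2: "sqrt B / sqrt (2 * pi) * sqrt (4 * pi / \<eta>\<^sup>2) = sqrt (2 * B) / \<eta>"
    proof -
      have "sqrt (4 * pi / \<eta>\<^sup>2) = sqrt 2 * sqrt (2 * pi) / \<eta>"
        using eta by (simp only: real_sqrt_mult[symmetric]) (simp add: real_sqrt_divide)
      moreover have "sqrt (2 * B) = sqrt 2 * sqrt B" by (rule real_sqrt_mult)
      ultimately show ?thesis using P(1) eta by simp
    qed
    have IQ: "integral\<^sup>L lborel Q = K4 * (sqrt (4 * pi / B) * (12 / B\<^sup>2)) + c2 * (sqrt (4 * pi / B) * (2 / B)) +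
      M3\<^sup>2 / 36 * (sqrt (4 * pi / B) * (120 / B ^ 3)) + F * sqrt (4 * pi / \<eta>\<^sup>2)"
      using hQ by (rule has_bochner_integral_integral_eq)
    have alg: "r * (k * (x * p) + c * (x * q) + m * (x * s) + f * z) = (r * x) * (k * p + c * q + m * s) + f * (r * z)"
      for r k x p c q m s f z :: real by (simp add: algebra_simps)
    have "K4 * (12 / B\<^sup>2) + c2 * (2 / B) + M3\<^sup>2 / 36 * (120 / B ^ 3) = 12 * K4 / B\<^sup>2 + (\<eta>\<^sup>2 + 4 / t0\<^sup>2 + 2 * y\<^sup>2) / B + 10 / 3 * M3\<^sup>2 / B ^ 3"
      unfolding c2_def by (simp add: add_divide_distrib distrib_right mult.commute)
    thus ?thesis unfolding IQ alg s1 s2 by (simp only: times_divide_eq_right)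
  qed
  ultimately show ?thesis unfolding F_def by (simp only:)
qed

text \<open>The hypothesis is integrated against \<open>cut_exp\<close>. Here 1 + (w + u)^2 \<le> 3
  + 2 w^2, and the mass and the second moment are at most 1 and 2 because \<sigma> \<ge> 1; this
  gives 3 + 2 * 2 = 7.\<close>

lemma smooth_exp_expectation_near:
  assumes eta: "\<eta> > 0" and sigma: "\<sigma> \<ge> 1" and c: "c > 0" and u: "\<bar>u\<bar> \<le> 1" and e1: "e1 \<ge> 0"
    and near: "\<And>y. \<bar>smooth_density \<eta> y - c\<bar> \<le> c * (e1 * (1 + y\<^sup>2))"
  shows "\<bar>(\<integral>\<omega>. smooth_exp \<sigma> \<eta> (Y \<omega> - u) \<partial>M) - c / \<sigma>\<bar> \<le> 7 * (c * e1)"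
proof -
  have s0: "\<sigma> > 0" using sigma by simp
  have h0: "has_bochner_integral lborel (cut_exp \<sigma>) (1 / \<sigma>)"
    using has_bochner_integral_cut_exp_moment[OF s0, of 0] by simp
  have h2: "has_bochner_integral lborel (\<lambda>w. cut_exp \<sigma> w * w\<^sup>2) (2 / \<sigma> / \<sigma>\<^sup>2)"
  proof -
    have "has_bochner_integral lborel (\<lambda>w. cut_exp \<sigma> w * (- \<sigma> * w) ^ 2 / \<sigma>\<^sup>2) (fact 2 / \<sigma> / \<sigma>\<^sup>2)"
      by (intro has_bochner_integral_divide_zero has_bochner_integral_cut_exp_moment s0)
    thus ?thesis using s0 by (simp add: power_mult_distrib fact_numeral)
  qed
  have qm: "(\<lambda>w. smooth_density \<eta> (w + u)) \<in> borel_measurable lborel"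
    unfolding smooth_density_def normal_density_def by measurable
  have hP: "has_bochner_integral lborel (\<lambda>w. c * e1 * (3 * cut_exp \<sigma> w + 2 * (cut_exp \<sigma> w * w\<^sup>2))) (c * e1 * (3 * (1 / \<sigma>) + 2 * (2 / \<sigma> / \<sigma>\<^sup>2)))"
    by (intro has_bochner_integral_mult_right has_bochner_integral_add h0 h2)
  have pt: "\<bar>cut_exp \<sigma> w * (smooth_density \<eta> (w + u) - c)\<bar> \<le> c * e1 * (3 * cut_exp \<sigma> w + 2 * (cut_exp \<sigma> w * w\<^sup>2))" for w
  proof -
    have "(w + u)\<^sup>2 \<le> 2 * w\<^sup>2 + 2 * u\<^sup>2" using zero_le_power2[of "w - u"] by (simp add: power2_sum power2_diff)
    moreover have "u\<^sup>2 \<le> 1" using u by (simp add: abs_square_le_1)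
    ultimately have "1 + (w + u)\<^sup>2 \<le> 3 + 2 * w\<^sup>2" by linarith
    hence "c * (e1 * (1 + (w + u)\<^sup>2)) \<le> c * (e1 * (3 + 2 * w\<^sup>2))" using c e1 by (intro mult_left_mono) auto
    hence "\<bar>smooth_density \<eta> (w + u) - c\<bar> \<le> c * (e1 * (3 + 2 * w\<^sup>2))" using near[of "w + u"] by linarith
    hence "cut_exp \<sigma> w * \<bar>smooth_density \<eta> (w + u) - c\<bar> \<le> cut_exp \<sigma> w * (c * (e1 * (3 + 2 * w\<^sup>2)))"
      by (intro mult_left_mono cut_exp_nonneg)
    moreover have "\<bar>cut_exp \<sigma> w * (smooth_density \<eta> (w + u) - c)\<bar> = cut_exp \<sigma> w * \<bar>smooth_density \<eta> (w + u) - c\<bar>"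
      by (simp only: abs_mult abs_of_nonneg[OF cut_exp_nonneg])
    ultimately show ?thesis by (simp add: algebra_simps)
  qed
  have intd: "integrable lborel (\<lambda>w. cut_exp \<sigma> w * (smooth_density \<eta> (w + u) - c))"
  proof (rule Bochner_Integration.integrable_bound)
    show "integrable lborel (\<lambda>w. c * e1 * (3 * cut_exp \<sigma> w + 2 * (cut_exp \<sigma> w * w\<^sup>2)))" using hP by (rule integrable.intros)
    show "(\<lambda>w. cut_exp \<sigma> w * (smooth_density \<eta> (w + u) - c)) \<in> borel_measurable lborel" using qm by measurable
    show "AE w in lborel. norm (cut_exp \<sigma> w * (smooth_density \<eta> (w + u) - c)) \<le> norm (c * e1 * (3 * cut_exp \<sigma> w + 2 * (cut_exp \<sigma> w * w\<^sup>2)))"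
      by (rule AE_I2) (use pt in \<open>simp add: order_trans[OF _ abs_ge_self]\<close>)
  qed
  have "(\<integral>\<omega>. smooth_exp \<sigma> \<eta> (Y \<omega> - u) \<partial>M) = (\<integral>w. cut_exp \<sigma> w * (smooth_density \<eta> (w + u) - c) + c * cut_exp \<sigma> w \<partial>lborel)"
    unfolding expectation_smooth_exp[OF eta s0] by (intro Bochner_Integration.integral_cong refl) (simp add: algebra_simps)
  also have "\<dots> = (\<integral>w. cut_exp \<sigma> w * (smooth_density \<eta> (w + u) - c) \<partial>lborel) + c * (1 / \<sigma>)"
    using intd h0 by (subst Bochner_Integration.integral_add) (auto simp: has_bochner_integral_iff)
  finally have "(\<integral>\<omega>. smooth_exp \<sigma> \<eta> (Y \<omega> - u) \<partial>M) - c / \<sigma> = (\<integral>w. cut_exp \<sigma> w * (smooth_density \<eta> (w + u) - c) \<partial>lborel)" by simp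
  also have "\<bar>\<dots>\<bar> \<le> (\<integral>w. c * e1 * (3 * cut_exp \<sigma> w + 2 * (cut_exp \<sigma> w * w\<^sup>2)) \<partial>lborel)"
    using Bochner_Integration.integral_norm_bound_integral[OF intd integrable.intros[OF hP]] pt by simp
  also have "\<dots> = c * e1 * (3 * (1 / \<sigma>) + 2 * (2 / \<sigma> / \<sigma>\<^sup>2))" using hP by (rule has_bochner_integral_integral_eq)
  also have "\<dots> \<le> c * e1 * 7"
  proof (intro mult_left_mono)
    have "1 / \<sigma> \<le> 1" using sigma by simp
    moreover have "2 / \<sigma> / \<sigma>\<^sup>2 \<le> 2"
    proof -
      have "1 \<le> \<sigma> ^ 3" using sigma by (rule one_le_power)
      moreover have "2 / \<sigma> / \<sigma>\<^sup>2 = 2 / \<sigma> ^ 3" by (simp add: power2_eq_square power3_eq_cube)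
      ultimately show ?thesis using s0 by (simp add: divide_le_eq)
    qed
    ultimately show "3 * (1 / \<sigma>) + 2 * (2 / \<sigma> / \<sigma>\<^sup>2) \<le> 7" by linarith
  qed (use c e1 in auto)
  finally show ?thesis by simp
qed

text \<open>The pointwise sandwich averaged over Y, with the smoothed function taken at Y - u for
  the upper bound and at Y + u for the lower one.\<close>

lemma cut_exp_expectation_bounds:
  assumes eta: "\<eta> > 0" and sigma: "\<sigma> \<ge> 1" and c: "c > 0" and u: "0 \<le> u" "u \<le> 1" and e1: "e1 \<ge> 0"
    and near: "\<And>y. \<bar>smooth_density \<eta> y - c\<bar> \<le> c * (e1 * (1 + y\<^sup>2))"
  shows "(\<integral>\<omega>. cut_exp \<sigma> (Y \<omega>) \<partial>M) * (1 - normal_tail \<eta> u) \<le> exp (2 * \<sigma> * u) * (c / \<sigma> + 7 * (c * e1))"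
    and "c / \<sigma> - 7 * (c * e1) \<le> exp (2 * \<sigma> * u) * (\<integral>\<omega>. cut_exp \<sigma> (Y \<omega>) \<partial>M) + normal_tail \<eta> u"
proof -
  have s0: "\<sigma> > 0" using sigma by simp
  have intc: "integrable M (\<lambda>\<omega>. cut_exp \<sigma> (Y \<omega>))"
    using cut_exp_nonneg cut_exp_le_1[OF s0] by (intro integrable_const_bound[where B = 1]) auto
  have ints: "integrable M (\<lambda>\<omega>. smooth_exp \<sigma> \<eta> (Y \<omega> - v))" for v
  proof -
    have "(\<lambda>\<omega>. smooth_exp \<sigma> \<eta> (Y \<omega> - v)) \<in> borel_measurable M"
      unfolding smooth_exp_def normal_density_def by measurable
    thus ?thesis using smooth_exp_bounds[OF eta s0] by (intro integrable_const_bound[where B = 1]) auto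
  qed
  have "(\<integral>\<omega>. cut_exp \<sigma> (Y \<omega>) \<partial>M) * (1 - normal_tail \<eta> u) = (\<integral>\<omega>. cut_exp \<sigma> (Y \<omega>) * (1 - normal_tail \<eta> u) \<partial>M)" by simp
  also have "\<dots> \<le> (\<integral>\<omega>. exp (2 * \<sigma> * u) * smooth_exp \<sigma> \<eta> (Y \<omega> - u) \<partial>M)"
    using intc ints cut_exp_le_smooth[OF eta s0 u(1)] by (intro integral_mono) auto
  also have "\<dots> = exp (2 * \<sigma> * u) * (\<integral>\<omega>. smooth_exp \<sigma> \<eta> (Y \<omega> - u) \<partial>M)" by simp
  also have "\<dots> \<le> exp (2 * \<sigma> * u) * (c / \<sigma> + 7 * (c * e1))"
    using smooth_exp_expectation_near[OF eta sigma c _ e1 near, of u] u by (intro mult_left_mono) (auto simp: abs_le_iff)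
  finally show "(\<integral>\<omega>. cut_exp \<sigma> (Y \<omega>) \<partial>M) * (1 - normal_tail \<eta> u) \<le> exp (2 * \<sigma> * u) * (c / \<sigma> + 7 * (c * e1))" .
  have "c / \<sigma> - 7 * (c * e1) \<le> (\<integral>\<omega>. smooth_exp \<sigma> \<eta> (Y \<omega> - (- u)) \<partial>M)"
    using smooth_exp_expectation_near[OF eta sigma c _ e1 near, of "- u"] u by (auto simp: abs_le_iff)
  also have "\<dots> \<le> (\<integral>\<omega>. exp (2 * \<sigma> * u) * cut_exp \<sigma> (Y \<omega>) + normal_tail \<eta> u \<partial>M)"
    using intc ints[of "-u"] smooth_le_cut_exp[OF eta s0 u(1)] by (intro integral_mono) auto
  also have "\<dots> = exp (2 * \<sigma> * u) * (\<integral>\<omega>. cut_exp \<sigma> (Y \<omega>) \<partial>M) + normal_tail \<eta> u"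
    using intc by (simp add: prob_space)
  finally show "c / \<sigma> - 7 * (c * e1) \<le> exp (2 * \<sigma> * u) * (\<integral>\<omega>. cut_exp \<sigma> (Y \<omega>) \<partial>M) + normal_tail \<eta> u" .
qed

end

section \<open>Euler product and tilted measure\<close>

context additive_arithmetical_semigroup
begin

lemma one_notin_primes: "1 \<notin> P"
  using deg_prime_pos deg_one by fastforce

lemma deg_prod_mset_pos:
  assumes "set_mset M \<subseteq> P" "M \<noteq> {#}" shows "deg (prod_mset M) > 0"
  using assms
proof (induction M)
  case (add p M)
  have "deg p > 0" using add.prems by (intro deg_prime_pos) auto
  moreover have "deg (prod_mset M) \<ge> 0"
    using add by (cases "M = {#}") (auto simp: deg_one intro: less_imp_le)
  ultimately show ?case by (simp add: deg_mult)
qed simp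

lemma factorization_exists: "\<exists>M. set_mset M \<subseteq> P \<and> prod_mset M = a"
proof (cases "a = 1")
  case True thus ?thesis by (intro exI[of _ "{#}"]) auto
next
  case False thus ?thesis using unique_factorization[OF False] by blast
qed

text \<open>The axiom speaks only of elements other than 1. At 1 a nonempty multiset of primes is
  excluded because its product has positive degree.\<close>

lemma factorization_unique:
  assumes "set_mset M \<subseteq> P" "set_mset N \<subseteq> P" "prod_mset M = prod_mset N"
  shows "M = N"
proof (cases "prod_mset M = 1")
  case True
  hence "M = {#}" "N = {#}"
    using deg_prod_mset_pos[of M] deg_prod_mset_pos[of N] assms deg_one by auto
  thus ?thesis by simp
next
  case False
  hence "M \<noteq> {#}" "N \<noteq> {#}" using assms by auto
  thus ?thesis using unique_factorization[OF False] assms by metis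
qed

lemma deg_nonneg: "deg a \<ge> 0"
proof -
  obtain M where "set_mset M \<subseteq> P" "prod_mset M = a" using factorization_exists by blast
  thus ?thesis using deg_prod_mset_pos[of M] deg_one by (cases "M = {#}") auto
qed

lemma prod_mset_repeat: "prod_mset (repeat_mset n M) = prod_mset M ^ n"
  by (induction n) simp_all

text \<open>A prime q of multiplicity at least k gives the forbidden divisor q^k. Conversely, if b^k
  divides, uniqueness forces the factorization to be k copies of that of b plus a rest, so each
  prime of b has multiplicity at least k.\<close>

lemma power_free_prod_mset_iff:
  assumes M: "set_mset M \<subseteq> P" and k: "k \<ge> 1"
  shows "power_free k (prod_mset M) \<longleftrightarrow> (\<forall>q. count M q < k)"
proof
  assume pf: "power_free k (prod_mset M)"
  show "\<forall>q. count M q < k"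
  proof (rule allI, rule ccontr)
    fix q assume "\<not> count M q < k"
    hence q: "count M q \<ge> k" by simp
    hence "q \<in># M" using k not_in_iff[of q M] by fastforce
    hence "q \<noteq> 1" using M one_notin_primes by auto
    have "replicate_mset k q \<subseteq># M" using q by (simp add: count_le_replicate_mset_subset_eq)
    then obtain C where "M = replicate_mset k q + C" by (auto simp: mset_subset_eq_exists_conv)
    hence "q ^ k dvd prod_mset M" by simp
    thus False using pf \<open>q \<noteq> 1\<close> unfolding power_free_def by blast
  qed
next
  assume small: "\<forall>q. count M q < k"
  show "power_free k (prod_mset M)"
    unfolding power_free_def
  proof clarify
    fix b assume b: "b \<noteq> 1" "b ^ k dvd prod_mset M"
    obtain c where c: "prod_mset M = b ^ k * c" using b by (auto elim: dvdE)
    obtain N where N: "set_mset N \<subseteq> P" "prod_mset N = b" using factorization_exists by blast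
    obtain C where C: "set_mset C \<subseteq> P" "prod_mset C = c" using factorization_exists by blast
    have "q \<in># N" if "q \<in># repeat_mset k N" for q
      using that not_in_iff[of q "repeat_mset k N"] not_in_iff[of q N] by auto
    hence "set_mset (repeat_mset k N + C) \<subseteq> P" using N C by auto
    hence decomp: "M = repeat_mset k N + C"
      using M N C c by (intro factorization_unique) (auto simp: prod_mset_repeat)
    have "N \<noteq> {#}" using N b by auto
    then obtain q where "q \<in># N" by auto
    hence "k * 1 \<le> k * count N q" by (intro mult_le_mono2) (simp add: Suc_le_eq)
    hence "count M q \<ge> k" unfolding decomp count_union count_repeat_mset by linarith
    thus False using small[rule_format, of q] by simp
  qed
qed

end

text \<open>Enumerating the primes by \<open>nat\<close> turns products and series over primes into
  ordinary limits of sequences.\<close>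

locale enumerated_semigroup = additive_arithmetical_semigroup P deg
  for P :: "'a::comm_monoid_mult set" and deg :: "'a \<Rightarrow> real" +
  fixes k :: nat and p :: "nat \<Rightarrow> 'a"
  assumes k2: "k \<ge> 2" and bij_p: "bij_betw p UNIV P"
    and summable_primes: "s > 1 \<Longrightarrow> summable (\<lambda>n. exp (- deg (p n) * s))"
begin

lemma p_in: "p n \<in> P" using bij_p by (auto simp: bij_betw_def)
lemma p_inj: "inj p" using bij_p by (auto simp: bij_betw_def)

text \<open>Smooth in the sense of number theory: all prime factors are among the first N primes.
  This is unrelated to the Gaussian smoothing.\<close>

definition smooth_msets :: "nat \<Rightarrow> 'a multiset set" where
  "smooth_msets N = {M. set_mset M \<subseteq> p ` {..<N} \<and> (\<forall>q. count M q < k)}"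

definition smooth_power_free :: "nat \<Rightarrow> 'a set" where
  "smooth_power_free N = prod_mset ` smooth_msets N"

lemma smooth_msets_subset: "M \<in> smooth_msets N \<Longrightarrow> set_mset M \<subseteq> P"
  unfolding smooth_msets_def using p_in by auto

lemma inj_on_prod_mset: "inj_on prod_mset (smooth_msets N)"
  by (intro inj_onI factorization_unique smooth_msets_subset) auto

lemma count_smooth_msets_0: "M \<in> smooth_msets N \<Longrightarrow> count M (p N) = 0"
  using p_inj unfolding smooth_msets_def count_eq_zero_iff by (auto dest!: subsetD simp: inj_eq)

lemma smooth_msets_Suc:
  "smooth_msets (Suc N) = (\<lambda>(M, j). M + replicate_mset j (p N)) ` (smooth_msets N \<times> {..<k})"
proof (intro equalityI subsetI)
  fix M assume M: "M \<in> smooth_msets (Suc N)"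
  define M' where "M' = filter_mset (\<lambda>q. q \<noteq> p N) M"
  have "M = M' + replicate_mset (count M (p N)) (p N)"
    unfolding M'_def by (intro multiset_eqI) auto
  moreover have "M' \<in> smooth_msets N"
    using M unfolding smooth_msets_def M'_def by (auto simp: lessThan_Suc)
  moreover have "count M (p N) < k" using M unfolding smooth_msets_def by auto
  ultimately show "M \<in> (\<lambda>(M, j). M + replicate_mset j (p N)) ` (smooth_msets N \<times> {..<k})" by force
next
  fix M assume "M \<in> (\<lambda>(M, j). M + replicate_mset j (p N)) ` (smooth_msets N \<times> {..<k})"
  then obtain M' j where M': "M = M' + replicate_mset j (p N)" "M' \<in> smooth_msets N" "j < k" by auto
  have "count M' (p N) = 0" using M'(2) by (rule count_smooth_msets_0)
  thus "M \<in> smooth_msets (Suc N)" using M' unfolding smooth_msets_def by (auto split: if_splits)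
qed

lemma inj_on_add_replicate: "inj_on (\<lambda>(M, j). M + replicate_mset j (p N)) (smooth_msets N \<times> {..<k})"
proof (rule inj_onI, clarify)
  fix M j M' j' assume *: "M \<in> smooth_msets N" "M' \<in> smooth_msets N" "M + replicate_mset j (p N) = M' + replicate_mset j' (p N)"
  have "count M (p N) = 0" "count M' (p N) = 0" using * count_smooth_msets_0 by auto
  hence "j = j'" using arg_cong[OF *(3), of "\<lambda>L. count L (p N)"] by simp
  thus "M = M' \<and> j = j'" using * by simp
qed

lemma smooth_msets_0: "smooth_msets 0 = {{#}}"
  unfolding smooth_msets_def using k2 by auto

lemma finite_smooth_msets: "finite (smooth_msets N)"
  by (induction N) (auto simp: smooth_msets_0 smooth_msets_Suc)

text \<open>Stated over a commutative ring to serve both the real weights, for convergence, and the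
  complex ones, for zeta.\<close>

lemma sum_smooth_euler:
  fixes w :: "'a \<Rightarrow> 'c::comm_ring_1"
  assumes w1: "w 1 = 1" and wm: "\<And>a b. w (a * b) = w a * w b"
  shows "(\<Sum>a\<in>smooth_power_free N. w a) = (\<Prod>n<N. \<Sum>j<k. w (p n) ^ j)"
proof -
  have wp: "w (q ^ j) = w q ^ j" for q j by (induction j) (auto simp: w1 wm)
  have "(\<Sum>M\<in>smooth_msets N. w (prod_mset M)) = (\<Prod>n<N. \<Sum>j<k. w (p n) ^ j)"
  proof (induction N)
    case 0 show ?case by (simp add: smooth_msets_0 w1)
  next
    case (Suc N)
    have "(\<Sum>M\<in>smooth_msets (Suc N). w (prod_mset M)) = (\<Sum>(M, j)\<in>smooth_msets N \<times> {..<k}. w (prod_mset (M + replicate_mset j (p N))))"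
      unfolding smooth_msets_Suc by (subst sum.reindex[OF inj_on_add_replicate]) (simp add: case_prod_unfold)
    also have "\<dots> = (\<Sum>M\<in>smooth_msets N. \<Sum>j<k. w (prod_mset M) * w (p N) ^ j)"
      by (simp add: sum.cartesian_product[symmetric] wm wp)
    also have "\<dots> = (\<Sum>M\<in>smooth_msets N. w (prod_mset M)) * (\<Sum>j<k. w (p N) ^ j)"
      by (simp add: sum_product)
    finally show ?case using Suc by simp
  qed
  thus ?thesis unfolding smooth_power_free_def by (subst sum.reindex[OF inj_on_prod_mset]) (simp add: o_def)
qed

lemma finite_smooth: "finite (smooth_power_free N)"
  unfolding smooth_power_free_def using finite_smooth_msets by simp

lemma smooth_mono: "N \<le> N' \<Longrightarrow> smooth_power_free N \<subseteq> smooth_power_free N'"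
  unfolding smooth_power_free_def smooth_msets_def by (intro image_mono) force

lemma smooth_subset: "smooth_power_free N \<subseteq> {a. power_free k a}"
proof
  fix a assume "a \<in> smooth_power_free N"
  then obtain M where "M \<in> smooth_msets N" "a = prod_mset M" unfolding smooth_power_free_def by blast
  thus "a \<in> {a. power_free k a}"
    using power_free_prod_mset_iff[of M k] smooth_msets_subset[of M N] k2 unfolding smooth_msets_def by auto
qed

lemma smooth_exhaust: "power_free k a \<Longrightarrow> \<exists>N. a \<in> smooth_power_free N"
proof -
  assume pf: "power_free k a"
  obtain M where M: "set_mset M \<subseteq> P" "prod_mset M = a" using factorization_exists by blast
  have "set_mset M \<subseteq> range p" using M bij_p by (auto simp: bij_betw_def)
  then obtain I where I: "finite I" "set_mset M = p ` I" by (metis finite_set_mset finite_subset_image)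
  then obtain N where "I \<subseteq> {..<N}" by (meson finite_nat_iff_bounded)
  hence "M \<in> smooth_msets N"
    using I pf M power_free_prod_mset_iff[of M k] k2 unfolding smooth_msets_def by auto
  thus ?thesis using M unfolding smooth_power_free_def by blast
qed

lemma smooth_exhaust_finite:
  fixes F :: "'a set"
  assumes "finite F" "F \<subseteq> {a. power_free k a}"
  shows "\<exists>N. F \<subseteq> smooth_power_free N"
  using assms
proof (induction F)
  case (insert a F)
  then obtain N where "F \<subseteq> smooth_power_free N" by auto
  moreover obtain N' where "a \<in> smooth_power_free N'" using smooth_exhaust[of a] insert.prems by auto
  ultimately show ?case using smooth_mono[of N "max N N'"] smooth_mono[of N' "max N N'"] by (intro exI[of _ "max N N'"]) auto
qed auto

text \<open>The sets \<open>smooth_power_free N\<close> increase and eventually contain every finite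
  set of power-free elements, so unordered sums may be evaluated along them.\<close>

lemma filterlim_smooth: "filterlim smooth_power_free (finite_subsets_at_top {a. power_free k a}) sequentially"
  unfolding filterlim_iff eventually_finite_subsets_at_top
proof clarify
  fix Q :: "'a set \<Rightarrow> bool" and X assume X: "finite X" "X \<subseteq> {a. power_free k a}" "\<forall>Y. finite Y \<and> X \<subseteq> Y \<and> Y \<subseteq> {a. power_free k a} \<longrightarrow> Q Y"
  obtain N where "X \<subseteq> smooth_power_free N" using smooth_exhaust_finite[OF X(1,2)] by blast
  hence "Q (smooth_power_free M)" if "M \<ge> N" for M
    using smooth_mono[OF that] finite_smooth smooth_subset by (intro X(3)[rule_format]) auto
  thus "eventually (\<lambda>N. Q (smooth_power_free N)) sequentially" by (auto simp: eventually_sequentially)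
qed

text \<open>Every finite subset lies in some \<open>smooth_power_free N\<close>, whose sum is an
  Euler product; each factor is at most 1 + k r \<le> exp (k r), which reduces the bound to the
  convergent sum over primes.\<close>

lemma real_weight_summable:
  assumes "s > 1"
  shows "(\<lambda>a. exp (- deg a * s)) summable_on {a. power_free k a}"
proof (rule nonneg_bdd_above_summable_on)
  define S where "S = (\<Sum>n. exp (- deg (p n) * s))"
  show "bdd_above (sum (\<lambda>a. exp (- deg a * s)) ` {F. F \<subseteq> {a. power_free k a} \<and> finite F})"
  proof (rule bdd_aboveI2)
    fix F :: "'a set" assume "F \<in> {F. F \<subseteq> {a. power_free k a} \<and> finite F}"
    then obtain N where N: "F \<subseteq> smooth_power_free N" using smooth_exhaust_finite by blast
    have "sum (\<lambda>a. exp (- deg a * s)) F \<le> sum (\<lambda>a. exp (- deg a * s)) (smooth_power_free N)"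
      using N finite_smooth by (intro sum_mono2) auto
    also have "\<dots> = (\<Prod>n<N. \<Sum>j<k. exp (- deg (p n) * s) ^ j)"
      by (rule sum_smooth_euler) (auto simp: deg_one deg_mult exp_add[symmetric] algebra_simps)
    also have "\<dots> \<le> (\<Prod>n<N. exp (real k * exp (- deg (p n) * s)))"
    proof (intro prod_mono conjI)
      fix n
      define r where "r = exp (- deg (p n) * s)"
      have r: "0 \<le> r" "r \<le> 1" unfolding r_def using deg_nonneg assms by (auto simp: mult_nonneg_nonneg)
      have "(\<Sum>j<k. r ^ j) \<le> (\<Sum>j<k. (if j = 0 then 1 else 0) + r)"
      proof (intro sum_mono)
        fix j show "r ^ j \<le> (if j = 0 then 1 else 0) + r"
          using r power_decreasing[of 1 j r] by (cases "j = 0") auto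
      qed
      also have "\<dots> = 1 + real k * r" using k2 by (simp add: sum.distrib)
      also have "\<dots> \<le> exp (real k * r)" by (rule exp_ge_add_one_self)
      finally show "(\<Sum>j<k. r ^ j) \<le> exp (real k * r)" .
      show "0 \<le> (\<Sum>j<k. r ^ j)" using r by (intro sum_nonneg) auto
    qed
    also have "\<dots> = exp (real k * (\<Sum>n<N. exp (- deg (p n) * s)))" by (simp add: exp_sum sum_distrib_left)
    also have "\<dots> \<le> exp (real k * S)"
      unfolding S_def using summable_primes[OF assms] by (simp add: sum_le_suminf mult_left_mono)
    finally show "sum (\<lambda>a. exp (- deg a * s)) F \<le> exp (real k * S)" .
  qed
qed auto

lemma abs_summable_weight:
  assumes "Re s > 1"
  shows "(\<lambda>a. norm (exp (- complex_of_real (deg a) * s))) summable_on {a. power_free k a}"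
  using real_weight_summable[OF assms] by simp

text \<open>Absolute convergence allows the series to be summed along
  \<open>smooth_power_free\<close>, where its partial sums are finite Euler products.\<close>

lemma euler_product:
  assumes "Re s > 1"
  shows "(\<lambda>N. \<Prod>n<N. \<Sum>j<k. exp (- complex_of_real (deg (p n)) * s) ^ j) \<longlonglongrightarrow> zeta deg k s"
proof -
  have "((\<lambda>a. exp (- complex_of_real (deg a) * s)) has_sum zeta deg k s) {a. power_free k a}"
    unfolding zeta_def using has_sum_infsum[OF abs_summable_summable[OF abs_summable_weight[OF assms]]] .
  hence "(\<lambda>N. \<Sum>a\<in>smooth_power_free N. exp (- complex_of_real (deg a) * s)) \<longlonglongrightarrow> zeta deg k s"
    unfolding has_sum_def by (rule filterlim_compose[OF _ filterlim_smooth])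
  also have "(\<lambda>N. \<Sum>a\<in>smooth_power_free N. exp (- complex_of_real (deg a) * s)) = (\<lambda>N. \<Prod>n<N. \<Sum>j<k. exp (- complex_of_real (deg (p n)) * s) ^ j)"
  proof
    fix N
    show "(\<Sum>a\<in>smooth_power_free N. exp (- complex_of_real (deg a) * s)) = (\<Prod>n<N. \<Sum>j<k. exp (- complex_of_real (deg (p n)) * s) ^ j)"
    proof (rule sum_smooth_euler)
      show "exp (- complex_of_real (deg (a * b)) * s) = exp (- complex_of_real (deg a) * s) * exp (- complex_of_real (deg b) * s)" for a b
        unfolding exp_add[symmetric] by (simp add: deg_mult algebra_simps)
    qed (simp add: deg_one)
  qed
  finally show ?thesis .
qed

lemma zeta_of_real:
  assumes "s > 1"
  shows "zeta_real deg k s = (\<Sum>\<^sub>\<infinity>a\<in>{a. power_free k a}. exp (- deg a * s))"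
    and "zeta deg k (of_real s) = of_real (zeta_real deg k s)"
proof -
  have "zeta deg k (of_real s) = (\<Sum>\<^sub>\<infinity>a\<in>{a. power_free k a}. of_real (exp (- deg a * s)))"
    unfolding zeta_def by (simp only: exp_of_real[symmetric] of_real_mult of_real_minus)
  also have "\<dots> = of_real (\<Sum>\<^sub>\<infinity>a\<in>{a. power_free k a}. exp (- deg a * s))"
    by (intro infsumI has_sum_of_real has_sum_infsum real_weight_summable assms)
  finally have z: "zeta deg k (of_real s) = of_real (\<Sum>\<^sub>\<infinity>a\<in>{a. power_free k a}. exp (- deg a * s))" .
  show "zeta_real deg k s = (\<Sum>\<^sub>\<infinity>a\<in>{a. power_free k a}. exp (- deg a * s))"
    unfolding zeta_real_def z by simp
  thus "zeta deg k (of_real s) = of_real (zeta_real deg k s)" using z by simp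
qed

lemma power_free_1: "power_free k (1 :: 'a)"
  using power_free_prod_mset_iff[of "{#}" k] k2 by simp

lemma zeta_real_ge_1:
  assumes "s > 1" shows "zeta_real deg k s \<ge> 1"
proof -
  have "(\<Sum>a\<in>{1}. exp (- deg a * s)) \<le> (\<Sum>\<^sub>\<infinity>a\<in>{a. power_free k a}. exp (- deg a * s))"
    using power_free_1 by (intro finite_sum_le_infsum real_weight_summable assms) auto
  thus ?thesis using assms by (simp add: zeta_of_real(1) deg_one)
qed

definition weight :: "real \<Rightarrow> 'a \<Rightarrow> real" where
  "weight s a = (if power_free k a then exp (- deg a * s) / zeta_real deg k s else 0)"

definition tilted :: "real \<Rightarrow> 'a pmf" where
  "tilted s = embed_pmf (weight s)"

lemma pmf_tilted:
  assumes s: "s > 1" shows "pmf (tilted s) = weight s"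
proof
  fix a
  have z: "zeta_real deg k s \<ge> 1" by (rule zeta_real_ge_1[OF s])
  have nn: "weight s a \<ge> 0" for a unfolding weight_def using z by simp
  have hs: "(weight s has_sum 1) UNIV"
  proof -
    have "((\<lambda>a. exp (- deg a * s)) has_sum zeta_real deg k s) {a. power_free k a}"
      unfolding zeta_of_real(1)[OF s] by (intro has_sum_infsum real_weight_summable s)
    hence "((\<lambda>a. exp (- deg a * s) * (1 / zeta_real deg k s)) has_sum (zeta_real deg k s * (1 / zeta_real deg k s))) {a. power_free k a}"
      by (rule has_sum_cmult_left)
    hence "((\<lambda>a. exp (- deg a * s) / zeta_real deg k s) has_sum 1) {a. power_free k a}" using z by simp
    thus ?thesis by (rule has_sum_cong_neutral[THEN iffD1, rotated -1]) (auto simp: weight_def)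
  qed
  have "(\<integral>\<^sup>+ x. ennreal (weight s x) \<partial>count_space UNIV) = 1"
  proof -
    \<comment> \<open>The bridge from unordered sums to integrals over the counting measure leads
      through \<open>infsetsum\<close>.\<close>
    have "(\<lambda>a. norm (weight s a)) summable_on UNIV" using hs nn by (simp add: has_sum_imp_summable)
    hence abs: "Infinite_Set_Sum.abs_summable_on (weight s) UNIV" by (simp only: abs_summable_equivalent)
    hence "integrable (count_space UNIV) (weight s)" by (simp only: Infinite_Set_Sum.abs_summable_on_def)
    hence "(\<integral>\<^sup>+ x. ennreal (weight s x) \<partial>count_space UNIV) = ennreal (infsetsum (weight s) UNIV)"
      unfolding infsetsum_def using nn by (intro nn_integral_eq_integral) auto
    also have "infsetsum (weight s) UNIV = 1" using infsetsum_infsum[OF abs] infsumI[OF hs] by simp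
    finally show ?thesis by simp
  qed
  thus "pmf (tilted s) a = weight s a"
    unfolding tilted_def using nn by (intro pmf_embed_pmf)
qed

text \<open>exp (- deg a s) times the phase exp (i t deg a) is the weight at s - i t, which explains
  the sign in \<open>Complex s (- t)\<close>.\<close>

lemma tilted_char:
  assumes s: "s > 1"
  shows "(CLINT a|measure_pmf (tilted s). iexp (t * (deg a - x))) = iexp (- t * x) * (zeta deg k (Complex s (- t)) / of_real (zeta_real deg k s))"
proof -
  define f where "f = (\<lambda>a. iexp (t * (deg a - x)))"
  define Z where "Z = zeta_real deg k s"
  define g where "g = (\<lambda>a. weight s a *\<^sub>R f a)"
  have z: "Z \<ge> 1" unfolding Z_def by (rule zeta_real_ge_1[OF s])
  have g: "g a = (iexp (- t * x) / of_real Z) * exp (- complex_of_real (deg a) * Complex s (- t))" if "power_free k a" for a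
  proof -
    have "of_real (exp (- deg a * s)) * f a = iexp (- t * x) * exp (- complex_of_real (deg a) * Complex s (- t))"
    proof -
      have "of_real (exp (- deg a * s)) * f a = exp (of_real (- deg a * s) + \<i> * of_real (t * (deg a - x)))"
        unfolding f_def by (simp only: exp_add exp_of_real)
      also have "of_real (- deg a * s) + \<i> * of_real (t * (deg a - x)) = \<i> * of_real (- t * x) + - complex_of_real (deg a) * Complex s (- t)"
        by (simp add: complex_eq_iff algebra_simps)
      finally show ?thesis by (simp only: exp_add)
    qed
    thus ?thesis using that unfolding g_def weight_def Z_def[symmetric] by (simp add: scaleR_conv_of_real)
  qed
  have g0: "g a = 0" if "\<not> power_free k a" for a using that unfolding g_def weight_def by simp
  have hs: "(g has_sum (iexp (- t * x) / of_real Z) * zeta deg k (Complex s (- t))) UNIV"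
  proof -
    have "((\<lambda>a. exp (- complex_of_real (deg a) * Complex s (- t))) has_sum zeta deg k (Complex s (- t))) {a. power_free k a}"
    proof -
      have "1 < Re (Complex s (- t))" using s by simp
      from has_sum_infsum[OF abs_summable_summable[OF abs_summable_weight[OF this]]]
      show ?thesis unfolding zeta_def .
    qed
    hence "((\<lambda>a. (iexp (- t * x) / of_real Z) * exp (- complex_of_real (deg a) * Complex s (- t))) has_sum (iexp (- t * x) / of_real Z) * zeta deg k (Complex s (- t))) {a. power_free k a}"
      by (rule has_sum_cmult_right)
    thus ?thesis by (rule has_sum_cong_neutral[THEN iffD1, rotated -1]) (auto simp: g g0)
  qed
  have "(\<lambda>a. norm (g a)) summable_on UNIV"
  proof -
    have "(\<lambda>a. norm (g a)) = weight s"
      unfolding g_def f_def using z by (auto simp: fun_eq_iff weight_def Z_def[symmetric] simp del: of_real_mult)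
    moreover have "integrable (count_space UNIV) (pmf (tilted s))" by (rule integrable_pmf)
    hence "Infinite_Set_Sum.abs_summable_on (weight s) UNIV"
      by (simp only: Infinite_Set_Sum.abs_summable_on_def pmf_tilted[OF s])
    hence "(\<lambda>a. norm (weight s a)) summable_on UNIV" by (simp only: abs_summable_equivalent)
    hence "weight s summable_on UNIV" by (rule abs_summable_summable)
    ultimately show ?thesis by (simp only:)
  qed
  hence abs: "Infinite_Set_Sum.abs_summable_on g UNIV" by (simp only: abs_summable_equivalent)
  have "(CLINT a|measure_pmf (tilted s). f a) = (CLINT a|count_space UNIV. g a)"
    unfolding measure_pmf_eq_density g_def pmf_tilted[OF s, symmetric] by (subst integral_density) auto
  also have "\<dots> = infsum g UNIV" using infsetsum_infsum[OF abs] unfolding infsetsum_def .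
  also have "\<dots> = (iexp (- t * x) / of_real Z) * zeta deg k (Complex s (- t))" using hs by (rule infsumI)
  finally show ?thesis unfolding f_def Z_def by simp
qed

text \<open>On a counted element \<open>cut_exp\<close> cancels the tilt exactly, so all of them
  contribute the same amount; the count is thus an expectation.\<close>

lemma tilted_cut_exp:
  assumes s: "s > 1" and x: "x > 0"
  shows "(\<integral>a. cut_exp s (deg a - x) \<partial>measure_pmf (tilted s)) = real (power_free_count deg k x) * exp (- s * x) / zeta_real deg k s"
proof -
  define A where "A = {a. power_free k a \<and> deg a \<le> x}"
  have fin: "finite A" unfolding A_def using finite_deg_le[OF x] by (rule rev_finite_subset) auto
  have sub: "a \<in> A" if "a \<in> set_pmf (tilted s)" "cut_exp s (deg a - x) \<noteq> 0" for a
    using that unfolding A_def cut_exp_def set_pmf_iff pmf_tilted[OF s] weight_def by (auto simp: indicator_def split: if_splits)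
  have "(\<integral>a. cut_exp s (deg a - x) \<partial>measure_pmf (tilted s)) = (\<Sum>a\<in>A. cut_exp s (deg a - x) * pmf (tilted s) a)"
    using fin sub by (rule integral_measure_pmf_real)
  also have "\<dots> = (\<Sum>a\<in>A. exp (- s * x) / zeta_real deg k s)"
  proof (intro sum.cong refl)
    fix a assume "a \<in> A"
    thus "cut_exp s (deg a - x) * pmf (tilted s) a = exp (- s * x) / zeta_real deg k s"
      unfolding A_def pmf_tilted[OF s] weight_def cut_exp_def by (simp add: exp_add[symmetric] algebra_simps)
  qed
  also have "\<dots> = real (power_free_count deg k x) * exp (- s * x) / zeta_real deg k s"
    unfolding power_free_count_def A_def by simp
  finally show ?thesis .
qed

end

section \<open>The saddle point\<close>

context truncated_geometric
begin

lemma moment2_eq: "tg_moment k r 2 = (\<Sum>j<k. tg_prob k r j * (real j)\<^sup>2) - (tg_mean k r)\<^sup>2"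
proof -
  define m where "m = tg_mean k r"
  have "tg_moment k r 2 = (\<Sum>j<k. tg_prob k r j * (real j)\<^sup>2 - 2 * m * (tg_prob k r j * real j) + m\<^sup>2 * tg_prob k r j)"
    unfolding tg_moment_def m_def[symmetric] by (intro sum.cong refl) (simp add: power2_eq_square algebra_simps)
  also have "\<dots> = (\<Sum>j<k. tg_prob k r j * (real j)\<^sup>2) - 2 * m * (\<Sum>j<k. tg_prob k r j * real j) + m\<^sup>2 * (\<Sum>j<k. tg_prob k r j)"
    by (simp only: sum.distrib sum_subtractf sum_distrib_left)
  also have "\<dots> = (\<Sum>j<k. tg_prob k r j * (real j)\<^sup>2) - m\<^sup>2"
    unfolding sum_prob tg_mean_def[symmetric] m_def[symmetric] by (simp add: power2_eq_square)
  finally show ?thesis unfolding m_def .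
qed

end

section \<open>Derivatives of the logarithmic Euler factors\<close>

lemma DERIV_tg_norm_exp:
  "((\<lambda>s. tg_norm k (exp (- d * s))) has_real_derivative (- d * (\<Sum>j<k. real j * exp (- d * s) ^ j))) (at s)"
proof -
  have "((\<lambda>s. \<Sum>j<k. exp (real j * (- d * s))) has_real_derivative (\<Sum>j<k. exp (real j * (- d * s)) * (real j * - d))) (at s)"
    by (intro DERIV_sum) (auto intro!: derivative_eq_intros)
  moreover have "(\<Sum>j<k. exp (real j * (- d * s)) * (real j * - d)) = - d * (\<Sum>j<k. real j * exp (- d * s) ^ j)"
    unfolding sum_distrib_left by (intro sum.cong refl) (simp add: exp_of_nat_mult[symmetric])
  ultimately show ?thesis unfolding tg_norm_def exp_of_nat_mult by simp
qed

lemma tg_norm_exp_pos: "k \<ge> 1 \<Longrightarrow> r > 0 \<Longrightarrow> tg_norm k r > 0"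
  unfolding tg_norm_def by (intro sum_pos) (auto simp: lessThan_empty_iff)

lemma DERIV_ln_tg_norm:
  assumes "k \<ge> 1"
  shows "((\<lambda>s. ln (tg_norm k (exp (- d * s)))) has_real_derivative (- d * tg_mean k (exp (- d * s)))) (at s)"
proof -
  have n: "tg_norm k (exp (- d * s)) > 0" using assms by (intro tg_norm_exp_pos) auto
  have "((\<lambda>s. ln (tg_norm k (exp (- d * s)))) has_real_derivative (1 / tg_norm k (exp (- d * s)) * (- d * (\<Sum>j<k. real j * exp (- d * s) ^ j)))) (at s)"
    by (rule DERIV_chain2[OF DERIV_ln_divide[OF n] DERIV_tg_norm_exp])
  moreover have "1 / tg_norm k (exp (- d * s)) * (- d * (\<Sum>j<k. real j * exp (- d * s) ^ j)) = - d * tg_mean k (exp (- d * s))"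
    unfolding tg_mean_def tg_prob_def by (simp add: sum_divide_distrib sum_distrib_left mult_ac)
  ultimately show ?thesis by simp
qed

text \<open>In an exponential family the mean has the variance as its derivative in the natural
  parameter, here - d s. The assumption \<open>ds\<close> puts r = exp (- d s) into (0, 1], the
  range of the locale.\<close>

lemma DERIV_tg_mean:
  assumes k: "k \<ge> 2" and ds: "d * s \<ge> 0"
  shows "((\<lambda>s. tg_mean k (exp (- d * s))) has_real_derivative (- d * tg_moment k (exp (- d * s)) 2)) (at s)"
proof -
  define r where "r = exp (- d * s)"
  interpret truncated_geometric k r using k ds unfolding r_def by unfold_locales auto
  define S where "S = tg_norm k r"
  have n: "S > 0" unfolding S_def using norm_ge1 by simp
  define A where "A = (\<lambda>s. \<Sum>j<k. real j * exp (- d * s) ^ j)"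
  have A: "(A has_real_derivative (- d * (\<Sum>j<k. (real j)\<^sup>2 * r ^ j))) (at s)"
  proof -
    have "((\<lambda>s. \<Sum>j<k. real j * exp (real j * (- d * s))) has_real_derivative (\<Sum>j<k. real j * (exp (real j * (- d * s)) * (real j * - d)))) (at s)"
      by (intro DERIV_sum) (auto intro!: derivative_eq_intros)
    moreover have "(\<Sum>j<k. real j * (exp (real j * (- d * s)) * (real j * - d))) = - d * (\<Sum>j<k. (real j)\<^sup>2 * r ^ j)"
      unfolding sum_distrib_left r_def by (intro sum.cong refl) (simp add: exp_of_nat_mult[symmetric] power2_eq_square)
    ultimately show ?thesis unfolding A_def exp_of_nat_mult by simp
  qed
  have mean: "tg_mean k (exp (- d * s)) = A s / tg_norm k (exp (- d * s))" for s
    unfolding tg_mean_def tg_prob_def A_def by (simp add: sum_divide_distrib mult.commute)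
  have "((\<lambda>s. A s / tg_norm k (exp (- d * s))) has_real_derivative
     ((- d * (\<Sum>j<k. (real j)\<^sup>2 * r ^ j)) * S - A s * (- d * A s)) / (S * S)) (at s)"
    using DERIV_divide[OF A DERIV_tg_norm_exp[of k d s]] n unfolding S_def r_def A_def by simp
  moreover have "((- d * (\<Sum>j<k. (real j)\<^sup>2 * r ^ j)) * S - A s * (- d * A s)) / (S * S) = - d * tg_moment k r 2"
  proof -
    have 1: "(\<Sum>j<k. tg_prob k r j * (real j)\<^sup>2) = (\<Sum>j<k. (real j)\<^sup>2 * r ^ j) / S"
      unfolding tg_prob_def S_def by (simp add: sum_divide_distrib mult.commute)
    have 2: "tg_mean k r = A s / S" using mean[of s] unfolding S_def r_def .
    have "((- d * X) * S - a * (- d * a)) / (S * S) = - d * (X / S - (a / S)\<^sup>2)" for X a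
      using n by (simp add: power2_eq_square field_simps)
    thus ?thesis unfolding moment2_eq 1 2 .
  qed
  ultimately show ?thesis unfolding mean r_def by simp
qed

section \<open>Cumulants of the tilted degree: termwise differentiation and size\<close>

locale power_free_saddle = enumerated_semigroup P deg k p + degree_sequence "\<lambda>n. deg (p n)" \<rho> \<gamma> \<delta>
  for P :: "'a::comm_monoid_mult set" and deg :: "'a \<Rightarrow> real" and k p \<rho> \<gamma> \<delta>
begin

abbreviation d :: "nat \<Rightarrow> real" where "d n \<equiv> deg (p n)"

definition rad :: "real \<Rightarrow> nat \<Rightarrow> real" where "rad s n = exp (- d n * s)"

definition mean :: "real \<Rightarrow> real" where "mean s = (\<Sum>n. d n * tg_mean k (rad s n))"
definition var :: "real \<Rightarrow> real" where "var s = (\<Sum>n. d n ^ 2 * tg_moment k (rad s n) 2)"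
definition third :: "real \<Rightarrow> real" where "third s = (\<Sum>n. d n ^ 3 * tg_moment k (rad s n) 3)"

lemma truncated_geometric_rad: "s > 1 \<Longrightarrow> truncated_geometric k (rad s n)"
  using k2 d_pos[of n] by unfold_locales (auto simp: rad_def)

lemma summable_rad: "s > 1 \<Longrightarrow> summable (\<lambda>n. d n ^ j * rad s n)"
  unfolding rad_def by (rule summable_moment)

lemma mean_term_bounds:
  assumes "s > 1"
  shows "0 \<le> d n * tg_mean k (rad s n)" "d n * tg_mean k (rad s n) \<le> real k ^ 2 * (d n * rad s n)"
    "d n * tg_mean k (rad s n) \<ge> (1 / k) * (d n * rad s n)"
proof -
  interpret truncated_geometric k "rad s n" by (rule truncated_geometric_rad[OF assms])
  show "0 \<le> d n * tg_mean k (rad s n)" using mean_nonneg d_pos[of n] by simp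
  show "d n * tg_mean k (rad s n) \<le> real k ^ 2 * (d n * rad s n)"
    using mult_left_mono[OF mean_le_r, of "d n"] d_pos[of n] by (simp add: mult_ac)
  show "d n * tg_mean k (rad s n) \<ge> (1 / k) * (d n * rad s n)"
    using mult_left_mono[OF mean_ge, of "d n"] d_pos[of n] by (simp add: mult_ac)
qed

lemma moment_term_bound:
  assumes "s > 1" "i \<ge> 1"
  shows "\<bar>d n ^ i * tg_moment k (rad s n) i\<bar> \<le> 2 * real k ^ (i + 1) * (d n ^ i * rad s n)"
proof -
  interpret truncated_geometric k "rad s n" by (rule truncated_geometric_rad[OF assms(1)])
  have "\<bar>d n ^ i * tg_moment k (rad s n) i\<bar> = d n ^ i * \<bar>tg_moment k (rad s n) i\<bar>"
    using d_pos[of n] by (simp add: abs_mult)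
  also have "\<dots> \<le> d n ^ i * (2 * real k ^ (i + 1) * rad s n)"
    using moment_abs_le[OF assms(2)] d_pos[of n] by (intro mult_left_mono) auto
  finally show ?thesis by (simp add: mult_ac)
qed

lemma var_term_ge: "s > 1 \<Longrightarrow> d n ^ 2 * tg_moment k (rad s n) 2 \<ge> (1 / (2 * k)) * (d n ^ 2 * rad s n)"
proof -
  assume "s > 1"
  then interpret truncated_geometric k "rad s n" by (rule truncated_geometric_rad)
  show ?thesis using mult_left_mono[OF moment2_ge, of "d n ^ 2"] by (simp add: mult_ac)
qed

lemma summable_mean: assumes "s > 1" shows "summable (\<lambda>n. d n * tg_mean k (rad s n))"
proof (rule summable_comparison_test')
  show "summable (\<lambda>n. real k ^ 2 * (d n ^ 1 * rad s n))" using assms by (intro summable_mult summable_rad)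
  show "norm (d n * tg_mean k (rad s n)) \<le> real k ^ 2 * (d n ^ 1 * rad s n)" for n
    using mean_term_bounds[OF assms, of n] by simp
qed

lemma summable_moment_term:
  assumes "s > 1" "i \<ge> 1" shows "summable (\<lambda>n. d n ^ i * tg_moment k (rad s n) i)"
proof (rule summable_comparison_test')
  show "summable (\<lambda>n. 2 * real k ^ (i + 1) * (d n ^ i * rad s n))" using assms by (intro summable_mult summable_rad)
  show "norm (d n ^ i * tg_moment k (rad s n) i) \<le> 2 * real k ^ (i + 1) * (d n ^ i * rad s n)" for n
    using moment_term_bound[OF assms, of n] by simp
qed

lemma real_euler_product:
  assumes "s > 1" shows "(\<lambda>N. \<Prod>n<N. tg_norm k (rad s n)) \<longlonglongrightarrow> zeta_real deg k s"
proof -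
  have "(\<lambda>N. \<Prod>n<N. \<Sum>j<k. exp (- complex_of_real (d n) * of_real s) ^ j) \<longlonglongrightarrow> zeta deg k (of_real s)"
    using assms by (intro euler_product) simp
  moreover have "(\<Prod>n<N. \<Sum>j<k. exp (- complex_of_real (d n) * of_real s) ^ j) = of_real (\<Prod>n<N. tg_norm k (rad s n))" for N
  proof -
    have "exp (- complex_of_real x * of_real s) = of_real (exp (- x * s))" for x
      by (simp only: of_real_mult[symmetric] of_real_minus[symmetric] exp_of_real)
    thus ?thesis unfolding tg_norm_def rad_def by simp
  qed
  ultimately have "(\<lambda>N. complex_of_real (\<Prod>n<N. tg_norm k (rad s n))) \<longlonglongrightarrow> of_real (zeta_real deg k s)"
    unfolding zeta_of_real(2)[OF assms] by (simp only:)
  thus ?thesis by (simp only: tendsto_of_real_iff)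
qed

lemma ln_zeta_sums:
  assumes "s > 1" shows "(\<lambda>n. ln (tg_norm k (rad s n))) sums ln_zeta deg k s"
proof -
  have pos: "tg_norm k (rad s n) > 0" for n
    using truncated_geometric.norm_ge1[OF truncated_geometric_rad[OF assms, of n]] by simp
  have "(\<lambda>N. ln (\<Prod>n<N. tg_norm k (rad s n))) \<longlonglongrightarrow> ln (zeta_real deg k s)"
    using real_euler_product[OF assms] zeta_real_ge_1[OF assms] by (intro tendsto_ln) auto
  moreover have "ln (\<Prod>n<N. tg_norm k (rad s n)) = (\<Sum>n<N. ln (tg_norm k (rad s n)))" for N
  proof (rule ln_prod)
    show "tg_norm k (rad s n) \<noteq> 0" for n using pos[of n] by linarith
  qed simp
  ultimately show ?thesis unfolding sums_def ln_zeta_def by simp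
qed

lemma DERIV_ln_zeta:
  assumes s: "s > 1" shows "(ln_zeta deg k has_real_derivative - mean s) (at s)"
proof -
  \<comment> \<open>A point strictly between 1 and s. \<open>rad\<close> decreases in its first
    argument, so the convergent majorant at s0 serves on all of [s0, \<infinity>).\<close>
  define s0 where "s0 = (1 + s) / 2"
  have s0: "s0 > 1" "s0 < s" unfolding s0_def using s by auto
  have conv: "uniformly_convergent_on {s0..} (\<lambda>N u. \<Sum>n<N. - d n * tg_mean k (rad u n))"
  proof (rule Weierstrass_m_test')
    show "summable (\<lambda>n. real k ^ 2 * (d n ^ 1 * rad s0 n))" using s0 by (intro summable_mult summable_rad)
    fix n u assume u: "u \<in> {s0..}"
    have "rad u n \<le> rad s0 n" unfolding rad_def using u d_pos[of n] by simp
    hence "real k ^ 2 * (d n * rad u n) \<le> real k ^ 2 * (d n * rad s0 n)" using d_pos[of n] by (intro mult_left_mono) auto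
    thus "norm (- d n * tg_mean k (rad u n)) \<le> real k ^ 2 * (d n ^ 1 * rad s0 n)"
      using mean_term_bounds[of u n] u s0 by simp
  qed
  have "((\<lambda>u. \<Sum>n. ln (tg_norm k (rad u n))) has_real_derivative (\<Sum>n. - d n * tg_mean k (rad s n))) (at s)"
  proof (rule has_field_derivative_series'(2)[where S = "{s0..}" and x0 = s])
    fix n u assume "u \<in> {s0..}"
    show "((\<lambda>u. ln (tg_norm k (rad u n))) has_real_derivative - d n * tg_mean k (rad u n)) (at u within {s0..})"
      unfolding rad_def by (rule has_field_derivative_at_within[OF DERIV_ln_tg_norm]) (use k2 in simp)
  qed (use s0 conv ln_zeta_sums[OF s] ln_zeta_sums[OF s0(1)] in \<open>auto simp: sums_iff interior_real_atLeast\<close>)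
  moreover have "(\<Sum>n. - d n * tg_mean k (rad s n)) = - mean s"
    unfolding mean_def using suminf_minus[OF summable_mean[OF s]] by simp
  moreover have "eventually (\<lambda>u. (\<Sum>n. ln (tg_norm k (rad u n))) = ln_zeta deg k u) (nhds s)"
  proof -
    have "eventually (\<lambda>u. u \<in> {1<..}) (nhds s)" using s by (intro eventually_nhds_in_open) auto
    thus ?thesis by eventually_elim (use ln_zeta_sums in \<open>auto simp: sums_iff\<close>)
  qed
  ultimately show ?thesis by (subst (asm) DERIV_cong_ev[OF refl _ refl]) auto
qed

lemma DERIV_mean:
  assumes s: "s > 1" shows "(mean has_real_derivative - var s) (at s)"
proof -
  define s0 where "s0 = (1 + s) / 2"
  have s0: "s0 > 1" "s0 < s" unfolding s0_def using s by auto
  have conv: "uniformly_convergent_on {s0..} (\<lambda>N u. \<Sum>n<N. - (d n ^ 2 * tg_moment k (rad u n) 2))"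
  proof (rule Weierstrass_m_test')
    show "summable (\<lambda>n. 2 * real k ^ (2 + 1) * (d n ^ 2 * rad s0 n))" using s0 by (intro summable_mult summable_rad)
    fix n u assume u: "u \<in> {s0..}"
    have "rad u n \<le> rad s0 n" unfolding rad_def using u d_pos[of n] by simp
    hence "2 * real k ^ (2 + 1) * (d n ^ 2 * rad u n) \<le> 2 * real k ^ (2 + 1) * (d n ^ 2 * rad s0 n)" by (intro mult_left_mono) auto
    moreover have "\<bar>d n ^ 2 * tg_moment k (rad u n) 2\<bar> \<le> 2 * real k ^ (2 + 1) * (d n ^ 2 * rad u n)"
      using u s0 by (intro moment_term_bound) auto
    ultimately show "norm (- (d n ^ 2 * tg_moment k (rad u n) 2)) \<le> 2 * real k ^ (2 + 1) * (d n ^ 2 * rad s0 n)"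
      unfolding norm_minus_cancel real_norm_def by linarith
  qed
  have "((\<lambda>u. \<Sum>n. d n * tg_mean k (rad u n)) has_real_derivative (\<Sum>n. - (d n ^ 2 * tg_moment k (rad s n) 2))) (at s)"
  proof (rule has_field_derivative_series'(2)[where S = "{s0..}" and x0 = s])
    fix n u assume u: "u \<in> {s0..}"
    have "((\<lambda>u. tg_mean k (rad u n)) has_real_derivative - d n * tg_moment k (rad u n) 2) (at u within {s0..})"
      unfolding rad_def by (rule has_field_derivative_at_within[OF DERIV_tg_mean[OF k2]]) (use u s0 d_pos[of n] in auto)
    hence "((\<lambda>u. d n * tg_mean k (rad u n)) has_real_derivative d n * (- d n * tg_moment k (rad u n) 2)) (at u within {s0..})"
      by (rule DERIV_cmult)
    moreover have "d n * (- d n * tg_moment k (rad u n) 2) = - (d n ^ 2 * tg_moment k (rad u n) 2)" by (simp add: power2_eq_square)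
    ultimately show "((\<lambda>u. d n * tg_mean k (rad u n)) has_real_derivative - (d n ^ 2 * tg_moment k (rad u n) 2)) (at u within {s0..})" by (simp only:)
  qed (use s0 conv summable_mean[OF s] summable_mean[OF s0(1)] in \<open>auto simp: interior_real_atLeast\<close>)
  moreover have "(\<Sum>n. - (d n ^ 2 * tg_moment k (rad s n) 2)) = - var s"
    unfolding var_def using s by (intro suminf_minus summable_moment_term) auto
  ultimately show ?thesis unfolding mean_def[abs_def] by simp
qed

lemma deriv_ln_zeta: "s > 1 \<Longrightarrow> deriv (ln_zeta deg k) s = - mean s"
  by (rule DERIV_imp_deriv[OF DERIV_ln_zeta])

text \<open>\<open>deriv_ln_zeta\<close> is available only for s > 1, so the two functions are
  identified in a neighbourhood of s before differentiating again.\<close>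

lemma deriv2_ln_zeta:
  assumes s: "s > 1" shows "deriv (deriv (ln_zeta deg k)) s = var s"
proof -
  have "((\<lambda>u. - mean u) has_real_derivative - (- var s)) (at s)" by (rule DERIV_minus[OF DERIV_mean[OF s]])
  moreover have "eventually (\<lambda>u. - mean u = deriv (ln_zeta deg k) u) (nhds s)"
  proof -
    have "eventually (\<lambda>u. u \<in> {1<..}) (nhds s)" using s by (intro eventually_nhds_in_open) auto
    thus ?thesis by eventually_elim (use deriv_ln_zeta in auto)
  qed
  ultimately have "(deriv (ln_zeta deg k) has_real_derivative - (- var s)) (at s)"
    by (subst (asm) DERIV_cong_ev[OF refl _ refl]) auto
  thus ?thesis using DERIV_imp_deriv by fastforce
qed

lemma var_pos: assumes s: "s > 1" shows "var s > 0"
  unfolding var_def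
proof (rule suminf_pos)
  show "summable (\<lambda>n. d n ^ 2 * tg_moment k (rad s n) 2)" using s by (intro summable_moment_term) auto
  fix n
  have "(1 / (2 * k)) * (d n ^ 2 * rad s n) > 0" using d_pos[of n] k2 unfolding rad_def by simp
  thus "0 < d n ^ 2 * tg_moment k (rad s n) 2" using var_term_ge[OF s, of n] by linarith
qed

lemma mean_strict_antimono: assumes "1 < s" "s < u" shows "mean u < mean s"
proof (rule DERIV_neg_imp_decreasing[OF assms(2)])
  fix v assume "s \<le> v" "v \<le> u"
  thus "\<exists>y. (mean has_real_derivative y) (at v) \<and> y < 0"
    using DERIV_mean[of v] var_pos[of v] assms by (intro exI[of _ "- var v"]) auto
qed

text \<open>Both bounds come from the cosine sum at t = e: the inequalities 1 - cos y \<le> |y| and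
  1 - cos y \<le> y^2 at y = e d bound it by e and e^2 times the two sums.\<close>

lemma weighted_sums_lower:
  "\<exists>c>0. \<exists>e0>0. \<forall>e. 0 < e \<and> e < e0 \<longrightarrow> (\<Sum>n. d n * rad (1 + e) n) \<ge> c * e powr (- \<gamma> - 2) \<and> (\<Sum>n. d n ^ 2 * rad (1 + e) n) \<ge> c * e powr (- \<gamma> - 3)"
proof -
  define \<tau> where "\<tau> = \<delta> / 2"
  have tau: "0 < \<tau>" "\<tau> < \<delta>" using delta_pos unfolding \<tau>_def by auto
  obtain c1 e1 where c1: "c1 > 0" "e1 > 0" "\<And>e t. 0 < e \<and> e < e1 \<and> 1 * e \<le> \<bar>t\<bar> \<and> \<bar>t\<bar> \<le> e powr (-\<tau>) \<Longrightarrow>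
     (\<Sum>n. exp (- d n * (1 + e)) * (1 - cos (t * d n))) \<ge> c1 * e powr (- \<gamma> - 1)"
    using cosine_sum_lower[OF tau zero_less_one] by blast
  define e0 where "e0 = min e1 1"
  have main: "(\<Sum>n. d n * rad (1 + e) n) \<ge> c1 * e powr (- \<gamma> - 2) \<and> (\<Sum>n. d n ^ 2 * rad (1 + e) n) \<ge> c1 * e powr (- \<gamma> - 3)"
    if e: "0 < e" "e < e0" for e
  proof -
    have e1: "e < e1" "e < 1" using e unfolding e0_def by auto
    have "1 powr (-\<tau>) \<le> e powr (-\<tau>)" using e e1 tau by (intro powr_mono2') auto
    hence "e \<le> e powr (-\<tau>)" using e1 by simp
    hence low: "(\<Sum>n. rad (1 + e) n * (1 - cos (e * d n))) \<ge> c1 * e powr (- \<gamma> - 1)"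
      using c1(3)[of e e] e e1 unfolding rad_def by simp
    have r0: "rad (1 + e) n > 0" for n unfolding rad_def by simp
    have s: "1 + e > 1" using e by simp
    have sm: "summable (\<lambda>n. rad (1 + e) n * (1 - cos (e * d n)))"
    proof (rule summable_comparison_test')
      show "summable (\<lambda>n. 2 * (d n ^ 0 * rad (1 + e) n))" using s by (intro summable_mult summable_rad)
      show "norm (rad (1 + e) n * (1 - cos (e * d n))) \<le> 2 * (d n ^ 0 * rad (1 + e) n)" for n
        using r0[of n] cos_ge_minus_one[of "e * d n"] cos_le_one[of "e * d n"] by (simp add: abs_mult)
    qed
    have b1: "1 - cos y \<le> \<bar>y\<bar>" and b2: "1 - cos y \<le> y ^ 2" for y :: real
    proof -
      show "1 - cos y \<le> \<bar>y\<bar>" using abs_cos_diff_le[of 0 y] by simp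
      have "1 - cos y = 2 * (sin (y/2))\<^sup>2" using cos_double_sin[of "y/2"] by simp
      also have "\<dots> \<le> 2 * (y/2)\<^sup>2" using abs_sin_x_le_abs_x[of "y/2"] by (intro mult_left_mono) (auto simp: abs_le_square_iff[symmetric])
      also have "\<dots> \<le> y ^ 2" by (simp add: power_divide)
      finally show "1 - cos y \<le> y ^ 2" .
    qed
    have "(\<Sum>n. rad (1 + e) n * (1 - cos (e * d n))) \<le> (\<Sum>n. e * (d n ^ 1 * rad (1 + e) n))"
    proof (intro suminf_le sm summable_mult summable_rad s)
      fix n show "rad (1 + e) n * (1 - cos (e * d n)) \<le> e * (d n ^ 1 * rad (1 + e) n)"
        using mult_left_mono[OF b1[of "e * d n"], of "rad (1 + e) n"] r0[of n] d_pos[of n] e by (simp add: abs_mult mult_ac)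
    qed
    also have "\<dots> = e * (\<Sum>n. d n ^ 1 * rad (1 + e) n)" using s by (intro suminf_mult summable_rad)
    finally have "c1 * e powr (- \<gamma> - 1) \<le> e * (\<Sum>n. d n * rad (1 + e) n)" using low by simp
    moreover have "e powr (- \<gamma> - 1) = e * e powr (- \<gamma> - 2)" 
    proof -
      have "e * e powr (- \<gamma> - 2) = e powr (1 + (- \<gamma> - 2))" using e by (intro powr_mult_base) auto
      moreover have "1 + (- \<gamma> - 2) = - \<gamma> - 1" by simp
      ultimately show ?thesis by (simp only:)
    qed
    ultimately have A: "c1 * e powr (- \<gamma> - 2) \<le> (\<Sum>n. d n * rad (1 + e) n)" using e by (simp add: mult.left_commute)
    have "(\<Sum>n. rad (1 + e) n * (1 - cos (e * d n))) \<le> (\<Sum>n. e ^ 2 * (d n ^ 2 * rad (1 + e) n))"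
    proof (intro suminf_le sm summable_mult summable_rad s)
      fix n show "rad (1 + e) n * (1 - cos (e * d n)) \<le> e ^ 2 * (d n ^ 2 * rad (1 + e) n)"
        using mult_left_mono[OF b2[of "e * d n"], of "rad (1 + e) n"] r0[of n] by (simp add: power_mult_distrib mult_ac)
    qed
    also have "\<dots> = e ^ 2 * (\<Sum>n. d n ^ 2 * rad (1 + e) n)" using s by (intro suminf_mult summable_rad)
    finally have "c1 * e powr (- \<gamma> - 1) \<le> e ^ 2 * (\<Sum>n. d n ^ 2 * rad (1 + e) n)" using low by simp
    moreover have "e powr (- \<gamma> - 1) = e ^ 2 * e powr (- \<gamma> - 3)"
    proof -
      have "e ^ 2 = e powr 2" using e by simp
      hence "e ^ 2 * e powr (- \<gamma> - 3) = e powr (2 + (- \<gamma> - 3))" by (simp only: powr_add)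
      moreover have "2 + (- \<gamma> - 3) = - \<gamma> - 1" by simp
      ultimately show ?thesis by (simp only:)
    qed
    ultimately have "c1 * e powr (- \<gamma> - 3) \<le> (\<Sum>n. d n ^ 2 * rad (1 + e) n)" using e by (simp add: mult.left_commute)
    thus ?thesis using A by simp
  qed
  have "e0 > 0" unfolding e0_def using c1 by simp
  thus ?thesis using main c1(1) by blast
qed

lemma mean_lower: "\<exists>c>0. \<exists>e0>0. \<forall>e. 0 < e \<and> e < e0 \<longrightarrow> mean (1 + e) \<ge> c * e powr (- \<gamma> - 2)"
proof -
  obtain c e0 where c: "c > 0" "e0 > 0" "\<And>e. 0 < e \<Longrightarrow> e < e0 \<Longrightarrow> (\<Sum>n. d n * rad (1 + e) n) \<ge> c * e powr (- \<gamma> - 2)"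
    using weighted_sums_lower by blast
  have "mean (1 + e) \<ge> c / k * e powr (- \<gamma> - 2)" if e: "0 < e" "e < e0" for e
  proof -
    have s: "1 + e > 1" using e by simp
    have sr: "summable (\<lambda>n. d n * rad (1 + e) n)" using summable_rad[OF s, of 1] by simp
    have "c / k * e powr (- \<gamma> - 2) \<le> (1 / k) * (\<Sum>n. d n * rad (1 + e) n)" using c(3)[OF e] by (simp add: divide_right_mono)
    also have "\<dots> = (\<Sum>n. (1 / k) * (d n * rad (1 + e) n))" using sr by (rule suminf_mult[symmetric])
    also have "\<dots> \<le> mean (1 + e)" unfolding mean_def
      by (intro suminf_le summable_mean s summable_mult sr mean_term_bounds(3))
    finally show ?thesis .
  qed
  moreover have "c / k > 0" using c k2 by simp
  ultimately show ?thesis using c(2) by blast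
qed

lemma mean_upper: "\<exists>C>0. \<forall>e. 0 < e \<and> e \<le> 1 \<longrightarrow> mean (1 + e) \<le> C * e powr (- \<gamma> - 2)"
proof -
  obtain C where C: "C > 0" "\<And>e. 0 < e \<and> e \<le> 1 \<Longrightarrow> (\<Sum>n. d n ^ 1 * exp (- d n * (1 + e))) \<le> C * e powr (- \<gamma> - 1 - real 1)"
    using moment_sum_upper[of 1] by auto
  have ex: "- \<gamma> - 1 - real 1 = - \<gamma> - 2" by simp
  have "mean (1 + e) \<le> (real k ^ 2 * C) * e powr (- \<gamma> - 2)" if e: "0 < e \<and> e \<le> 1" for e
  proof -
    have s: "1 + e > 1" using e by simp
    have sr: "summable (\<lambda>n. d n * rad (1 + e) n)" using summable_rad[OF s, of 1] by simp
    have "mean (1 + e) \<le> (\<Sum>n. real k ^ 2 * (d n * rad (1 + e) n))"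
      unfolding mean_def by (intro suminf_le summable_mean s summable_mult sr mean_term_bounds(2))
    also have "\<dots> = real k ^ 2 * (\<Sum>n. d n * rad (1 + e) n)" using sr by (rule suminf_mult)
    also have "\<dots> \<le> real k ^ 2 * (C * e powr (- \<gamma> - 2))" using C(2)[OF e, unfolded ex] unfolding rad_def by (intro mult_left_mono) auto
    finally show ?thesis by simp
  qed
  moreover have "real k ^ 2 * C > 0" using C k2 by simp
  ultimately show ?thesis by blast
qed

lemma var_lower: "\<exists>c>0. \<exists>e0>0. \<forall>e. 0 < e \<and> e < e0 \<longrightarrow> var (1 + e) \<ge> c * e powr (- \<gamma> - 3)"
proof -
  obtain c e0 where c: "c > 0" "e0 > 0" "\<And>e. 0 < e \<Longrightarrow> e < e0 \<Longrightarrow> (\<Sum>n. d n ^ 2 * rad (1 + e) n) \<ge> c * e powr (- \<gamma> - 3)"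
    using weighted_sums_lower by blast
  have "var (1 + e) \<ge> c / (2 * k) * e powr (- \<gamma> - 3)" if e: "0 < e" "e < e0" for e
  proof -
    have s: "1 + e > 1" using e by simp
    have "c / (2 * k) * e powr (- \<gamma> - 3) \<le> (1 / (2 * k)) * (\<Sum>n. d n ^ 2 * rad (1 + e) n)" using c(3)[OF e] by (simp add: divide_right_mono)
    also have "\<dots> = (\<Sum>n. (1 / (2 * k)) * (d n ^ 2 * rad (1 + e) n))" using summable_rad[OF s, of 2] by (rule suminf_mult[symmetric])
    also have "\<dots> \<le> var (1 + e)" unfolding var_def
      by (intro suminf_le summable_moment_term s summable_mult summable_rad var_term_ge) auto
    finally show ?thesis .
  qed
  moreover have "c / (2 * k) > 0" using c k2 by simp
  ultimately show ?thesis using c(2) by blast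
qed

lemma third_upper: "\<exists>C>0. \<forall>e. 0 < e \<and> e \<le> 1 \<longrightarrow> \<bar>third (1 + e)\<bar> \<le> C * e powr (- \<gamma> - 4)"
proof -
  obtain C where C: "C > 0" "\<And>e. 0 < e \<and> e \<le> 1 \<Longrightarrow> (\<Sum>n. d n ^ 3 * exp (- d n * (1 + e))) \<le> C * e powr (- \<gamma> - 1 - real 3)"
    using moment_sum_upper[of 3] by auto
  have ex: "- \<gamma> - 1 - real 3 = - \<gamma> - 4" by simp
  have "\<bar>third (1 + e)\<bar> \<le> (2 * real k ^ (3 + 1) * C) * e powr (- \<gamma> - 4)" if e: "0 < e \<and> e \<le> 1" for e
  proof -
    have s: "1 + e > 1" using e by simp
    have sr: "summable (\<lambda>n. d n ^ 3 * rad (1 + e) n)" using summable_rad[OF s, of 3] by simp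
    have "\<bar>third (1 + e)\<bar> \<le> (\<Sum>n. 2 * real k ^ (3 + 1) * (d n ^ 3 * rad (1 + e) n))"
    proof -
      have b: "\<bar>d n ^ 3 * tg_moment k (rad (1 + e) n) 3\<bar> \<le> 2 * real k ^ (3 + 1) * (d n ^ 3 * rad (1 + e) n)" for n
        by (intro moment_term_bound s) auto
      have sb: "summable (\<lambda>n. 2 * real k ^ (3 + 1) * (d n ^ 3 * rad (1 + e) n))" using sr by (rule summable_mult)
      have sa: "summable (\<lambda>n. \<bar>d n ^ 3 * tg_moment k (rad (1 + e) n) 3\<bar>)"
        by (rule summable_comparison_test'[OF sb]) (use b in simp)
      have "\<bar>third (1 + e)\<bar> \<le> (\<Sum>n. \<bar>d n ^ 3 * tg_moment k (rad (1 + e) n) 3\<bar>)"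
        unfolding third_def by (rule summable_rabs[OF sa])
      also have "\<dots> \<le> (\<Sum>n. 2 * real k ^ (3 + 1) * (d n ^ 3 * rad (1 + e) n))"
        by (rule suminf_le[OF b sa sb])
      finally show ?thesis .
    qed
    also have "\<dots> = 2 * real k ^ (3 + 1) * (\<Sum>n. d n ^ 3 * rad (1 + e) n)" using sr by (rule suminf_mult)
    also have "\<dots> \<le> 2 * real k ^ (3 + 1) * (C * e powr (- \<gamma> - 4))" using C(2)[OF e, unfolded ex] unfolding rad_def by (intro mult_left_mono) auto
    finally show ?thesis by simp
  qed
  moreover have "2 * real k ^ (3 + 1) * C > 0" using C k2 by simp
  ultimately show ?thesis by blast
qed

lemma exists_mean_ge: "\<exists>s>1. mean s > x"
proof -
  obtain c e0 where c: "c > 0" "e0 > 0" "\<And>e. 0 < e \<Longrightarrow> e < e0 \<Longrightarrow> mean (1 + e) \<ge> c * e powr (- \<gamma> - 2)"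
    using mean_lower by blast
  \<comment> \<open>For e \<le> 1 the lower bound for the mean is at least c / e, as \<gamma> > -1;
    the last argument of the minimum makes c / e exceed x.\<close>
  define e where "e = min (min (e0 / 2) 1) (c / (\<bar>x\<bar> + 1))"
  have e: "e > 0" "e < e0" "e \<le> 1" "e \<le> c / (\<bar>x\<bar> + 1)"
  proof -
    have "c / (\<bar>x\<bar> + 1) > 0" using c by (intro divide_pos_pos) auto
    thus "e > 0" unfolding e_def using c by simp
    have "e \<le> e0 / 2" unfolding e_def by (meson min.cobounded1 order_trans)
    thus "e < e0" using c by simp
  qed (simp_all add: e_def)
  have "e * (\<bar>x\<bar> + 1) \<le> c" using e(4) by (simp add: pos_le_divide_eq)
  moreover have "e * x < e * (\<bar>x\<bar> + 1)" using e(1) by (intro mult_strict_left_mono) auto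
  ultimately have "e * x < c" by linarith
  hence "x < c * (1 / e)" using e(1) by (simp add: pos_less_divide_eq mult.commute)
  also have "1 / e = e powr (- 1)" using e by (simp add: powr_minus_divide)
  also have "c * e powr (- 1) \<le> c * e powr (- \<gamma> - 2)"
    using e c gamma_gt by (intro mult_left_mono powr_mono') auto
  also have "\<dots> \<le> mean (1 + e)" using c(3) e by simp
  finally show ?thesis using e by (intro exI[of _ "1 + e"]) auto
qed

text \<open>If the mean stayed above x, \<open>ln_zeta\<close> would decrease at least at the rate x
  and become negative, although zeta is at least 1.\<close>

lemma exists_mean_le:
  assumes x: "x > 0" shows "\<exists>s>1. mean s < x"
proof (rule ccontr)
  assume "\<not> (\<exists>s>1. mean s < x)"
  hence ge: "mean s \<ge> x" if "s > 1" for s using that by force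
  \<comment> \<open>Chosen so that a slope of at most - x on [2, u] would lower
    \<open>ln_zeta\<close> by its value at 2 plus 1.\<close>
  define u where "u = 2 + (ln_zeta deg k 2 + 1) / x"
  have z: "ln_zeta deg k s \<ge> 0" if "s > 1" for s unfolding ln_zeta_def using zeta_real_ge_1[OF that] by simp
  have u: "u > 2" unfolding u_def using z[of 2] x by simp
  obtain v where v: "2 < v" "v < u" "ln_zeta deg k u - ln_zeta deg k 2 = (u - 2) * - mean v"
    using MVT2[OF u, of "ln_zeta deg k" "\<lambda>s. - mean s"] DERIV_ln_zeta by auto
  have "(u - 2) * x \<le> (u - 2) * mean v" using ge[of v] v u by (intro mult_left_mono) auto
  moreover have "(u - 2) * x = ln_zeta deg k 2 + 1" unfolding u_def using x by simp
  ultimately show False using v(3) z[of u] u by simp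
qed

text \<open>Existence is the intermediate value theorem for \<open>mean\<close>; uniqueness comes
  from the positivity of its negative derivative, the variance.\<close>

lemma saddle_exists_unique:
  assumes x: "x > 0" shows "\<exists>!s. saddle_eq deg k x s"
proof -
  have iff: "saddle_eq deg k x s \<longleftrightarrow> s > 1 \<and> mean s = x" for s
    unfolding saddle_eq_def using deriv_ln_zeta[of s] by auto
  obtain a where a: "a > 1" "mean a > x" using exists_mean_ge by blast
  obtain b where b: "b > 1" "mean b < x" using exists_mean_le[OF x] by blast
  have ab: "a \<le> b" using mean_strict_antimono[OF b(1), of a] a b by (cases "a \<le> b") auto
  have "\<exists>s\<ge>a. s \<le> b \<and> mean s = x"
  proof (rule IVT2)
    show "\<forall>s. a \<le> s \<and> s \<le> b \<longrightarrow> isCont mean s" using DERIV_isCont[OF DERIV_mean] a by auto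
  qed (use a b ab in auto)
  then obtain s where "a \<le> s" and "mean s = x" by blast
  hence s: "s > 1" "mean s = x" using a(1) by linarith+
  show ?thesis
  proof (rule ex1I[of _ s])
    show "saddle_eq deg k x s" unfolding iff using s by simp
    fix u assume "saddle_eq deg k x u"
    hence u: "u > 1" "mean u = x" unfolding iff by auto
    show "u = s" using mean_strict_antimono[of s u] mean_strict_antimono[of u s] s u by (cases u s rule: linorder_cases) auto
  qed
qed

end

section \<open>The characteristic function of the tilted measure\<close>

lemma real_variable_pmf: "real_variable (measure_pmf q) f"
  by unfold_locales simp

context power_free_saddle
begin

definition phi :: "real \<Rightarrow> real \<Rightarrow> complex" where
  "phi s t = real_variable.cf (measure_pmf (tilted s)) (\<lambda>a. deg a - mean s) t"

text \<open>The complex Euler product is divided by the real one, and the partial sums of the mean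
  are removed as a phase. By \<open>local_factor\<close> what is left is exactly the product of the
  local characteristic functions.\<close>

lemma phi_product:
  assumes s: "s > 1"
  shows "(\<lambda>N. \<Prod>n<N. tg_char k (rad s n) (t * d n)) \<longlonglongrightarrow> phi s t"
proof -
  define Z where "Z = zeta_real deg k s"
  have Z: "Z \<ge> 1" unfolding Z_def by (rule zeta_real_ge_1[OF s])
  have phi: "phi s t = (zeta deg k (Complex s (- t)) / of_real Z) * iexp (- t * mean s)"
    unfolding phi_def real_variable.cf_def[OF real_variable_pmf] tilted_char[OF s] Z_def by simp
  have norm_pos: "tg_norm k (rad s n) > 0" for n
    using truncated_geometric.norm_ge1[OF truncated_geometric_rad[OF s, of n]] by simp
  have factor: "(\<Sum>j<k. exp (- complex_of_real (d n) * Complex s (- t)) ^ j) =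
      of_real (tg_norm k (rad s n)) * iexp (t * (d n * tg_mean k (rad s n))) * tg_char k (rad s n) (t * d n)" for n
  proof -
    interpret truncated_geometric k "rad s n" by (rule truncated_geometric_rad[OF s])
    have "exp (- complex_of_real (d n) * Complex s (- t)) = of_real (rad s n) * iexp (t * d n)"
    proof -
      have "- complex_of_real (d n) * Complex s (- t) = of_real (- d n * s) + \<i> * of_real (t * d n)"
        by (simp add: complex_eq_iff)
      thus ?thesis unfolding rad_def by (simp only: exp_add exp_of_real)
    qed
    thus ?thesis using local_factor[of "t * d n"] by (simp only: mult.assoc)
  qed
  have prod: "(\<Prod>n<N. \<Sum>j<k. exp (- complex_of_real (d n) * Complex s (- t)) ^ j) =
     of_real (\<Prod>n<N. tg_norm k (rad s n)) * iexp (t * (\<Sum>n<N. d n * tg_mean k (rad s n))) * (\<Prod>n<N. tg_char k (rad s n) (t * d n))" for N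
  proof -
    have "iexp (t * (\<Sum>n<N. d n * tg_mean k (rad s n))) = (\<Prod>n<N. iexp (t * (d n * tg_mean k (rad s n))))"
      by (simp add: exp_sum[symmetric] sum_distrib_left)
    thus ?thesis unfolding factor by (simp only: prod.distrib of_real_prod)
  qed
  have l1: "(\<lambda>N. \<Prod>n<N. \<Sum>j<k. exp (- complex_of_real (d n) * Complex s (- t)) ^ j) \<longlonglongrightarrow> zeta deg k (Complex s (- t))"
    using s by (intro euler_product) simp
  have l2: "(\<lambda>N. complex_of_real (\<Prod>n<N. tg_norm k (rad s n))) \<longlonglongrightarrow> of_real Z"
    unfolding Z_def by (intro tendsto_of_real real_euler_product s)
  have l3: "(\<lambda>N. iexp (- t * (\<Sum>n<N. d n * tg_mean k (rad s n)))) \<longlonglongrightarrow> iexp (- t * mean s)"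
    unfolding mean_def
    by (intro tendsto_exp tendsto_mult tendsto_const tendsto_of_real summable_LIMSEQ summable_mean s)
  have "(\<lambda>N. (\<Prod>n<N. \<Sum>j<k. exp (- complex_of_real (d n) * Complex s (- t)) ^ j) / of_real (\<Prod>n<N. tg_norm k (rad s n)) *
      iexp (- t * (\<Sum>n<N. d n * tg_mean k (rad s n)))) \<longlonglongrightarrow> phi s t"
    unfolding phi using Z by (intro tendsto_mult tendsto_divide l1 l2 l3) auto
  moreover have "(\<Prod>n<N. \<Sum>j<k. exp (- complex_of_real (d n) * Complex s (- t)) ^ j) / of_real (\<Prod>n<N. tg_norm k (rad s n)) *
      iexp (- t * (\<Sum>n<N. d n * tg_mean k (rad s n))) = (\<Prod>n<N. tg_char k (rad s n) (t * d n))" for N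
  proof -
    define S where "S = (\<Sum>n<N. d n * tg_mean k (rad s n))"
    define p where "p = (\<Prod>n<N. tg_norm k (rad s n))"
    have "p > 0" unfolding p_def using norm_pos by (intro prod_pos) auto
    moreover have "iexp (t * S) * iexp (- t * S) = 1" by (simp add: exp_add[symmetric])
    ultimately show ?thesis unfolding prod S_def[symmetric] p_def[symmetric] by simp
  qed
  ultimately show ?thesis by (simp only:)
qed

text \<open>The local bounds \<open>norm_char_le\<close> multiply to an exponential of the sum that
  \<open>cosine_sum_lower\<close> estimates.\<close>

lemma norm_phi_le:
  assumes s: "s > 1"
  shows "norm (phi s t) \<le> exp (- (1 / k ^ 2) * (\<Sum>n. rad s n * (1 - cos (t * d n))))"
proof -
  have sm: "summable (\<lambda>n. rad s n * (1 - cos (t * d n)))"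
  proof (rule summable_comparison_test')
    show "summable (\<lambda>n. 2 * (d n ^ 0 * rad s n))" using s by (intro summable_mult summable_rad)
    show "norm (rad s n * (1 - cos (t * d n))) \<le> 2 * (d n ^ 0 * rad s n)" for n
      using cos_ge_minus_one[of "t * d n"] cos_le_one[of "t * d n"] by (simp add: abs_mult rad_def)
  qed
  have bound: "norm (\<Prod>n<N. tg_char k (rad s n) (t * d n)) \<le> exp (- (1 / k ^ 2) * (\<Sum>n<N. rad s n * (1 - cos (t * d n))))" for N
  proof -
    have "norm (\<Prod>n<N. tg_char k (rad s n) (t * d n)) = (\<Prod>n<N. norm (tg_char k (rad s n) (t * d n)))" by (rule prod_norm[symmetric])
    also have "\<dots> \<le> (\<Prod>n<N. exp (- (1 / k ^ 2) * (rad s n * (1 - cos (t * d n)))))"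
      using truncated_geometric.norm_char_le[OF truncated_geometric_rad[OF s]] by (intro prod_mono) auto
    also have "\<dots> = exp (- (1 / k ^ 2) * (\<Sum>n<N. rad s n * (1 - cos (t * d n))))"
      unfolding sum_distrib_left by (rule exp_sum[symmetric]) simp
    finally show ?thesis .
  qed
  have lim: "(\<lambda>N. exp (- (1 / k ^ 2) * (\<Sum>n<N. rad s n * (1 - cos (t * d n))))) \<longlonglongrightarrow>
     exp (- (1 / k ^ 2) * (\<Sum>n. rad s n * (1 - cos (t * d n))))"
    by (intro tendsto_exp tendsto_mult tendsto_const summable_LIMSEQ sm)
  have "(\<lambda>N. norm (\<Prod>n<N. tg_char k (rad s n) (t * d n))) \<longlonglongrightarrow> norm (phi s t)"
    by (intro tendsto_norm phi_product s)
  thus ?thesis by (rule LIMSEQ_le[OF _ lim]) (use bound in blast)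
qed

text \<open>Local logarithms add up to variance, third moment and a remainder summed by the fourth
  powers of the degrees. Only the exponential of the sum is used, so the choice of branch in
  \<open>Ln\<close> has no effect.\<close>

lemma phi_expansion:
  assumes s: "s > 1" and t: "4 * real k ^ 3 * t ^ 2 \<le> 1"
  shows "\<exists>R. phi s t = exp (of_real (- (var s * t\<^sup>2 / 2)) - \<i> * of_real (third s * t ^ 3 / 6) + R)
      \<and> norm R \<le> 3 * real k ^ 6 * (\<Sum>n. d n ^ 4 * rad s n) * t ^ 4"
proof -
  define L where "L = (\<lambda>n. Ln (tg_char k (rad s n) (t * d n)))"
  define v where "v = (\<lambda>n. d n ^ 2 * tg_moment k (rad s n) 2)"
  define z where "z = (\<lambda>n. d n ^ 3 * tg_moment k (rad s n) 3)"
  define R where "R = (\<lambda>n. L n + of_real (v n * (t\<^sup>2 / 2)) + \<i> * of_real (z n * (t ^ 3 / 6)))"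
  \<comment> \<open>One bound on t serves all primes at once, because d^2 exp (- d s) \<le> 2 for
    every d > 0.\<close>
  have small: "real k ^ 3 * rad s n * (t * d n) ^ 2 \<le> 1/2" for n
  proof -
    have "d n ^ 2 / 2 \<le> exp (d n)" using exp_lower_Taylor_quadratic[of "d n"] d_pos[of n] by simp
    also have "\<dots> \<le> exp (d n * s)" using s d_pos[of n] by simp
    finally have "d n ^ 2 * rad s n \<le> 2" unfolding rad_def by (simp add: exp_minus field_simps)
    hence "real k ^ 3 * t ^ 2 * (d n ^ 2 * rad s n) \<le> real k ^ 3 * t ^ 2 * 2" by (intro mult_left_mono) auto
    thus ?thesis using t by (simp add: power_mult_distrib mult_ac)
  qed
  have nz: "tg_char k (rad s n) (t * d n) \<noteq> 0" for n
    by (rule truncated_geometric.Ln_char_expansion(1)[OF truncated_geometric_rad[OF s] small])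
  have Rb: "norm (R n) \<le> 3 * real k ^ 6 * t ^ 4 * (d n ^ 4 * rad s n)" for n
  proof -
    have "norm (L n + of_real (tg_moment k (rad s n) 2 * (t * d n) ^ 2 / 2) + \<i> * of_real (tg_moment k (rad s n) 3 * (t * d n) ^ 3 / 6))
       \<le> 3 * real k ^ 6 * rad s n * (t * d n) ^ 4"
      unfolding L_def by (rule truncated_geometric.Ln_char_expansion(2)[OF truncated_geometric_rad[OF s] small])
    moreover have "tg_moment k (rad s n) 2 * (t * d n) ^ 2 / 2 = v n * (t\<^sup>2 / 2)" unfolding v_def by (simp add: power_mult_distrib)
    moreover have "tg_moment k (rad s n) 3 * (t * d n) ^ 3 / 6 = z n * (t ^ 3 / 6)" unfolding z_def by (simp add: power_mult_distrib)
    moreover have "3 * real k ^ 6 * rad s n * (t * d n) ^ 4 = 3 * real k ^ 6 * t ^ 4 * (d n ^ 4 * rad s n)" by (simp add: power_mult_distrib)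
    ultimately show ?thesis unfolding R_def by (simp only:)
  qed
  have s4: "summable (\<lambda>n. 3 * real k ^ 6 * t ^ 4 * (d n ^ 4 * rad s n))" using s by (intro summable_mult summable_rad)
  have sRn: "summable (\<lambda>n. norm (R n))" by (rule summable_comparison_test'[OF s4]) (use Rb in simp)
  hence sR: "summable R" by (rule summable_norm_cancel)
  have sv: "v sums var s" unfolding v_def var_def using s by (intro summable_sums summable_moment_term) auto
  have sz: "z sums third s" unfolding z_def third_def using s by (intro summable_sums summable_moment_term) auto
  have "(\<lambda>n. R n - of_real (v n * (t\<^sup>2 / 2)) - \<i> * of_real (z n * (t ^ 3 / 6))) sums
      (suminf R - of_real (var s * (t\<^sup>2 / 2)) - \<i> * of_real (third s * (t ^ 3 / 6)))"
    by (intro sums_diff sums_mult sums_of_real sums_mult2 sv sz summable_sums sR)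
  hence "L sums (suminf R - of_real (var s * (t\<^sup>2 / 2)) - \<i> * of_real (third s * (t ^ 3 / 6)))"
    unfolding R_def by simp
  hence "(\<lambda>N. exp (\<Sum>n<N. L n)) \<longlonglongrightarrow> exp (suminf R - of_real (var s * (t\<^sup>2 / 2)) - \<i> * of_real (third s * (t ^ 3 / 6)))"
    unfolding sums_def by (rule tendsto_exp)
  moreover have "exp (\<Sum>n<N. L n) = (\<Prod>n<N. tg_char k (rad s n) (t * d n))" for N
    unfolding L_def using nz by (simp add: exp_sum)
  ultimately have "(\<lambda>N. \<Prod>n<N. tg_char k (rad s n) (t * d n)) \<longlonglongrightarrow> exp (suminf R - of_real (var s * (t\<^sup>2 / 2)) - \<i> * of_real (third s * (t ^ 3 / 6)))"
    by (simp only:)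
  hence "phi s t = exp (suminf R - of_real (var s * (t\<^sup>2 / 2)) - \<i> * of_real (third s * (t ^ 3 / 6)))"
    by (rule LIMSEQ_unique[OF phi_product[OF s]])
  also have "suminf R - of_real (var s * (t\<^sup>2 / 2)) - \<i> * of_real (third s * (t ^ 3 / 6)) =
      of_real (- (var s * t\<^sup>2 / 2)) - \<i> * of_real (third s * t ^ 3 / 6) + suminf R" by simp
  finally have "phi s t = exp (of_real (- (var s * t\<^sup>2 / 2)) - \<i> * of_real (third s * t ^ 3 / 6) + suminf R)" .
  moreover have "norm (suminf R) \<le> 3 * real k ^ 6 * (\<Sum>n. d n ^ 4 * rad s n) * t ^ 4"
  proof -
    have "norm (suminf R) \<le> (\<Sum>n. norm (R n))" by (rule summable_norm[OF sRn])
    also have "\<dots> \<le> (\<Sum>n. 3 * real k ^ 6 * t ^ 4 * (d n ^ 4 * rad s n))" by (rule suminf_le[OF Rb sRn s4])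
    also have "\<dots> = 3 * real k ^ 6 * t ^ 4 * (\<Sum>n. d n ^ 4 * rad s n)" using s by (intro suminf_mult summable_rad)
    finally show ?thesis by (simp add: mult_ac)
  qed
  ultimately show ?thesis by blast
qed

end

section \<open>The local limit estimate\<close>

text \<open>Bookkeeping in a small parameter v: every factor in \<open>up\<close> and
  \<open>lo\<close> is 1 + O(v). The tail \<open>tl\<close> is bounded twice, since it multiplies A
  in \<open>up\<close> but is added in \<open>lo\<close>, where it must be small against c.\<close>

lemma sandwich_ratio:
  fixes A c s v H D tl :: real
  assumes v: "0 \<le> v" "4 * v \<le> 1" and c: "c > 0" and s: "1 \<le> s" "s \<le> 1 + v" and A: "A \<ge> 0"
    and H: "H \<ge> 0" and D: "D \<ge> 0" "D * v \<le> 1/2" and tl: "tl \<le> D * v" "tl \<le> D * v * c"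
    and up: "A * (1 - tl) \<le> exp (2 * s * v) * (c / s + 7 * (c * (H * v)))"
    and lo: "c / s - 7 * (c * (H * v)) \<le> exp (2 * s * v) * A + tl"
  shows "\<bar>A / c - 1\<bar> \<le> 9 * (1 + 7 * H) * (1 + 2 * D) * v"
proof -
  define a where "a = A / c"
  have Aa: "A = a * c" unfolding a_def using c by simp
  have a0: "a \<ge> 0" unfolding a_def using A c by simp
  have v1: "v \<le> 1" using v by simp
  have e: "exp (2 * s * v) \<le> 1 + 8 * v"
  proof -
    have "2 * s * v \<le> 4 * v" using s v by (intro mult_right_mono) auto
    hence "exp (2 * s * v) \<le> exp (4 * v)" by simp
    also have "\<dots> \<le> 1 + 4 * v + (4 * v)\<^sup>2" using v by (intro exp_bound) auto
    also have "(4 * v)\<^sup>2 \<le> (4 * v) * 1" unfolding power2_eq_square using v by (intro mult_left_mono) auto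
    finally show ?thesis by simp
  qed
  \<comment> \<open>Since v^2 \<le> v, multiplying two such factors multiplies 1 plus their
    coefficients; this is the origin of (1 + 8) (1 + 7 H) (1 + 2 D) in the conclusion.\<close>
  have mono: "(1 + p * v) * (1 + q * v) \<le> 1 + ((1 + p) * (1 + q) - 1) * v" if "p \<ge> 0" "q \<ge> 0" for p q
  proof -
    have "p * q * v * v \<le> p * q * v * 1" using v v1 that by (intro mult_left_mono) auto
    thus ?thesis by (simp add: algebra_simps)
  qed
  have K: "9 * (1 + 7 * H) * (1 + 2 * D) \<ge> 9 + 7 * H + D"
  proof -
    have "9 * (1 + 7 * H) * (1 + 2 * D) = 9 + 63 * H + 18 * D + 126 * (H * D)" by (simp add: algebra_simps)
    moreover have "H * D \<ge> 0" using H D by simp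
    ultimately show ?thesis using H D by linarith
  qed
  have "a \<le> 1 + 9 * (1 + 7 * H) * (1 + 2 * D) * v"
  proof -
    have "a * (1 - D * v) \<le> a * (1 - tl)" using tl a0 by (intro mult_left_mono) auto
    also have "\<dots> \<le> exp (2 * s * v) * (1 / s + 7 * (H * v))"
    proof -
      have "c * (a * (1 - tl)) \<le> c * (exp (2 * s * v) * (1 / s + 7 * (H * v)))"
        using up unfolding Aa by (simp add: distrib_left mult_ac)
      thus ?thesis using c by simp
    qed
    also have "\<dots> \<le> (1 + 8 * v) * (1 + 7 * H * v)"
      using e s H v by (intro mult_mono) auto
    finally have "a * (1 - D * v) \<le> (1 + 8 * v) * (1 + 7 * H * v)" .
    hence "a * (1 - D * v) * (1 + 2 * D * v) \<le> (1 + 8 * v) * (1 + 7 * H * v) * (1 + 2 * D * v)"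
      using D v by (intro mult_right_mono) auto
    \<comment> \<open>Instead of dividing by 1 - D v one multiplies by 1 + 2 D v, which is at least
      its inverse because D v \<le> 1/2.\<close>
    moreover have "a * 1 \<le> a * ((1 - D * v) * (1 + 2 * D * v))"
    proof (intro mult_left_mono a0)
      have "D * v * (D * v) \<le> D * v * (1/2)" using D v by (intro mult_left_mono) auto
      thus "1 \<le> (1 - D * v) * (1 + 2 * D * v)" by (simp add: algebra_simps)
    qed
    ultimately have "a \<le> (1 + 8 * v) * (1 + 7 * H * v) * (1 + 2 * D * v)" by (simp add: mult.assoc)
    also have "\<dots> \<le> (1 + ((1 + 8) * (1 + 7 * H) - 1) * v) * (1 + 2 * D * v)"
      using mono[of 8 "7 * H"] H D v by (intro mult_right_mono) auto
    also have "\<dots> \<le> 1 + ((1 + ((1 + 8) * (1 + 7 * H) - 1)) * (1 + 2 * D) - 1) * v"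
      using H D by (intro mono) auto
    also have "\<dots> \<le> 1 + 9 * (1 + 7 * H) * (1 + 2 * D) * v" using v by (simp add: algebra_simps)
    finally show ?thesis .
  qed
  moreover have "a \<ge> 1 - (9 + 7 * H + D) * v"
  proof -
    define X where "X = 1 + 7 * H + D"
    have X: "X \<ge> 0" unfolding X_def using H D by simp
    have "1 - v \<le> 1 / s"
    proof -
      have "(1 - v) * s \<le> (1 - v) * (1 + v)" using s v1 by (intro mult_left_mono) auto
      also have "\<dots> \<le> 1" using v by (simp add: algebra_simps)
      finally show ?thesis using s by (simp add: pos_le_divide_eq)
    qed
    moreover have "1 / s - 7 * (H * v) - D * v \<le> exp (2 * s * v) * a"
    proof -
      have "c / s - 7 * (c * (H * v)) - D * v * c \<le> exp (2 * s * v) * (a * c)" using lo tl unfolding Aa by linarith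
      hence "c * (1 / s - 7 * (H * v) - D * v) \<le> c * (exp (2 * s * v) * a)" by (simp add: algebra_simps)
      thus ?thesis using c by simp
    qed
    moreover have "exp (2 * s * v) * a \<le> (1 + 8 * v) * a" using e a0 by (intro mult_right_mono)
    moreover have "X * v = v + 7 * (H * v) + D * v" unfolding X_def by (simp add: algebra_simps)
    ultimately have "1 - X * v \<le> (1 + 8 * v) * a" by linarith
    moreover have "(1 + 8 * v) * (1 - (X + 8) * v) \<le> 1 - X * v"
    proof -
      have "(1 + 8 * v) * (1 - (X + 8) * v) = 1 - X * v - 8 * ((X + 8) * (v * v))" by (simp add: algebra_simps)
      moreover have "(X + 8) * (v * v) \<ge> 0" using X by simp
      ultimately show ?thesis by linarith
    qed
    ultimately have "(1 + 8 * v) * (1 - (X + 8) * v) \<le> (1 + 8 * v) * a" by linarith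
    moreover have "1 + 8 * v > 0" using v by simp
    ultimately have "1 - (X + 8) * v \<le> a" by (simp only: mult_le_cancel_left_pos)
    thus ?thesis unfolding X_def by (simp add: algebra_simps)
  qed
  moreover have "(9 + 7 * H + D) * v \<le> 9 * (1 + 7 * H) * (1 + 2 * D) * v" using K v by (intro mult_right_mono) auto
  ultimately show ?thesis unfolding a_def[symmetric] by (simp add: abs_le_iff)
qed

context power_free_saddle
begin

lemma var_upper: "\<exists>C>0. \<forall>e. 0 < e \<and> e \<le> 1 \<longrightarrow> var (1 + e) \<le> C * e powr (- \<gamma> - 3)"
proof -
  obtain C where C: "C > 0" "\<And>e. 0 < e \<and> e \<le> 1 \<Longrightarrow> (\<Sum>n. d n ^ 2 * exp (- d n * (1 + e))) \<le> C * e powr (- \<gamma> - 1 - real 2)"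
    using moment_sum_upper[of 2] by auto
  have ex: "- \<gamma> - 1 - real 2 = - \<gamma> - 3" by simp
  have "var (1 + e) \<le> (2 * real k ^ (2 + 1) * C) * e powr (- \<gamma> - 3)" if e: "0 < e \<and> e \<le> 1" for e
  proof -
    have s: "1 + e > 1" using e by simp
    have sr: "summable (\<lambda>n. d n ^ 2 * rad (1 + e) n)" using summable_rad[OF s, of 2] by simp
    have "d n ^ 2 * tg_moment k (rad (1 + e) n) 2 \<le> 2 * real k ^ (2 + 1) * (d n ^ 2 * rad (1 + e) n)" for n
      using moment_term_bound[OF s, of 2 n] by simp
    hence "var (1 + e) \<le> (\<Sum>n. 2 * real k ^ (2 + 1) * (d n ^ 2 * rad (1 + e) n))"
      unfolding var_def using s by (intro suminf_le summable_moment_term summable_mult sr) auto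
    also have "\<dots> = 2 * real k ^ (2 + 1) * (\<Sum>n. d n ^ 2 * rad (1 + e) n)" using sr by (rule suminf_mult)
    also have "\<dots> \<le> 2 * real k ^ (2 + 1) * (C * e powr (- \<gamma> - 3))" using C(2)[OF e, unfolded ex] unfolding rad_def by (intro mult_left_mono) auto
    finally show ?thesis by simp
  qed
  moreover have "2 * real k ^ (2 + 1) * C > 0" using C k2 by simp
  ultimately show ?thesis by blast
qed

text \<open>With \<open>s = 1 + e\<close>, the bump of the characteristic function at \<open>0\<close> has width \<open>e\<close>; the smoothing
  scale \<open>e powr \<tau>1\<close> and the cut-off \<open>e powr (- \<tau>2)\<close> are chosen with \<open>\<tau> < \<tau>1 < \<tau>2 < \<delta>\<close>, so that all tails
  are smaller than every power of \<open>e\<close>.\<close>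

lemma smooth_density_estimate:
  assumes tau: "0 < \<tau>" "\<tau> < \<tau>1" "\<tau>1 < \<tau>2" "\<tau>2 < \<delta>" "\<tau> \<le> 1 + \<gamma>"
  shows "\<exists>H\<ge>0. \<exists>e0>0. \<forall>e. 0 < e \<and> e < e0 \<longrightarrow> (\<forall>y.
     \<bar>real_variable.smooth_density (measure_pmf (tilted (1 + e))) (\<lambda>a. deg a - mean (1 + e)) (e powr \<tau>1) y
        * sqrt (2 * pi * var (1 + e)) - 1\<bar> \<le> H * e powr \<tau> * (1 + y\<^sup>2))"
proof -
  obtain cB e1 where cB: "cB > 0" "e1 > 0" "\<And>e. 0 < e \<Longrightarrow> e < e1 \<Longrightarrow> var (1 + e) \<ge> cB * e powr (- \<gamma> - 3)"
    using var_lower by blast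
  obtain CB where CB: "CB > 0" "\<And>e. 0 < e \<Longrightarrow> e \<le> 1 \<Longrightarrow> var (1 + e) \<le> CB * e powr (- \<gamma> - 3)"
    using var_upper by blast
  obtain C3 where C3: "C3 > 0" "\<And>e. 0 < e \<Longrightarrow> e \<le> 1 \<Longrightarrow> \<bar>third (1 + e)\<bar> \<le> C3 * e powr (- \<gamma> - 4)"
    using third_upper by blast
  obtain C4' where C4': "C4' > 0" "\<And>e. 0 < e \<and> e \<le> 1 \<Longrightarrow> (\<Sum>n. d n ^ 4 * exp (- d n * (1 + e))) \<le> C4' * e powr (- \<gamma> - 1 - real 4)"
    using moment_sum_upper[of 4] by auto
  have ex4: "- \<gamma> - 1 - real 4 = - \<gamma> - 5" by simp
  define C4 where "C4 = 3 * real k ^ 6 * C4'"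
  have C4: "C4 > 0" unfolding C4_def using C4' k2 by simp
  \<comment> \<open>At t0 = c0 e this gives C4 c0^2 = cB / 8, which is the condition K4 t0^2 \<le> B
    / 8 for the central range.\<close>
  define c0 where "c0 = sqrt (cB / (8 * C4))"
  have c0: "c0 > 0" "c0\<^sup>2 = cB / (8 * C4)" unfolding c0_def using cB C4 by auto
  have tau2: "0 < \<tau>2" using tau by linarith
  obtain c1 e2 where c1: "c1 > 0" "e2 > 0" "\<And>e t. 0 < e \<and> e < e2 \<and> c0 * e \<le> \<bar>t\<bar> \<and> \<bar>t\<bar> \<le> e powr (-\<tau>2) \<Longrightarrow>
     (\<Sum>n. exp (- d n * (1 + e)) * (1 - cos (t * d n))) \<ge> c1 * e powr (- \<gamma> - 1)"
    using cosine_sum_lower[OF tau2 tau(4) c0(1)] by blast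
  \<comment> \<open>The far frequencies carry the factor sqrt (2 B) / \<eta>, of order at most
    \<open>e powr (- (\<gamma> + 3) / 2 - \<tau>1)\<close>; this exponent compensates it and leaves
    \<open>e powr \<tau>\<close>.\<close>
  define N where "N = \<tau> + \<tau>1 + (\<gamma> + 3) / 2"
  have N: "N > 0"
  proof -
    have "(\<gamma> + 3) / 2 > 0" using gamma_gt by simp
    thus ?thesis unfolding N_def using tau by linarith
  qed
  have k0: "real k > 0" using k2 by simp
  obtain D1 where D1: "D1 > 0" "\<And>e. e > 0 \<Longrightarrow> exp (- (c1 / k ^ 2 * e powr (- (\<gamma> + 1)))) \<le> D1 * e powr N"
    using exp_neg_powr_le[of "c1 / k ^ 2" "\<gamma> + 1" N] c1 N gamma_gt k0 by auto
  obtain D2 where D2: "D2 > 0" "\<And>e. e > 0 \<Longrightarrow> exp (- (1/4 * e powr (- (2 * (\<tau>2 - \<tau>1))))) \<le> D2 * e powr N"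
    using exp_neg_powr_le[of "1/4" "2 * (\<tau>2 - \<tau>1)" N] N tau by auto
  define H1 where "H1 = sqrt 2 * (12 * C4 / cB\<^sup>2 + (1 + 4 / c0\<^sup>2 + 2) / cB + 10 / 3 * C3\<^sup>2 / cB ^ 3)"
  define H2 where "H2 = (D1 + D2) * sqrt (2 * CB)"
  have H: "H1 \<ge> 0" "H2 \<ge> 0" unfolding H1_def H2_def using C4 cB C3 D1 D2 CB by auto
  \<comment> \<open>cB / 4 ensures B \<ge> 4, hence \<open>\<eta>\<^sup>2\<close> \<le> B / 4; the
    last entry gives 4 k^3 t^2 \<le> 1 for |t| \<le> c0 e, as \<open>phi_expansion\<close>
    demands.\<close>
  define e0 where "e0 = min (min e1 e2) (min (min 1 (cB / 4)) (1 / (4 * real k ^ 3 * c0\<^sup>2)))"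
  have e0: "e0 > 0" unfolding e0_def using cB c1 k0 c0(1) by simp
  have main: "\<bar>real_variable.smooth_density (measure_pmf (tilted (1 + e))) (\<lambda>a. deg a - mean (1 + e)) (e powr \<tau>1) y
        * sqrt (2 * pi * var (1 + e)) - 1\<bar> \<le> (H1 + H2) * e powr \<tau> * (1 + y\<^sup>2)" if e: "0 < e" "e < e0" for e y
  proof -
    have ee: "e < e1" "e < e2" "e < 1" "e < cB / 4" "e < 1 / (4 * real k ^ 3 * c0\<^sup>2)" using e unfolding e0_def by auto
    have s: "1 + e > 1" using e by simp
    interpret rv: real_variable "measure_pmf (tilted (1 + e))" "\<lambda>a. deg a - mean (1 + e)" by (rule real_variable_pmf)
    define B where "B = var (1 + e)"
    define b where "b = e powr (- \<gamma> - 3)"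
    define K4 where "K4 = 3 * real k ^ 6 * (\<Sum>n. d n ^ 4 * rad (1 + e) n)"
    define M3 where "M3 = third (1 + e)"
    \<comment> \<open>The common order of K4 / B^2, 1 / (e^2 B) and M3^2 / B^3: the exponents are -
      \<gamma> - 5 + 2 (\<gamma> + 3), - 2 + (\<gamma> + 3) and - 2 (\<gamma> + 4) + 3 (\<gamma> +
      3).\<close>
    define w where "w = e powr (\<gamma> + 1)"
    have pw: "e powr x * e powr y = e powr (x + y)" for x y by (simp add: powr_add)
    have pwn: "e ^ n = e powr (real n)" for n using e by (simp add: powr_realpow)
    have pe: "x = y \<Longrightarrow> e powr x = e powr y" for x y by simp
    have pos: "b > 0" "w > 0" unfolding b_def w_def using e by auto
    have wle: "w \<le> e powr \<tau>" unfolding w_def using e ee tau by (intro powr_mono') auto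
    have Blo: "cB * b \<le> B" unfolding B_def b_def using cB(3) e ee by simp
    have Bup: "B \<le> CB * b" unfolding B_def b_def using CB(2) e ee by simp
    have Bpos: "B > 0" using Blo cB pos by (meson less_le_trans mult_pos_pos)
    have K4up: "K4 \<le> C4 * e powr (- \<gamma> - 5)"
    proof -
      have "(\<Sum>n. d n ^ 4 * rad (1 + e) n) \<le> C4' * e powr (- \<gamma> - 5)" using C4'(2)[of e, unfolded ex4] e ee unfolding rad_def by simp
      thus ?thesis unfolding K4_def C4_def by (simp add: mult_left_mono)
    qed
    have K40: "K4 \<ge> 0" unfolding K4_def
      by (intro mult_nonneg_nonneg suminf_nonneg summable_rad s) (auto simp: rad_def)
    have eta: "e powr \<tau>1 > 0" using e by simp
    have eta1: "(e powr \<tau>1)\<^sup>2 \<le> 1"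
    proof -
      have "e powr \<tau>1 \<le> 1" using e ee tau by (intro powr_le1) auto
      thus ?thesis using eta by (simp add: power_le_one)
    qed
    have b4: "4 \<le> cB * b"
    proof -
      have "e powr (- 1) \<le> b" unfolding b_def using e ee gamma_gt by (intro powr_mono') auto
      hence "1 / e \<le> b" using e by (simp add: powr_minus_divide)
      hence "cB * (1 / e) \<le> cB * b" using cB by (intro mult_left_mono) auto
      moreover have "4 \<le> cB * (1 / e)" using ee e by (simp add: pos_le_divide_eq)
      ultimately show ?thesis by linarith
    qed
    have eta2: "(e powr \<tau>1)\<^sup>2 \<le> B / 4" using eta1 b4 Blo by linarith
    have t0: "c0 * e > 0" using c0 e by simp
    have K4t: "K4 * (c0 * e)\<^sup>2 \<le> B / 8"
    proof -
      have "K4 * (c0 * e)\<^sup>2 \<le> (C4 * e powr (- \<gamma> - 5)) * (c0 * e)\<^sup>2" using K4up by (intro mult_right_mono) auto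
      also have "\<dots> = (C4 * c0\<^sup>2) * (e powr (- \<gamma> - 5) * e ^ 2)" by (simp add: power_mult_distrib)
      also have "e powr (- \<gamma> - 5) * e ^ 2 = b" unfolding b_def pwn pw by (rule pe) simp
      also have "C4 * c0\<^sup>2 = cB / 8" unfolding c0(2) using C4 by simp
      finally show ?thesis using Blo by simp
    qed
    define E where "E = exp (- (c1 / k ^ 2 * e powr (- (\<gamma> + 1))))"
    have near: "\<exists>R. rv.cf t = exp (of_real (- (B * t\<^sup>2 / 2)) - \<i> * of_real (M3 * t ^ 3 / 6) + R) \<and> norm R \<le> K4 * t ^ 4"
      if t: "\<bar>t\<bar> \<le> c0 * e" for t
    proof -
      have "t\<^sup>2 \<le> (c0 * e)\<^sup>2" using t t0 abs_le_square_iff[of t "c0 * e"] by simp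
      also have "\<dots> = c0\<^sup>2 * (e * e)" by (simp add: power2_eq_square)
      also have "\<dots> \<le> c0\<^sup>2 * (e * 1)" using e ee by (intro mult_left_mono) auto
      finally have "4 * real k ^ 3 * t\<^sup>2 \<le> 4 * real k ^ 3 * (c0\<^sup>2 * e)" by (intro mult_left_mono) auto
      also have "\<dots> \<le> 1" using ee(5) k0 c0(1) by (simp add: pos_less_divide_eq mult_ac)
      finally have "4 * real k ^ 3 * t\<^sup>2 \<le> 1" .
      from phi_expansion[OF s this] show ?thesis unfolding phi_def B_def M3_def K4_def .
    qed
    have far: "norm (rv.cf t) \<le> E" if t: "c0 * e \<le> \<bar>t\<bar>" "\<bar>t\<bar> \<le> e powr (- \<tau>2)" for t
    proof -
      have "norm (rv.cf t) \<le> exp (- (1 / k ^ 2) * (\<Sum>n. rad (1 + e) n * (1 - cos (t * d n))))"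
        using norm_phi_le[OF s, of t] unfolding phi_def .
      also have "\<dots> \<le> E"
      proof -
        have "c1 * e powr (- \<gamma> - 1) \<le> (\<Sum>n. rad (1 + e) n * (1 - cos (t * d n)))"
          using c1(3)[of e t] e ee t unfolding rad_def by simp
        hence "1 / k ^ 2 * (c1 * e powr (- \<gamma> - 1)) \<le> 1 / k ^ 2 * (\<Sum>n. rad (1 + e) n * (1 - cos (t * d n)))"
          by (intro mult_left_mono) auto
        moreover have "e powr (- (\<gamma> + 1)) = e powr (- \<gamma> - 1)" by (rule pe) simp
        ultimately show ?thesis unfolding E_def by simp
      qed
      finally show ?thesis .
    qed
    have bound: "\<bar>rv.smooth_density (e powr \<tau>1) y * sqrt (2 * pi * B) - 1\<bar> \<le>
       sqrt 2 * (12 * K4 / B\<^sup>2 + ((e powr \<tau>1)\<^sup>2 + 4 / (c0 * e)\<^sup>2 + 2 * y\<^sup>2) / B + 10 / 3 * M3\<^sup>2 / B ^ 3)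
       + (E + exp (- ((e powr \<tau>1)\<^sup>2 * (e powr (- \<tau>2))\<^sup>2 / 4))) * sqrt (2 * B) / e powr \<tau>1"
      by (rule rv.smooth_density_near_gaussian[OF Bpos t0 eta eta2 K40 K4t _ _ near far]) (auto simp: E_def)
    have y1: "1 + y\<^sup>2 \<ge> 1" by simp
    have q1: "12 * K4 / B\<^sup>2 \<le> 12 * C4 / cB\<^sup>2 * w * (1 + y\<^sup>2)"
    proof -
      have "12 * K4 / B\<^sup>2 \<le> 12 * (C4 * e powr (- \<gamma> - 5)) / (cB * b)\<^sup>2"
        using K4up Blo cB pos K40 by (intro frac_le mult_left_mono power_mono) auto
      also have "\<dots> = 12 * C4 / cB\<^sup>2 * (e powr (- \<gamma> - 5) / b\<^sup>2)" by (simp add: power_mult_distrib)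
      also have "e powr (- \<gamma> - 5) / b\<^sup>2 = w"
        unfolding b_def w_def power2_eq_square pw powr_diff[symmetric] by (rule pe) simp
      also have "12 * C4 / cB\<^sup>2 * w \<le> 12 * C4 / cB\<^sup>2 * w * (1 + y\<^sup>2)"
        using mult_left_mono[OF y1, of "12 * C4 / cB\<^sup>2 * w"] C4 pos by simp
      finally show ?thesis .
    qed
    have q3: "10 / 3 * M3\<^sup>2 / B ^ 3 \<le> 10 / 3 * C3\<^sup>2 / cB ^ 3 * w * (1 + y\<^sup>2)"
    proof -
      have "M3\<^sup>2 \<le> (C3 * e powr (- \<gamma> - 4))\<^sup>2"
        using C3(2)[of e] e ee abs_le_square_iff[of M3 "C3 * e powr (- \<gamma> - 4)"] C3(1) unfolding M3_def by simp
      hence "10 / 3 * M3\<^sup>2 \<le> 10 / 3 * (C3 * e powr (- \<gamma> - 4))\<^sup>2" by simp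
      moreover have "(cB * b) ^ 3 \<le> B ^ 3" using Blo cB pos by (intro power_mono) auto
      ultimately have "10 / 3 * M3\<^sup>2 / B ^ 3 \<le> 10 / 3 * (C3 * e powr (- \<gamma> - 4))\<^sup>2 / (cB * b) ^ 3"
        using cB pos by (intro frac_le) auto
      also have "\<dots> = 10 / 3 * C3\<^sup>2 / cB ^ 3 * ((e powr (- \<gamma> - 4))\<^sup>2 / b ^ 3)" by (simp add: power_mult_distrib)
      also have "(e powr (- \<gamma> - 4))\<^sup>2 / b ^ 3 = w"
        unfolding b_def w_def power2_eq_square power3_eq_cube pw powr_diff[symmetric] by (rule pe) simp
      also have "10 / 3 * C3\<^sup>2 / cB ^ 3 * w \<le> 10 / 3 * C3\<^sup>2 / cB ^ 3 * w * (1 + y\<^sup>2)"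
        using mult_left_mono[OF y1, of "10 / 3 * C3\<^sup>2 / cB ^ 3 * w"] cB pos by simp
      finally show ?thesis .
    qed
    have q2: "((e powr \<tau>1)\<^sup>2 + 4 / (c0 * e)\<^sup>2 + 2 * y\<^sup>2) / B \<le> (1 + 4 / c0\<^sup>2 + 2) / cB * w * (1 + y\<^sup>2)"
    proof -
      have ie: "1 \<le> 1 / e\<^sup>2" using e ee by (simp add: power_le_one)
      have "(e powr \<tau>1)\<^sup>2 + 4 / (c0 * e)\<^sup>2 + 2 * y\<^sup>2 \<le> (1 + 4 / c0\<^sup>2 + 2) * (1 / e\<^sup>2) * (1 + y\<^sup>2)"
      proof -
        have m: "x \<le> x * ((1 / e\<^sup>2) * (1 + y\<^sup>2))" if "x \<ge> 0" for x
          using mult_mono[OF ie y1] that mult_left_mono[of 1 "(1 / e\<^sup>2) * (1 + y\<^sup>2)" x] by simp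
        have "(e powr \<tau>1)\<^sup>2 \<le> 1 * ((1 / e\<^sup>2) * (1 + y\<^sup>2))" using eta1 m[of 1] by simp
        moreover have "4 / (c0 * e)\<^sup>2 \<le> 4 / c0\<^sup>2 * ((1 / e\<^sup>2) * (1 + y\<^sup>2))"
          using mult_left_mono[OF y1, of "4 / c0\<^sup>2 * (1 / e\<^sup>2)"] by (simp add: power_mult_distrib)
        moreover have "2 * y\<^sup>2 \<le> 2 * ((1 / e\<^sup>2) * (1 + y\<^sup>2))"
        proof -
          have "1 + y\<^sup>2 \<le> 1 / e\<^sup>2 * (1 + y\<^sup>2)" using mult_right_mono[OF ie, of "1 + y\<^sup>2"] by simp
          moreover have "2 * a \<le> 2 * z" if "1 + a \<le> z" for a z :: real using that by linarith
          ultimately show ?thesis by blast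
        qed
        moreover have "(1 + 4 / c0\<^sup>2 + 2) * (1 / e\<^sup>2) * (1 + y\<^sup>2) = 1 * ((1 / e\<^sup>2) * (1 + y\<^sup>2)) + 4 / c0\<^sup>2 * ((1 / e\<^sup>2) * (1 + y\<^sup>2)) + 2 * ((1 / e\<^sup>2) * (1 + y\<^sup>2))"
          by (simp only: mult.assoc distrib_right)
        moreover have "a1 + a2 + a3 \<le> r" if "a1 \<le> b1" "a2 \<le> b2" "a3 \<le> b3" "r = b1 + b2 + b3"
          for a1 a2 a3 b1 b2 b3 r :: real using that by linarith
        ultimately show ?thesis by blast
      qed
      hence "((e powr \<tau>1)\<^sup>2 + 4 / (c0 * e)\<^sup>2 + 2 * y\<^sup>2) / B \<le> (1 + 4 / c0\<^sup>2 + 2) * (1 / e\<^sup>2) * (1 + y\<^sup>2) / (cB * b)"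
        using Blo cB pos by (intro frac_le) auto
      also have "\<dots> = (1 + 4 / c0\<^sup>2 + 2) / cB * (1 / (e\<^sup>2 * b)) * (1 + y\<^sup>2)" by simp
      also have "1 / (e\<^sup>2 * b) = w"
      proof -
        have "e\<^sup>2 * b = e powr (- \<gamma> - 1)" unfolding b_def pwn pw by (rule pe) simp
        moreover have "w = e powr (- (- \<gamma> - 1))" unfolding w_def by (rule pe) simp
        ultimately show ?thesis by (simp only: powr_minus_divide)
      qed
      finally show ?thesis .
    qed
    have part1: "sqrt 2 * (12 * K4 / B\<^sup>2 + ((e powr \<tau>1)\<^sup>2 + 4 / (c0 * e)\<^sup>2 + 2 * y\<^sup>2) / B + 10 / 3 * M3\<^sup>2 / B ^ 3) \<le> H1 * e powr \<tau> * (1 + y\<^sup>2)"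
    proof -
      have "sqrt 2 * (12 * K4 / B\<^sup>2 + ((e powr \<tau>1)\<^sup>2 + 4 / (c0 * e)\<^sup>2 + 2 * y\<^sup>2) / B + 10 / 3 * M3\<^sup>2 / B ^ 3)
         \<le> sqrt 2 * (12 * C4 / cB\<^sup>2 * w * (1 + y\<^sup>2) + (1 + 4 / c0\<^sup>2 + 2) / cB * w * (1 + y\<^sup>2) + 10 / 3 * C3\<^sup>2 / cB ^ 3 * w * (1 + y\<^sup>2))"
        by (intro mult_left_mono add_mono q1 q2 q3) auto
      also have "\<dots> = H1 * w * (1 + y\<^sup>2)" unfolding H1_def by (simp only: distrib_right mult.assoc)
      also have "\<dots> \<le> H1 * e powr \<tau> * (1 + y\<^sup>2)" using wle H by (intro mult_right_mono mult_left_mono) auto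
      finally show ?thesis .
    qed
    have part2: "(E + exp (- ((e powr \<tau>1)\<^sup>2 * (e powr (- \<tau>2))\<^sup>2 / 4))) * sqrt (2 * B) / e powr \<tau>1 \<le> H2 * e powr \<tau> * (1 + y\<^sup>2)"
    proof -
      have "exp (- ((e powr \<tau>1)\<^sup>2 * (e powr (- \<tau>2))\<^sup>2 / 4)) \<le> D2 * e powr N"
      proof -
        have "(e powr \<tau>1)\<^sup>2 * (e powr (- \<tau>2))\<^sup>2 = e powr (- (2 * (\<tau>2 - \<tau>1)))"
          unfolding power2_eq_square pw by (rule pe) simp
        thus ?thesis using D2(2)[OF e(1)] by simp
      qed
      hence X: "E + exp (- ((e powr \<tau>1)\<^sup>2 * (e powr (- \<tau>2))\<^sup>2 / 4)) \<le> (D1 + D2) * e powr N"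
        using D1(2)[OF e(1)] unfolding E_def by (simp add: distrib_right)
      have Y: "sqrt (2 * B) \<le> sqrt (2 * CB) * e powr (- (\<gamma> + 3) / 2)"
      proof -
        have "sqrt (2 * B) \<le> sqrt (2 * CB * b)" using Bup by simp
        also have "\<dots> = sqrt (2 * CB) * sqrt b" by (rule real_sqrt_mult)
        also have "sqrt b = e powr (- (\<gamma> + 3) / 2)"
        proof -
          have "sqrt b = b powr (1/2)" using pos by (simp add: powr_half_sqrt)
          also have "\<dots> = e powr ((- \<gamma> - 3) * (1/2))" unfolding b_def by (rule powr_powr)
          also have "(- \<gamma> - 3) * (1/2) = - (\<gamma> + 3) / 2" by simp
          finally show ?thesis .
        qed
        finally show ?thesis .
      qed
      have "(E + exp (- ((e powr \<tau>1)\<^sup>2 * (e powr (- \<tau>2))\<^sup>2 / 4))) * sqrt (2 * B) / e powr \<tau>1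
         \<le> ((D1 + D2) * e powr N) * (sqrt (2 * CB) * e powr (- (\<gamma> + 3) / 2)) / e powr \<tau>1"
        using X Y D1 D2 CB Bpos by (intro divide_right_mono mult_mono) auto
      also have "\<dots> = H2 * (e powr N * e powr (- (\<gamma> + 3) / 2) / e powr \<tau>1)" unfolding H2_def by (simp only: mult_ac times_divide_eq_right)
      also have "e powr N * e powr (- (\<gamma> + 3) / 2) / e powr \<tau>1 = e powr \<tau>"
      proof -
        have "N + - (\<gamma> + 3) / 2 - \<tau>1 = \<tau>" unfolding N_def by (simp add: field_simps)
        thus ?thesis unfolding pw powr_diff[symmetric] by (simp only:)
      qed
      also have "H2 * e powr \<tau> \<le> H2 * e powr \<tau> * (1 + y\<^sup>2)"
        using mult_left_mono[OF y1, of "H2 * e powr \<tau>"] H by simp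
      finally show ?thesis .
    qed
    have "\<bar>rv.smooth_density (e powr \<tau>1) y * sqrt (2 * pi * B) - 1\<bar> \<le> H1 * e powr \<tau> * (1 + y\<^sup>2) + H2 * e powr \<tau> * (1 + y\<^sup>2)"
      using bound part1 part2 by linarith
    also have "\<dots> = (H1 + H2) * e powr \<tau> * (1 + y\<^sup>2)" by (simp only: distrib_right)
    finally show ?thesis unfolding B_def .
  qed
  moreover have "H1 + H2 \<ge> 0" using H by simp
  ultimately show ?thesis using e0 by blast
qed

end

section \<open>From the smoothed density to the counting function\<close>

context power_free_saddle
begin

lemma mean_pos: assumes s: "s > 1" shows "mean s > 0"
  unfolding mean_def
proof (rule suminf_pos[OF summable_mean[OF s]])
  fix n
  have "(1 / k) * (d n * rad s n) > 0" using d_pos[of n] k2 unfolding rad_def by simp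
  thus "0 < d n * tg_mean k (rad s n)" using mean_term_bounds(3)[OF s, of n] by linarith
qed

text \<open>The parameter is e, and x is recovered as \<open>mean (1 + e)\<close>. The quantity
  \<open>v = e powr \<tau>\<close> is both the shift in the sandwich and the target error: it
  exceeds the smoothing scale \<open>e powr \<tau>1\<close> by a negative power of e, so the tail is
  negligible, while exp (2 s v) is still 1 + O(v).\<close>

lemma saddle_ratio:
  assumes tau: "0 < \<tau>" "\<tau> < \<delta>" "\<tau> \<le> 1 + \<gamma>" "\<tau> \<le> 1"
  shows "\<exists>K. \<exists>e0>0. \<forall>e. 0 < e \<and> e < e0 \<longrightarrow>
     \<bar>real (power_free_count deg k (mean (1 + e))) / saddle_term deg k (mean (1 + e)) (1 + e) - 1\<bar> \<le> K * e powr \<tau>"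
proof -
  define \<tau>1 where "\<tau>1 = (2 * \<tau> + \<delta>) / 3"
  define \<tau>2 where "\<tau>2 = (\<tau> + 2 * \<delta>) / 3"
  have t12: "\<tau> < \<tau>1" "\<tau>1 < \<tau>2" "\<tau>2 < \<delta>" unfolding \<tau>1_def \<tau>2_def using tau by auto
  obtain H e1 where H: "H \<ge> 0" "e1 > 0" "\<And>e y. 0 < e \<Longrightarrow> e < e1 \<Longrightarrow>
     \<bar>real_variable.smooth_density (measure_pmf (tilted (1 + e))) (\<lambda>a. deg a - mean (1 + e)) (e powr \<tau>1) y
        * sqrt (2 * pi * var (1 + e)) - 1\<bar> \<le> H * e powr \<tau> * (1 + y\<^sup>2)"
    using smooth_density_estimate[OF tau(1) t12 tau(3)] by blast
  obtain CB where CB: "CB > 0" "\<And>e. 0 < e \<Longrightarrow> e \<le> 1 \<Longrightarrow> var (1 + e) \<le> CB * e powr (- \<gamma> - 3)"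
    using var_upper by blast
  \<comment> \<open>The tail must be O(v c), and c is bounded below by a multiple of
    \<open>e powr ((\<gamma> + 3) / 2)\<close>; hence the exponent beyond \<tau>.\<close>
  define N where "N = \<tau> + (\<gamma> + 3) / 2"
  have g3: "(\<gamma> + 3) / 2 > 0" using gamma_gt by simp
  have N: "N > 0" unfolding N_def using tau g3 by linarith
  obtain D3 where D3: "D3 > 0" "\<And>e. e > 0 \<Longrightarrow> exp (- (1 * e powr (- (\<tau>1 - \<tau>)))) \<le> D3 * e powr N"
    using exp_neg_powr_le[of 1 "\<tau>1 - \<tau>" N] N t12 by auto
  \<comment> \<open>The summand 1 serves the bound of the tail by v, the square root the bound by v
    c.\<close>
  define D where "D = 4 * D3 * (1 + sqrt (2 * pi * CB))"
  have sq: "sqrt (2 * pi * CB) > 0" using CB by simp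
  have D: "D > 0" "4 * D3 \<le> D" "4 * D3 * sqrt (2 * pi * CB) \<le> D"
  proof -
    have "D = 4 * D3 + 4 * D3 * sqrt (2 * pi * CB)" unfolding D_def by (simp add: distrib_left)
    moreover have "4 * D3 * sqrt (2 * pi * CB) > 0" using D3 sq by simp
    ultimately show "D > 0" "4 * D3 \<le> D" "4 * D3 * sqrt (2 * pi * CB) \<le> D" using D3 by linarith+
  qed
  \<comment> \<open>Makes v (4 + 2 D) \<le> 1, so that 4 v \<le> 1 and D v \<le> 1/2 hold at
    once.\<close>
  define e0 where "e0 = min (min e1 1) ((1 / (4 + 2 * D)) powr (1 / \<tau>))"
  have e0: "e0 > 0" unfolding e0_def using H D by simp
  have "\<bar>real (power_free_count deg k (mean (1 + e))) / saddle_term deg k (mean (1 + e)) (1 + e) - 1\<bar> \<le> 9 * (1 + 7 * H) * (1 + 2 * D) * e powr \<tau>"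
    if e: "0 < e" "e < e0" for e
  proof -
    have ee: "e < e1" "e < 1" "e < (1 / (4 + 2 * D)) powr (1 / \<tau>)" using e unfolding e0_def by auto
    define s where "s = 1 + e"
    have s: "s > 1" "s \<le> 2" unfolding s_def using e ee by auto
    define x where "x = mean s"
    have x: "x > 0" unfolding x_def by (rule mean_pos[OF s(1)])
    define v where "v = e powr \<tau>"
    have v0: "v > 0" unfolding v_def using e by simp
    have "v \<le> 1 / (4 + 2 * D)"
    proof -
      have "v \<le> ((1 / (4 + 2 * D)) powr (1 / \<tau>)) powr \<tau>" unfolding v_def using e ee tau by (intro powr_mono2) auto
      also have "\<dots> = 1 / (4 + 2 * D)" using tau D by (simp add: powr_powr)
      finally show ?thesis .
    qed
    hence "v * (4 + 2 * D) \<le> 1" using D by (simp add: pos_le_divide_eq)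
    hence vsum: "4 * v + 2 * (D * v) \<le> 1" by (simp add: algebra_simps)
    have Dv: "D * v > 0" using D v0 by simp
    have v: "4 * v \<le> 1" "D * v \<le> 1/2" using vsum Dv v0 by linarith+
    \<comment> \<open>The mass 1 / s of \<open>cut_exp\<close> deviates from 1 by O(e); \<tau> \<le>
      1 makes this O(v).\<close>
    have ev: "e \<le> v"
    proof -
      have "e powr 1 \<le> e powr \<tau>" using e ee tau by (intro powr_mono') auto
      thus ?thesis unfolding v_def using e by simp
    qed
    interpret rv: real_variable "measure_pmf (tilted s)" "\<lambda>a. deg a - x" by (rule real_variable_pmf)
    define B where "B = var s"
    have B: "B > 0" unfolding B_def by (rule var_pos[OF s(1)])
    define c where "c = 1 / sqrt (2 * pi * B)"
    have c: "c > 0" unfolding c_def using B by simp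
    have near: "\<bar>rv.smooth_density (e powr \<tau>1) y - c\<bar> \<le> c * ((H * v) * (1 + y\<^sup>2))" for y
    proof -
      have "\<bar>rv.smooth_density (e powr \<tau>1) y * sqrt (2 * pi * B) - 1\<bar> \<le> H * v * (1 + y\<^sup>2)"
        using H(3)[OF e(1) ee(1), of y] unfolding s_def[symmetric] x_def[symmetric] B_def[symmetric] v_def .
      hence "c * \<bar>rv.smooth_density (e powr \<tau>1) y * sqrt (2 * pi * B) - 1\<bar> \<le> c * (H * v * (1 + y\<^sup>2))"
        using c by (intro mult_left_mono) auto
      moreover have "rv.smooth_density (e powr \<tau>1) y - c = c * (rv.smooth_density (e powr \<tau>1) y * sqrt (2 * pi * B) - 1)"
        unfolding c_def using B by (simp add: right_diff_distrib)
      ultimately show ?thesis using c by (simp only: abs_mult abs_of_pos)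
    qed
    define A where "A = (\<integral>a. cut_exp s (deg a - x) \<partial>measure_pmf (tilted s))"
    define tl where "tl = normal_tail (e powr \<tau>1) v"
    have eta: "e powr \<tau>1 > 0" using e by simp
    have v1: "v \<le> 1" "0 \<le> v" using v v0 by auto
    have up: "A * (1 - tl) \<le> exp (2 * s * v) * (c / s + 7 * (c * (H * v)))"
      and lo: "c / s - 7 * (c * (H * v)) \<le> exp (2 * s * v) * A + tl"
      unfolding A_def tl_def
      using rv.cut_exp_expectation_bounds[OF eta less_imp_le[OF s(1)] c v1(2,1) _ near] H v0 by simp_all
    have tl: "tl \<le> 4 * D3 * e powr N"
    proof -
      have "tl \<le> 4 * exp (- v / e powr \<tau>1)" unfolding tl_def by (rule normal_tail_le[OF eta])
      also have "- v / e powr \<tau>1 = - (1 * e powr (- (\<tau>1 - \<tau>)))"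
        unfolding v_def by (simp add: powr_diff)
      also have "4 * exp (- (1 * e powr (- (\<tau>1 - \<tau>)))) \<le> 4 * (D3 * e powr N)" using D3(2)[OF e(1)] by simp
      finally show ?thesis by simp
    qed
    have eN: "e powr N = v * e powr ((\<gamma> + 3) / 2)" unfolding N_def v_def by (rule powr_add)
    have tl1: "tl \<le> D * v"
    proof -
      have "e powr ((\<gamma> + 3) / 2) \<le> 1" using e ee g3 by (intro powr_le1) auto
      hence "v * e powr ((\<gamma> + 3) / 2) \<le> v * 1" using v0 by (intro mult_left_mono) auto
      hence "4 * D3 * e powr N \<le> 4 * D3 * v" using D3 unfolding eN by simp
      also have "\<dots> \<le> D * v" using D v0 by (intro mult_right_mono) auto
      finally show ?thesis using tl by linarith
    qed
    have tl2: "tl \<le> D * v * c"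
    proof -
      have "e powr ((\<gamma> + 3) / 2) \<le> sqrt (2 * pi * CB) * c"
      proof -
        have "2 * pi * B \<le> 2 * pi * CB * e powr (- \<gamma> - 3)"
          using CB(2)[of e] e ee unfolding B_def s_def by simp
        hence "sqrt (2 * pi * B) \<le> sqrt (2 * pi * CB * e powr (- \<gamma> - 3))" by simp
        also have "\<dots> = sqrt (2 * pi * CB) * sqrt (e powr (- \<gamma> - 3))" by (rule real_sqrt_mult)
        also have "sqrt (e powr (- \<gamma> - 3)) = e powr (- ((\<gamma> + 3) / 2))"
        proof -
          have "sqrt (e powr (- \<gamma> - 3)) = (e powr (- \<gamma> - 3)) powr (1/2)" by (simp add: powr_half_sqrt)
          also have "\<dots> = e powr ((- \<gamma> - 3) * (1/2))" by (rule powr_powr)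
          also have "(- \<gamma> - 3) * (1/2) = - ((\<gamma> + 3) / 2)" by (simp add: field_simps)
          finally show ?thesis .
        qed
        finally have "e powr ((\<gamma> + 3) / 2) * sqrt (2 * pi * B) \<le> e powr ((\<gamma> + 3) / 2) * (sqrt (2 * pi * CB) * e powr (- ((\<gamma> + 3) / 2)))"
          by (intro mult_left_mono) auto
        also have "\<dots> = sqrt (2 * pi * CB) * (e powr ((\<gamma> + 3) / 2) * e powr (- ((\<gamma> + 3) / 2)))" by (simp only: mult_ac)
        also have "e powr ((\<gamma> + 3) / 2) * e powr (- ((\<gamma> + 3) / 2)) = 1" using e by (simp add: powr_add[symmetric])
        finally have "e powr ((\<gamma> + 3) / 2) * sqrt (2 * pi * B) \<le> sqrt (2 * pi * CB)" by simp
        thus ?thesis unfolding c_def using B by (simp add: pos_le_divide_eq)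
      qed
      hence "v * e powr ((\<gamma> + 3) / 2) \<le> v * (sqrt (2 * pi * CB) * c)" using v0 by (intro mult_left_mono) auto
      hence "4 * D3 * e powr N \<le> 4 * D3 * (v * (sqrt (2 * pi * CB) * c))" unfolding eN
        by (rule mult_left_mono) (use D3 in simp)
      also have "\<dots> = (4 * D3 * sqrt (2 * pi * CB)) * (v * c)" by (simp only: mult_ac)
      also have "\<dots> \<le> D * (v * c)" using D v0 c by (intro mult_right_mono) auto
      finally show ?thesis using tl by (simp add: mult.assoc)
    qed
    have A0: "A \<ge> 0" unfolding A_def by (intro Bochner_Integration.integral_nonneg cut_exp_nonneg)
    have "\<bar>A / c - 1\<bar> \<le> 9 * (1 + 7 * H) * (1 + 2 * D) * v"
      by (rule sandwich_ratio[OF v1(2) v(1) c less_imp_le[OF s(1)] _ A0 H(1) less_imp_le[OF D(1)] v(2) tl1 tl2 up lo])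
         (use ev in \<open>simp add: s_def\<close>)
    \<comment> \<open>Undoing the tilt: A is the count divided by exp (x s) zeta(s), and c is the
      factor 1 / sqrt (2 pi B) of the saddle term.\<close>
    moreover have "A / c = real (power_free_count deg k x) / saddle_term deg k x s"
    proof -
      have Z: "zeta_real deg k s \<ge> 1" by (rule zeta_real_ge_1[OF s(1)])
      have st: "saddle_term deg k x s = exp (x * s) * zeta_real deg k s * c"
        unfolding saddle_term_def deriv2_ln_zeta[OF s(1)] c_def B_def by simp
      have "A = real (power_free_count deg k x) / (exp (x * s) * zeta_real deg k s)"
        unfolding A_def tilted_cut_exp[OF s(1) x] by (simp add: exp_minus divide_inverse mult_ac)
      thus ?thesis unfolding st by simp
    qed
    ultimately show ?thesis unfolding x_def s_def v_def by simp
  qed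
  thus ?thesis using e0 by blast
qed

text \<open>The change from e to x: by \<open>mean_upper\<close>, x \<le> C
  \<open>e powr (- (2 + \<gamma>))\<close>, so \<open>e powr \<tau>\<close> is
  O(\<open>x powr (- \<kappa>)\<close>) when \<tau> = \<kappa> (2 + \<gamma>).\<close>

lemma saddle_asymptotics:
  assumes kappa: "0 < \<kappa>" "\<kappa> < \<delta> / (2 + \<gamma>)" "\<kappa> \<le> (1 + \<gamma>) / (2 + \<gamma>)" and delta1: "\<delta> \<le> 1"
  shows "eq_times_one_plus_bigo (\<lambda>x. real (power_free_count deg k x))
           (\<lambda>x. saddle_term deg k x (saddle_point deg k x)) (\<lambda>x. x powr (-\<kappa>))"
proof -
  have g2: "2 + \<gamma> > 0" using gamma_gt by simp
  define \<tau> where "\<tau> = \<kappa> * (2 + \<gamma>)"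
  have tau: "0 < \<tau>" "\<tau> < \<delta>" "\<tau> \<le> 1 + \<gamma>" "\<tau> \<le> 1"
    using kappa g2 delta1 unfolding \<tau>_def by (auto simp: pos_less_divide_eq pos_le_divide_eq)
  obtain K e0 where K: "e0 > 0" "\<And>e. 0 < e \<Longrightarrow> e < e0 \<Longrightarrow>
     \<bar>real (power_free_count deg k (mean (1 + e))) / saddle_term deg k (mean (1 + e)) (1 + e) - 1\<bar> \<le> K * e powr \<tau>"
    using saddle_ratio[OF tau] by blast
  obtain C where C: "C > 0" "\<And>e. 0 < e \<Longrightarrow> e \<le> 1 \<Longrightarrow> mean (1 + e) \<le> C * e powr (- \<gamma> - 2)"
    using mean_upper by blast
  define e1 where "e1 = min e0 1 / 2"
  have e1: "0 < e1" "e1 < e0" "e1 < 1" unfolding e1_def using K by auto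
  define \<epsilon> where "\<epsilon> = (\<lambda>x. real (power_free_count deg k x) / saddle_term deg k x (saddle_point deg k x) - 1)"
  \<comment> \<open>As \<open>mean\<close> is strictly decreasing, x \<ge> mean (1 + e1) forces the
    saddle point to be at most 1 + e1, where the estimate in e applies.\<close>
  define X where "X = max 1 (mean (1 + e1))"
  have main: "\<bar>\<epsilon> x\<bar> \<le> \<bar>K\<bar> * C powr \<kappa> * x powr (-\<kappa>) \<and> saddle_term deg k x (saddle_point deg k x) > 0" if x: "x \<ge> X" for x
  proof -
    have x1: "x \<ge> 1" "x \<ge> mean (1 + e1)" using x unfolding X_def by auto
    define s where "s = saddle_point deg k x"
    have "saddle_eq deg k x s"
      unfolding s_def saddle_point_def by (rule theI'[OF saddle_exists_unique]) (use x1 in simp)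
    hence s: "s > 1" "mean s = x" unfolding saddle_eq_def using deriv_ln_zeta[of s] by auto
    define e where "e = s - 1"
    have e: "0 < e" "1 + e = s" unfolding e_def using s by auto
    have ee1: "e \<le> e1"
    proof (rule ccontr)
      assume "\<not> e \<le> e1"
      hence "mean (1 + e) < mean (1 + e1)" using e1 by (intro mean_strict_antimono) auto
      thus False using x1 s e by simp
    qed
    have e01: "e < e0" "e \<le> 1" using ee1 e1 by linarith+
    have "\<bar>\<epsilon> x\<bar> \<le> K * e powr \<tau>" using K(2)[OF e(1) e01(1)] s e unfolding \<epsilon>_def s_def by simp
    also have "\<dots> \<le> \<bar>K\<bar> * e powr \<tau>" by (intro mult_right_mono) auto
    also have "e powr \<tau> \<le> C powr \<kappa> * x powr (-\<kappa>)"
    proof -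
      have "x \<le> C * e powr (- (2 + \<gamma>))"
      proof -
        have "- \<gamma> - 2 = - (2 + \<gamma>)" by simp
        hence "mean s \<le> C * e powr (- (2 + \<gamma>))" using C(2)[OF e(1) e01(2)] unfolding e(2) by (simp only:)
        thus ?thesis unfolding s(2) .
      qed
      hence "x * e powr (2 + \<gamma>) \<le> C * e powr (- (2 + \<gamma>)) * e powr (2 + \<gamma>)" by (intro mult_right_mono) auto
      also have "\<dots> = C * (e powr (- (2 + \<gamma>)) * e powr (2 + \<gamma>))" by (rule mult.assoc)
      also have "e powr (- (2 + \<gamma>)) * e powr (2 + \<gamma>) = 1" using e by (simp only: powr_add[symmetric]) simp
      finally have "e powr (2 + \<gamma>) \<le> C / x" using x1 by (simp add: pos_le_divide_eq mult.commute)
      hence "(e powr (2 + \<gamma>)) powr \<kappa> \<le> (C / x) powr \<kappa>" using kappa by (intro powr_mono2) auto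
      moreover have "(e powr (2 + \<gamma>)) powr \<kappa> = e powr \<tau>" unfolding \<tau>_def by (simp add: powr_powr mult.commute)
      moreover have "(C / x) powr \<kappa> = C powr \<kappa> * x powr (-\<kappa>)" 
      proof -
        have "(C / x) powr \<kappa> = C powr \<kappa> / x powr \<kappa>" by (rule powr_divide)
        thus ?thesis by (simp add: powr_minus_divide)
      qed
      ultimately show ?thesis by simp
    qed
    finally have "\<bar>\<epsilon> x\<bar> \<le> \<bar>K\<bar> * C powr \<kappa> * x powr (-\<kappa>)" by (simp add: mult_left_mono mult.assoc)
    \<comment> \<open>Positivity lets the quotient in \<epsilon> be multiplied back to the
      count.\<close>
    moreover have "saddle_term deg k x (saddle_point deg k x) > 0"
      unfolding s_def[symmetric] saddle_term_def deriv2_ln_zeta[OF s(1)]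
      using zeta_real_ge_1[OF s(1)] var_pos[OF s(1)] by simp
    ultimately show ?thesis by simp
  qed
  show ?thesis
    unfolding eq_times_one_plus_bigo_def
  proof (intro exI[of _ \<epsilon>] conjI)
    show "\<epsilon> \<in> O(\<lambda>x. x powr (-\<kappa>))"
    proof (rule bigoI)
      show "\<forall>\<^sub>F x in at_top. norm (\<epsilon> x) \<le> \<bar>K\<bar> * C powr \<kappa> * norm (x powr (-\<kappa>))"
        using eventually_ge_at_top[of X] by eventually_elim (use main in auto)
    qed
    show "\<forall>\<^sub>F x in at_top. real (power_free_count deg k x) = saddle_term deg k x (saddle_point deg k x) * (1 + \<epsilon> x)"
      using eventually_ge_at_top[of X]
    proof eventually_elim
      case (elim x)
      thus ?case using main[OF elim] unfolding \<epsilon>_def by simp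
    qed
  qed
qed

end

section \<open>Consequences of the hypothesis on the prime count\<close>

lemma eq_times_one_plus_bigo_abs_le:
  assumes "eq_times_one_plus_bigo f (\<lambda>x. \<rho> * x powr \<gamma> * exp x) (\<lambda>x. x powr (-\<delta>))" "\<rho> > 0"
  shows "\<exists>C X. \<forall>x\<ge>X. \<bar>f x - \<rho> * x powr \<gamma> * exp x\<bar> \<le> C * x powr (\<gamma> - \<delta>) * exp x"
proof -
  obtain \<epsilon> where eps: "\<epsilon> \<in> O(\<lambda>x. x powr (-\<delta>))" "\<forall>\<^sub>F x in at_top. f x = \<rho> * x powr \<gamma> * exp x * (1 + \<epsilon> x)"
    using assms unfolding eq_times_one_plus_bigo_def by blast
  obtain c where c: "c > 0" "\<forall>\<^sub>F x in at_top. norm (\<epsilon> x) \<le> c * norm (x powr (-\<delta>))"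
    using eps(1) by (rule landau_o.bigE)
  have "\<forall>\<^sub>F x in at_top. \<bar>f x - \<rho> * x powr \<gamma> * exp x\<bar> \<le> (\<rho> * c) * x powr (\<gamma> - \<delta>) * exp x"
    using eps(2) c(2)
  proof eventually_elim
    case (elim x)
    have "f x - \<rho> * x powr \<gamma> * exp x = (\<rho> * x powr \<gamma> * exp x) * \<epsilon> x" unfolding elim(1) by (simp add: algebra_simps)
    hence "\<bar>f x - \<rho> * x powr \<gamma> * exp x\<bar> = (\<rho> * x powr \<gamma> * exp x) * \<bar>\<epsilon> x\<bar>" using assms(2) by (simp add: abs_mult)
    also have "\<dots> \<le> (\<rho> * x powr \<gamma> * exp x) * (c * x powr (-\<delta>))"
      using elim(2) assms(2) by (intro mult_left_mono) auto
    also have "\<dots> = (\<rho> * c) * (x powr \<gamma> * x powr (-\<delta>)) * exp x" by (simp only: mult_ac)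
    also have "x powr \<gamma> * x powr (-\<delta>) = x powr (\<gamma> - \<delta>)" by (simp add: powr_add[symmetric])
    finally show ?case .
  qed
  thus ?thesis by (auto simp: eventually_at_top_linorder)
qed

text \<open>Applied to the prime count it shows that there are infinitely many primes, so that they
  can be enumerated by all of \<open>nat\<close>.\<close>

lemma count_unbounded:
  assumes "eq_times_one_plus_bigo f (\<lambda>x. \<rho> * x powr \<gamma> * exp x) (\<lambda>x. x powr (-\<delta>))"
    and pos: "\<rho> > 0" "\<gamma> > -1" "\<delta> > 0"
  shows "\<exists>x. f x > M"
proof -
  obtain C X where CX: "\<And>x. x \<ge> X \<Longrightarrow> \<bar>f x - \<rho> * x powr \<gamma> * exp x\<bar> \<le> C * x powr (\<gamma> - \<delta>) * exp x"
    using eq_times_one_plus_bigo_abs_le[OF assms(1) pos(1)] by blast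
  have "((\<lambda>x. C * x powr (- \<delta>)) \<longlongrightarrow> C * 0) at_top"
    using pos by (intro tendsto_mult tendsto_const tendsto_neg_powr filterlim_ident) auto
  hence "eventually (\<lambda>x. C * x powr (- \<delta>) < \<rho> / 2) at_top"
    using pos by (auto dest!: order_tendstoD(2)[where a = "\<rho>/2"])
  then obtain X2 where X2: "\<And>x. x \<ge> X2 \<Longrightarrow> C * x powr (- \<delta>) < \<rho> / 2"
    by (auto simp: eventually_at_top_linorder)
  define x where "x = max (max X X2) (max 1 (4 * (\<bar>M\<bar> + 1) / \<rho>))"
  have x: "x \<ge> X" "x \<ge> X2" "x \<ge> 1" "x \<ge> 4 * (\<bar>M\<bar> + 1) / \<rho>" unfolding x_def by auto
  define G where "G = x powr \<gamma> * exp x"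
  \<comment> \<open>Even for negative \<gamma> the main term grows at least linearly, because
    \<gamma> > -1 and exp x \<ge> x^2 / 2.\<close>
  have G: "G \<ge> x / 2"
  proof -
    have "x powr (- 1) * (x\<^sup>2 / 2) \<le> x powr \<gamma> * exp x"
    proof (intro mult_mono)
      show "x powr (- 1) \<le> x powr \<gamma>" using x pos by (intro powr_mono) auto
      show "x\<^sup>2 / 2 \<le> exp x" using exp_lower_Taylor_quadratic[of x] x by simp
    qed auto
    moreover have "x powr (- 1) * (x\<^sup>2 / 2) = x / 2" using x by (simp add: powr_minus_divide power2_eq_square)
    ultimately show ?thesis unfolding G_def by simp
  qed
  have "C * x powr (\<gamma> - \<delta>) * exp x = (C * x powr (- \<delta>)) * G"
    unfolding G_def by (simp add: powr_diff powr_minus field_simps)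
  also have "\<dots> \<le> \<rho> / 2 * G" using X2[OF x(2)] G x by (intro mult_right_mono) auto
  finally have "C * x powr (\<gamma> - \<delta>) * exp x \<le> \<rho> / 2 * G" .
  moreover have "\<bar>f x - \<rho> * G\<bar> \<le> C * x powr (\<gamma> - \<delta>) * exp x"
    using CX[OF x(1)] unfolding G_def by (simp only: mult.assoc)
  ultimately have "f x \<ge> \<rho> * G - \<rho> / 2 * G" by (simp only: abs_le_iff) linarith
  moreover have "\<rho> * G - \<rho> / 2 * G = \<rho> / 2 * G" by simp
  moreover have "\<rho> / 2 * G \<ge> \<rho> / 2 * (x / 2)" using G pos by (intro mult_left_mono) auto
  moreover have "\<rho> / 2 * (x / 2) \<ge> \<bar>M\<bar> + 1"
  proof -
    have "4 * (\<bar>M\<bar> + 1) \<le> x * \<rho>" using x(4) pos by (simp add: pos_divide_le_eq)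
    thus ?thesis by (simp add: mult.commute)
  qed
  ultimately have "f x > M" by linarith
  thus ?thesis by blast
qed

theorem theorem1:
  fixes P :: "'a::comm_monoid_mult set" and deg :: "'a \<Rightarrow> real"
    and \<rho> \<gamma> \<delta> \<kappa> :: real and k :: nat
  assumes "additive_arithmetical_semigroup P deg"
    and "\<rho> > 0" and "\<gamma> > -1" and "0 < \<delta>" and "\<delta> \<le> 1"
    and "eq_times_one_plus_bigo (\<lambda>x. real (prime_count P deg x))
           (\<lambda>x. \<rho> * x powr \<gamma> * exp x) (\<lambda>x. x powr (-\<delta>))"
    and "k \<ge> 2"
    and "\<kappa> > 0" and "\<kappa> < \<delta> / (2 + \<gamma>)" and "\<kappa> \<le> (1 + \<gamma>) / (2 + \<gamma>)"
  shows "(\<forall>x>0. \<exists>!s. saddle_eq deg k x s) \<and>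
         eq_times_one_plus_bigo (\<lambda>x. real (power_free_count deg k x))
           (\<lambda>x. saddle_term deg k x (saddle_point deg k x)) (\<lambda>x. x powr (-\<kappa>))"
proof -
  interpret additive_arithmetical_semigroup P deg by fact
  have inf: "infinite P"
  proof
    assume fin: "finite P"
    obtain x where "real (prime_count P deg x) > real (card P)"
      using count_unbounded[OF assms(6,2,3,4)] by blast
    moreover have "prime_count P deg x \<le> card P" unfolding prime_count_def using fin by (intro card_mono) auto
    ultimately show False by simp
  qed
  define p where "p = from_nat_into P"
  have bij: "bij_betw p UNIV P" unfolding p_def using countable_primes inf by (rule bij_betw_from_nat_into)
  have inj: "inj p" and ran: "range p = P" using bij by (auto simp: bij_betw_def)
  have img: "p ` {n. deg (p n) \<le> x} = {q \<in> P. deg q \<le> x}" for x using ran by auto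
  have card: "card {n. deg (p n) \<le> x} = prime_count P deg x" for x
    unfolding prime_count_def img[symmetric] using inj by (intro card_image[symmetric]) (auto intro: inj_on_subset)
  have fin: "finite {n. deg (p n) \<le> x}" for x
  proof (rule finite_imageD[of p])
    \<comment> \<open>\<open>finite_deg_le\<close> asks for a positive bound, hence the maximum with
      1.\<close>
    have "{q \<in> P. deg q \<le> x} \<subseteq> {a. deg a \<le> max x 1}" by auto
    moreover have "finite {a. deg a \<le> max x 1}" by (rule finite_deg_le) auto
    ultimately show "finite (p ` {n. deg (p n) \<le> x})" unfolding img by (rule finite_subset)
    show "inj_on p {n. deg (p n) \<le> x}" using inj by (auto intro: inj_on_subset)
  qed
  interpret deg_seq: degree_sequence "\<lambda>n. deg (p n)" \<rho> \<gamma> \<delta>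
  proof
    show "deg (p n) > 0" for n using ran by (intro deg_prime_pos) auto
    show "\<exists>C X. \<forall>x\<ge>X. \<bar>real (card {n. deg (p n) \<le> x}) - \<rho> * x powr \<gamma> * exp x\<bar> \<le> C * x powr (\<gamma> - \<delta>) * exp x"
      unfolding card using assms(6,2) by (rule eq_times_one_plus_bigo_abs_le)
  qed (use assms fin in auto)
  interpret power_free_saddle P deg k p \<rho> \<gamma> \<delta>
  proof
    show "summable (\<lambda>n. exp (- deg (p n) * s))" if "s > 1" for s
      using deg_seq.summable_moment[OF that, of 0] by simp
  qed (use assms bij in auto)
  show ?thesis
    using saddle_exists_unique saddle_asymptotics[OF assms(8,9,10,5)] by blast
qed

end
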